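(* If $\mathcal P=(\Delta,\mathcal F)$ is a simple lattice multi-polytope, then $$\int_\Delta e^{c_1(\mathcal P)}\,\mathcal T(\Delta)=\sharp(\mathcal P).$$
   Context: **Multi-fans.** Let $N$ be a lattice of rank $n$ and $N_{\mathbb R}=N\otimes\mathbb R$. A cone in $N$ is a strongly convex rational polyhedral cone in $N_{\mathbb R}$ (the set of nonnegative real combinations of finitely many vectors of $N$, containing no line). $\mathrm{Cone}(N)$ is the set of all cones, partially ordered by $\tau\prec\sigma$ iff $\tau$ is a proper face of $\sigma$. A multi-fan of dimension $n$ in $N$ is a triple $\Delta=(\Sigma,C,w^{\pm})$ where $\Sigma$ is a finite partially ordered set with a unique minimum element $*$; $C:\Sigma\to\mathrm{Cone}(N)$ is a map with (1) $C( * )=\{0\}$, (2) $I<J$ implies $C(I)\prec C(J)$, (3) for each $J\in\Sigma$, $C$ restricts to an isomorphism of ordered sets from $\{I\in\Sigma: I\le J\}$ onto $\{\kappa\in\mathrm{Cone}(N):\kappa\preceq C(J)\}$; and, with $\Sigma^{(m)}=\{I\in\Sigma:\dim C(I)=m\}$ (write $|I|=m$ for $I\in\Sigma^{(m)}$), $w^+,w^-:\Sigma^{(n)}\to\mathbb Z_{\ge0}$ are functions such that $w^+(I)>0$ or $w^-(I)>0$ for each $I$. Put $w=w^+-w^-$. A vector $v\in N_{\mathbb R}$ is generic if it lies on no linear subspace spanned by a cone $C(I)$ of dimension $<n$. $\Delta$ is pre-complete if $\Sigma^{(n)}\ne\emptyset$ and $d_v=\sum_{v\in C(I),\,I\in\Sigma^{(n)}}w(I)$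 is independent of the generic vector $v$. For $K\in\Sigma$ the projected multi-fan $\Delta_K=(\Sigma_K,C_K,w_K^\pm)$ has $\Sigma_K=\{J\in\Sigma:K\le J\}$, $C_K(J)$ = the image of $C(J)$ in the quotient of $N_{\mathbb R}$ by the span of $C(K)$ (with lattice the quotient of $N$ by the subgroup generated by $C(K)\cap N$), and $w_K^\pm$ the restrictions of $w^\pm$. $\Delta$ is complete if $\Delta$ and all $\Delta_K$, $K\in\Sigma$, are pre-complete. $\Delta$ is simplicial if every $C(I)$ is generated by linearly independent vectors; then $\Sigma$ is identified with an augmented simplicial set (abstract simplicial complex including the empty set as minimum) of subsets of $\{1,\dots,d\}$ with $\Sigma^{(1)}=\{\{1\},\dots,\{d\}\}$, and $|I|$ is the cardinality of $I$. **Multi-polytopes.** Put $V=N_{\mathbb R}$, $V^*=\mathrm{Hom}(V,\mathbb R)$, $N^*=\mathrm{Hom}(N,\mathbb Z)\subset V^*$. A multi-polytope is a pair $\mathcal P=(\Delta,\mathcal F)$ where $\Delta$ is a complete multi-fan and $\mathcal F$ assigns to each $I\in\Sigma^{(1)}$ an affine hyperplane $\mathcal F(I)\subset V^*$ on which the elements of $C(I)$ are constant. It is simple if $\Delta$ is simplicial. For simple $\mathcal P$ let $v_i$ be the primitive vector of $N$ in $C(\{i\})$ and write $F_i=\mathcal F(\{i\})=\{u\in V^*:\langle u,v_i\rangle=c_i\}$, $c_i\in\mathbb R$. For $I\in\Sigma^{(n)}$, $\bigcap_{i\in I}F_i$ is a point $u_I$ (a vertex); $\{u_i^I\}_{i\in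 I}\subset V^*$ is the basis dual to $\{v_i\}_{i\in I}$. $\mathcal P$ is a lattice multi-polytope if every vertex $u_I$ lies in $N^*$. **Duistermaat-Heckman function and $\sharp(\mathcal P)$.** Fix a generic $v\in V$. For $I\in\Sigma^{(n)}$ put $(-1)^I=(-1)^{\sharp\{i\in I:\langle u_i^I,v\rangle>0\}}$, $(u_i^I)^+=u_i^I$ if $\langle u_i^I,v\rangle>0$ and $-u_i^I$ if $\langle u_i^I,v\rangle<0$; let $\phi_I$ be the characteristic function of the cone with apex $u_I$ spanned by the $(u_i^I)^+$, $i\in I$. Then $\mathrm{DH}_{\mathcal P}=\sum_{I\in\Sigma^{(n)}}(-1)^Iw(I)\phi_I$ on $V^*\setminus\bigcup_iF_i$ (it is independent of $v$ and has bounded support). $\mathcal P_+$ is obtained from $\mathcal P$ by replacing each $c_i$ by $c_i+\varepsilon$ for sufficiently small $\varepsilon>0$ (the moved hyperplanes miss $N^*$), and $\sharp(\mathcal P)=\sum_{u\in N^*}\mathrm{DH}_{\mathcal P_+}(u)$. **Cohomology of $\Delta$.** Let $T$ be a compact torus of dimension $n$ and identify $N=H_2(BT)=\mathrm{Hom}(S^1,T)$, $N^*=H^2(BT)$, so $H^*(BT;\mathbb Q)$ is the symmetric algebra of $N^*\otimes\mathbb Q$ (in degree 2). For $\Delta$ complete simplicial, $H_T^*(\Delta)=\mathbb Z[x_1,\dots,x_d]/(x_I: I\notin\Sigma)$, where $x_I=\prod_{i\in I}x_i$, $I\subset\{1,\dots,d\}$, $\deg x_i=2$. It is an algebra over $H^*(BT)$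 via $\pi^*(u)=\sum_{i=1}^d\langle u,v_i\rangle x_i$ for $u\in H^2(BT)$. $H^*(\Delta)$ is the quotient of $H_T^*(\Delta)$ by the ideal generated by $\pi^*(H^2(BT))$; $\bar x_i$ is the image of $x_i$. For $I\in\Sigma^{(n)}$, $\iota_I^*:H_T^*(\Delta)\otimes\mathbb Q\to H^*(BT;\mathbb Q)$ is the ring homomorphism with $\iota_I^*(x_i)=u_i^I$ if $i\in I$ and $0$ otherwise. Let $\eta:\mathbb R^d\to N_{\mathbb R}$, $\eta(a)=\sum_ia_iv_i$, and let $G_I\subset\mathbb R^d/\mathbb Z^d$ be the (finite) image of $\{a\in\mathbb R^d:\eta(a)\in N,\ a_j=0\text{ for }j\notin I\}$; $G_I\cong N/N_I$ with $N_I$ generated by $v_i$, $i\in I$. Put $G_\Delta=\bigcup_{I\in\Sigma^{(n)}}G_I$ and $\rho_i([a])=\exp(2\pi\sqrt{-1}a_i)$ on $\mathbb R^d/\mathbb Z^d$. The index map $\pi_!(x)=\sum_{I\in\Sigma^{(n)}}\frac{w(I)\,\iota_I^*(x)}{|G_I|\prod_{i\in I}u_i^I}$ maps $H_T^*(\Delta)\otimes\mathbb Q$ into $H^*(BT;\mathbb Q)$, lowers degree by $2n$, is $H^*(BT;\mathbb Q)$-linear, and hence induces $\int_\Delta:H^*(\Delta)\otimes\mathbb Q\to\mathbb Q$, which vanishes outside degree $2n$ (extended to $\mathbb R$ coefficients and to $H^{**}(\Delta)$, the direct product of the graded pieces). The first Chern class is $c_1(\mathcal P)=\sum_ic_i\bar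 x_i\in H^2(\Delta)\otimes\mathbb R$ and the Todd class is $\mathcal T(\Delta)=\sum_{g\in G_\Delta}\prod_{i=1}^d\frac{\bar x_i}{1-\rho_i(g)e^{-\bar x_i}}\in H^{**}(\Delta)\otimes\mathbb Q$ (each factor understood via its Maclaurin expansion). *)

theory Defs
  imports
    "HOL-Analysis.Analysis"
    "HOL-Algebra.QuotRing"
    "HOL-Library.Poly_Mapping"
    "HOL-Computational_Algebra.Formal_Power_Series"
begin

section \<open>Lattices and cones\<close>

text \<open>
  A lattice \<open>N\<close> is the integer span of a linearly independent set in a Euclidean space, and
  \<open>N\<^sub>\<real>\<close> is its real span, which need not be the whole space; so the rank may be 0, and quotient
  lattices can be realised in the same type. The inner product identifies the dual space
  \<open>Hom(N\<^sub>\<real>, \<real>)\<close> with \<open>span N\<close>: the pairing of \<open>u\<close> and \<open>v\<close> is \<open>u \<bullet> v\<close>.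
\<close>

definition is_lattice :: "'a::euclidean_space set \<Rightarrow> bool" where
  "is_lattice N \<longleftrightarrow>
     (\<exists>B. independent B \<and> N = {\<Sum>b\<in>B. of_int (c b) *\<^sub>R b | c :: 'a \<Rightarrow> int. True})"

definition dual_lattice :: "'a::euclidean_space set \<Rightarrow> 'a set" where
  "dual_lattice N = {u \<in> span N. \<forall>x\<in>N. u \<bullet> x \<in> \<int>}"

definition nonneg_hull :: "'a::euclidean_space set \<Rightarrow> 'a set" where
  "nonneg_hull S = {\<Sum>s\<in>S. c s *\<^sub>R s | c :: 'a \<Rightarrow> real. \<forall>s\<in>S. 0 \<le> c s}"

definition is_cone :: "'a::euclidean_space set \<Rightarrow> 'a set \<Rightarrow> bool" where
  "is_cone N \<kappa> \<longleftrightarrow>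
     (\<exists>S. finite S \<and> S \<subseteq> N \<and> \<kappa> = nonneg_hull S) \<and> (\<forall>x. x \<in> \<kappa> \<and> - x \<in> \<kappa> \<longrightarrow> x = 0)"

section \<open>Multi-fans\<close>

text \<open>The finite partially ordered set is \<open>faces\<close>, with the order of its element type.\<close>

record ('a, 'i) multi_fan =
  lat :: "'a set"
  faces :: "'i set"
  cone_of :: "'i \<Rightarrow> 'a set"
  wplus :: "'i \<Rightarrow> nat"
  wminus :: "'i \<Rightarrow> nat"

definition fan_dim :: "('a::euclidean_space, 'i) multi_fan \<Rightarrow> nat" where
  "fan_dim \<Delta> = dim (span (lat \<Delta>))"

definition faces_dim :: "('a::euclidean_space, 'i) multi_fan \<Rightarrow> nat \<Rightarrow> 'i set" where
  "faces_dim \<Delta> m = {I \<in> faces \<Delta>. dim (cone_of \<Delta> I) = m}"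

abbreviation facets :: "('a::euclidean_space, 'i) multi_fan \<Rightarrow> 'i set" where
  "facets \<Delta> \<equiv> faces_dim \<Delta> (fan_dim \<Delta>)"

definition weight :: "('a, 'i) multi_fan \<Rightarrow> 'i \<Rightarrow> int" where
  "weight \<Delta> I = int (wplus \<Delta> I) - int (wminus \<Delta> I)"

definition is_multi_fan :: "('a::euclidean_space, 'i::order) multi_fan \<Rightarrow> bool" where
  "is_multi_fan \<Delta> \<longleftrightarrow>
     is_lattice (lat \<Delta>) \<and>
     finite (faces \<Delta>) \<and>
     (\<forall>I\<in>faces \<Delta>. is_cone (lat \<Delta>) (cone_of \<Delta> I)) \<and>
     (\<exists>s\<in>faces \<Delta>. (\<forall>I\<in>faces \<Delta>. s \<le> I) \<and> cone_of \<Delta> s = {0}) \<and>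
     (\<forall>I\<in>faces \<Delta>. \<forall>J\<in>faces \<Delta>. I < J \<longrightarrow>
        cone_of \<Delta> I face_of cone_of \<Delta> J \<and> cone_of \<Delta> I \<noteq> cone_of \<Delta> J) \<and>
     (\<forall>J\<in>faces \<Delta>.
        bij_betw (cone_of \<Delta>) {I \<in> faces \<Delta>. I \<le> J}
          {\<kappa>. is_cone (lat \<Delta>) \<kappa> \<and> \<kappa> face_of cone_of \<Delta> J} \<and>
        (\<forall>I\<in>faces \<Delta>. \<forall>I'\<in>faces \<Delta>. I \<le> J \<and> I' \<le> J \<longrightarrow>
           (I \<le> I' \<longleftrightarrow> cone_of \<Delta> I face_of cone_of \<Delta> I'))) \<and>
     (\<forall>I\<in>facets \<Delta>. wplus \<Delta> I > 0 \<or> wminus \<Delta> I > 0)"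

definition generic :: "('a::euclidean_space, 'i) multi_fan \<Rightarrow> 'a \<Rightarrow> bool" where
  "generic \<Delta> v \<longleftrightarrow>
     v \<in> span (lat \<Delta>) \<and>
     (\<forall>I\<in>faces \<Delta>. dim (cone_of \<Delta> I) < fan_dim \<Delta> \<longrightarrow> v \<notin> span (cone_of \<Delta> I))"

definition deg_at :: "('a::euclidean_space, 'i) multi_fan \<Rightarrow> 'a \<Rightarrow> int" where
  "deg_at \<Delta> v = (\<Sum>I | I \<in> facets \<Delta> \<and> v \<in> cone_of \<Delta> I. weight \<Delta> I)"

definition pre_complete :: "('a::euclidean_space, 'i) multi_fan \<Rightarrow> bool" where
  "pre_complete \<Delta> \<longleftrightarrow>
     facets \<Delta> \<noteq> {} \<and> (\<forall>v v'. generic \<Delta> v \<and> generic \<Delta> v' \<longrightarrow> deg_at \<Delta> v = deg_at \<Delta> v')"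

text \<open>
  The quotient of \<open>N\<^sub>\<real>\<close> by a subspace \<open>U\<close> is realised as the orthogonal complement of \<open>U\<close> in
  \<open>N\<^sub>\<real>\<close>, with orthogonal projection along \<open>U\<close> as the quotient map.
\<close>

definition quot_map :: "'a::euclidean_space set \<Rightarrow> 'a \<Rightarrow> 'a" where
  "quot_map U x = (THE y. y \<in> orthogonal_comp U \<and> x - y \<in> U)"

definition projected ::
  "('a::euclidean_space, 'i::order) multi_fan \<Rightarrow> 'i \<Rightarrow> ('a, 'i) multi_fan" where
  "projected \<Delta> K =
     \<lparr> lat = quot_map (span (cone_of \<Delta> K)) ` lat \<Delta>,
       faces = {J \<in> faces \<Delta>. K \<le> J},
       cone_of = (\<lambda>J. quot_map (span (cone_of \<Delta> K)) ` cone_of \<Delta> J),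
       wplus = wplus \<Delta>,
       wminus = wminus \<Delta> \<rparr>"

definition complete_fan :: "('a::euclidean_space, 'i::order) multi_fan \<Rightarrow> bool" where
  "complete_fan \<Delta> \<longleftrightarrow>
     is_multi_fan \<Delta> \<and> pre_complete \<Delta> \<and> (\<forall>K\<in>faces \<Delta>. pre_complete (projected \<Delta> K))"

text \<open>\<open>nrays \<Delta>\<close> is the number \<open>d\<close> of one-dimensional cones.\<close>

definition nrays :: "('a::euclidean_space, 'i) multi_fan \<Rightarrow> nat" where
  "nrays \<Delta> = card (faces_dim \<Delta> 1)"

text \<open>
  A simplicial multi-fan is presented with its index set identified with an abstract simplicial
  complex on the vertex set \<open>{1..d}\<close> (containing the empty set), ordered by inclusion.
\<close>

definition simplicial_fan :: "('a::euclidean_space, nat set) multi_fan \<Rightarrow> bool" where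
  "simplicial_fan \<Delta> \<longleftrightarrow>
     (\<forall>I\<in>faces \<Delta>. \<exists>B. independent B \<and> cone_of \<Delta> I = nonneg_hull B) \<and>
     (\<forall>I\<in>faces \<Delta>. I \<subseteq> {1..nrays \<Delta>}) \<and>
     (\<forall>I\<in>faces \<Delta>. \<forall>J. J \<subseteq> I \<longrightarrow> J \<in> faces \<Delta>) \<and>
     faces_dim \<Delta> 1 = (\<lambda>i. {i}) ` {1..nrays \<Delta>}"

section \<open>Multi-polytopes\<close>

definition affine_hyperplane :: "'a::euclidean_space set \<Rightarrow> 'a set \<Rightarrow> bool" where
  "affine_hyperplane V H \<longleftrightarrow> (\<exists>a\<in>V. \<exists>c. a \<noteq> 0 \<and> H = {u \<in> V. u \<bullet> a = c})"

definition multi_polytope ::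
  "('a::euclidean_space, 'i::order) multi_fan \<Rightarrow> ('i \<Rightarrow> 'a set) \<Rightarrow> bool" where
  "multi_polytope \<Delta> F \<longleftrightarrow>
     complete_fan \<Delta> \<and>
     (\<forall>I\<in>faces_dim \<Delta> 1.
        affine_hyperplane (span (lat \<Delta>)) (F I) \<and>
        (\<forall>x\<in>cone_of \<Delta> I. \<exists>c. \<forall>u\<in>F I. u \<bullet> x = c))"

definition simple_multi_polytope ::
  "('a::euclidean_space, nat set) multi_fan \<Rightarrow> (nat set \<Rightarrow> 'a set) \<Rightarrow> bool" where
  "simple_multi_polytope \<Delta> F \<longleftrightarrow> multi_polytope \<Delta> F \<and> simplicial_fan \<Delta>"

text \<open>The primitive vector \<open>v\<^sub>i\<close> of the ray \<open>C({i})\<close>.\<close>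

definition ray_vec :: "('a::euclidean_space, nat set) multi_fan \<Rightarrow> nat \<Rightarrow> 'a" where
  "ray_vec \<Delta> i =
     (THE v. v \<in> lat \<Delta> \<and> v \<in> cone_of \<Delta> {i} \<and> v \<noteq> 0 \<and>
        (\<forall>(k::nat). \<forall>x\<in>lat \<Delta>. v = of_nat k *\<^sub>R x \<longrightarrow> k = 1))"

text \<open>The constant \<open>c\<^sub>i\<close> in the equation of the hyperplane \<open>F\<^sub>i\<close>.\<close>

definition offset ::
  "('a::euclidean_space, nat set) multi_fan \<Rightarrow> (nat set \<Rightarrow> 'a set) \<Rightarrow> nat \<Rightarrow> real" where
  "offset \<Delta> F i = (THE c. F {i} = {u \<in> span (lat \<Delta>). u \<bullet> ray_vec \<Delta> i = c})"

definition vertex ::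
  "('a::euclidean_space, nat set) multi_fan \<Rightarrow> (nat set \<Rightarrow> 'a set) \<Rightarrow> nat set \<Rightarrow> 'a" where
  "vertex \<Delta> F I = (THE u. u \<in> span (lat \<Delta>) \<and> (\<forall>i\<in>I. u \<in> F {i}))"

text \<open>\<open>dual_vec \<Delta> I i\<close> is the member \<open>u\<^sub>i\<^sup>I\<close> of the basis dual to \<open>(v\<^sub>j)\<close>, \<open>j \<in> I\<close>.\<close>

definition dual_vec :: "('a::euclidean_space, nat set) multi_fan \<Rightarrow> nat set \<Rightarrow> nat \<Rightarrow> 'a" where
  "dual_vec \<Delta> I i =
     (THE u. u \<in> span (lat \<Delta>) \<and> (\<forall>j\<in>I. u \<bullet> ray_vec \<Delta> j = (if j = i then 1 else 0)))"

definition lattice_multi_polytope ::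
  "('a::euclidean_space, nat set) multi_fan \<Rightarrow> (nat set \<Rightarrow> 'a set) \<Rightarrow> bool" where
  "lattice_multi_polytope \<Delta> F \<longleftrightarrow> (\<forall>I\<in>facets \<Delta>. vertex \<Delta> F I \<in> dual_lattice (lat \<Delta>))"

section \<open>The Duistermaat-Heckman function and the lattice point count\<close>

definition dual_vec_plus ::
  "('a::euclidean_space, nat set) multi_fan \<Rightarrow> 'a \<Rightarrow> nat set \<Rightarrow> nat \<Rightarrow> 'a" where
  "dual_vec_plus \<Delta> v I i =
     (if dual_vec \<Delta> I i \<bullet> v > 0 then dual_vec \<Delta> I i else - dual_vec \<Delta> I i)"

definition DH ::
  "('a::euclidean_space, nat set) multi_fan \<Rightarrow> (nat set \<Rightarrow> 'a set) \<Rightarrow> 'a \<Rightarrow> 'a \<Rightarrow> int" where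
  "DH \<Delta> F v u =
     (\<Sum>I\<in>facets \<Delta>. (- 1) ^ card {i \<in> I. dual_vec \<Delta> I i \<bullet> v > 0} * weight \<Delta> I *
        indicator ((\<lambda>x. vertex \<Delta> F I + x) ` nonneg_hull (dual_vec_plus \<Delta> v I ` I)) u)"

definition shifted ::
  "('a::euclidean_space, nat set) multi_fan \<Rightarrow> (nat set \<Rightarrow> 'a set) \<Rightarrow> real \<Rightarrow> nat set \<Rightarrow> 'a set"
  where
  "shifted \<Delta> F \<epsilon> R =
     {u \<in> span (lat \<Delta>). u \<bullet> ray_vec \<Delta> (the_elem R) = offset \<Delta> F (the_elem R) + \<epsilon>}"

text \<open>
  The number \<open>\<sharp>(\<P>)\<close>, computed with the generic vector \<open>v\<close>: the common value, for all sufficiently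
  small positive \<open>\<epsilon>\<close>, of the sum over the dual lattice of the function \<open>DH\<close> of the polytope with
  every \<open>c\<^sub>i\<close> replaced by \<open>c\<^sub>i + \<epsilon>\<close>. For small \<open>\<epsilon>\<close> no moved hyperplane meets the dual lattice,
  and the sum has finite support.
\<close>

definition sharp ::
  "('a::euclidean_space, nat set) multi_fan \<Rightarrow> (nat set \<Rightarrow> 'a set) \<Rightarrow> 'a \<Rightarrow> int" where
  "sharp \<Delta> F v =
     (THE m. \<forall>\<^sub>F \<epsilon> in at_right (0::real).
        m = (\<Sum>\<^sub>\<infinity>u\<in>dual_lattice (lat \<Delta>). DH \<Delta> (shifted \<Delta> F \<epsilon>) v u))"

section \<open>Cohomology\<close>

text \<open>
  All cohomology is taken with complex coefficients, because the factors of the Todd class have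
  complex coefficients. Extending scalars commutes with the two quotients
  \<open>HT\<close> (the face ring \<open>H\<^sub>T\<^sup>*(\<Delta>)\<close>) and \<open>HH\<close> (the ring \<open>H\<^sup>*(\<Delta>)\<close>).
\<close>

type_synonym mpoly = "(nat \<Rightarrow>\<^sub>0 nat) \<Rightarrow>\<^sub>0 complex"

definition mvar :: "nat \<Rightarrow> mpoly" where
  "mvar i = Poly_Mapping.single (Poly_Mapping.single i 1) 1"

definition mconst :: "complex \<Rightarrow> mpoly" where
  "mconst c = Poly_Mapping.single 0 c"

definition mdeg :: "(nat \<Rightarrow>\<^sub>0 nat) \<Rightarrow> nat" where
  "mdeg m = (\<Sum>i\<in>Poly_Mapping.keys m. Poly_Mapping.lookup m i)"

definition mpoly_eval :: "(nat \<Rightarrow> complex) \<Rightarrow> mpoly \<Rightarrow> complex" where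
  "mpoly_eval f p =
     (\<Sum>m\<in>Poly_Mapping.keys p. Poly_Mapping.lookup p m *
        (\<Prod>i\<in>Poly_Mapping.keys m. f i ^ Poly_Mapping.lookup m i))"

definition poly_ring :: "nat \<Rightarrow> mpoly ring" where
  "poly_ring d =
     \<lparr> carrier = {p. \<forall>m\<in>Poly_Mapping.keys p. Poly_Mapping.keys m \<subseteq> {1..d}},
       mult = (*), one = 1, zero = 0, add = (+) \<rparr>"

definition SR_ideal :: "('a::euclidean_space, nat set) multi_fan \<Rightarrow> mpoly set" where
  "SR_ideal \<Delta> =
     Idl\<^bsub>poly_ring (nrays \<Delta>)\<^esub> {\<Prod>i\<in>I. mvar i | I. I \<subseteq> {1..nrays \<Delta>} \<and> I \<notin> faces \<Delta>}"

definition HT :: "('a::euclidean_space, nat set) multi_fan \<Rightarrow> mpoly set ring" where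
  "HT \<Delta> = poly_ring (nrays \<Delta>) Quot SR_ideal \<Delta>"

definition HT_class :: "('a::euclidean_space, nat set) multi_fan \<Rightarrow> mpoly \<Rightarrow> mpoly set" where
  "HT_class \<Delta> p = SR_ideal \<Delta> +>\<^bsub>poly_ring (nrays \<Delta>)\<^esub> p"

definition pi_star :: "('a::euclidean_space, nat set) multi_fan \<Rightarrow> 'a \<Rightarrow> mpoly set" where
  "pi_star \<Delta> u =
     HT_class \<Delta> (\<Sum>i\<in>{1..nrays \<Delta>}. mconst (complex_of_real (u \<bullet> ray_vec \<Delta> i)) * mvar i)"

definition lin_ideal :: "('a::euclidean_space, nat set) multi_fan \<Rightarrow> mpoly set set" where
  "lin_ideal \<Delta> = Idl\<^bsub>HT \<Delta>\<^esub> (pi_star \<Delta> ` dual_lattice (lat \<Delta>))"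

definition HH :: "('a::euclidean_space, nat set) multi_fan \<Rightarrow> mpoly set set ring" where
  "HH \<Delta> = HT \<Delta> Quot lin_ideal \<Delta>"

definition HH_class :: "('a::euclidean_space, nat set) multi_fan \<Rightarrow> mpoly \<Rightarrow> mpoly set set" where
  "HH_class \<Delta> p = lin_ideal \<Delta> +>\<^bsub>HT \<Delta>\<^esub> HT_class \<Delta> p"

text \<open>The piece of cohomological degree \<open>2k\<close>; each \<open>x\<^sub>i\<close> has degree 2.\<close>

definition HH_piece ::
  "('a::euclidean_space, nat set) multi_fan \<Rightarrow> nat \<Rightarrow> mpoly set set set" where
  "HH_piece \<Delta> k =
     HH_class \<Delta> ` {p \<in> carrier (poly_ring (nrays \<Delta>)). \<forall>m\<in>Poly_Mapping.keys p. mdeg m = k}"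

text \<open>\<open>H\<^sup>*\<^sup>*(\<Delta>)\<close>: the component at \<open>k\<close> of an element lies in cohomological degree \<open>2k\<close>.\<close>

definition HHH :: "('a::euclidean_space, nat set) multi_fan \<Rightarrow> (nat \<Rightarrow> mpoly set set) ring" where
  "HHH \<Delta> =
     \<lparr> carrier = {f. \<forall>k. f k \<in> HH_piece \<Delta> k},
       mult = (\<lambda>f g k. (\<Oplus>\<^bsub>HH \<Delta>\<^esub>j\<in>{..k}. f j \<otimes>\<^bsub>HH \<Delta>\<^esub> g (k - j))),
       one = (\<lambda>k. if k = 0 then \<one>\<^bsub>HH \<Delta>\<^esub> else \<zero>\<^bsub>HH \<Delta>\<^esub>),
       zero = (\<lambda>k. \<zero>\<^bsub>HH \<Delta>\<^esub>),
       add = (\<lambda>f g k. f k \<oplus>\<^bsub>HH \<Delta>\<^esub> g k) \<rparr>"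

text \<open>Substitution of an element \<open>y\<close> of degree 2 into a power series in one variable.\<close>

definition fps_subst ::
  "('a::euclidean_space, nat set) multi_fan \<Rightarrow> complex fps \<Rightarrow> mpoly set set \<Rightarrow>
     nat \<Rightarrow> mpoly set set" where
  "fps_subst \<Delta> a y = (\<lambda>k. HH_class \<Delta> (mconst (fps_nth a k)) \<otimes>\<^bsub>HH \<Delta>\<^esub> (y [^]\<^bsub>HH \<Delta>\<^esub> k))"

section \<open>The groups \<open>G\<^sub>I\<close>\<close>

text \<open>
  \<open>\<real>\<^sup>d\<close> is the space of functions on \<open>nat\<close> vanishing off \<open>{1..d}\<close>; an element of \<open>\<real>\<^sup>d / \<int>\<^sup>d\<close> is a
  coset of the integer points.
\<close>

definition real_space :: "nat \<Rightarrow> (nat \<Rightarrow> real) set" where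
  "real_space d = {a. \<forall>i. i \<notin> {1..d} \<longrightarrow> a i = 0}"

definition torus_class :: "nat \<Rightarrow> (nat \<Rightarrow> real) \<Rightarrow> (nat \<Rightarrow> real) set" where
  "torus_class d a = {b \<in> real_space d. \<forall>i. b i - a i \<in> \<int>}"

definition eta :: "('a::euclidean_space, nat set) multi_fan \<Rightarrow> (nat \<Rightarrow> real) \<Rightarrow> 'a" where
  "eta \<Delta> a = (\<Sum>i\<in>{1..nrays \<Delta>}. a i *\<^sub>R ray_vec \<Delta> i)"

definition GI :: "('a::euclidean_space, nat set) multi_fan \<Rightarrow> nat set \<Rightarrow> (nat \<Rightarrow> real) set set" where
  "GI \<Delta> I =
     torus_class (nrays \<Delta>) `
       {a \<in> real_space (nrays \<Delta>). eta \<Delta> a \<in> lat \<Delta> \<and> (\<forall>j. j \<notin> I \<longrightarrow> a j = 0)}"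

definition G_fan :: "('a::euclidean_space, nat set) multi_fan \<Rightarrow> (nat \<Rightarrow> real) set set" where
  "G_fan \<Delta> = (\<Union>I\<in>facets \<Delta>. GI \<Delta> I)"

definition rho :: "nat \<Rightarrow> (nat \<Rightarrow> real) set \<Rightarrow> complex" where
  "rho i g = the_elem ((\<lambda>a. exp (2 * complex_of_real pi * \<i> * complex_of_real (a i))) ` g)"

section \<open>The index map and the integral\<close>

text \<open>
  \<open>H\<^sup>*(BT; \<complex>)\<close>, the symmetric algebra of the complexified dual space, is realised as the ring of
  complex polynomial functions on \<open>N\<^sub>\<real>\<close>, an element \<open>u\<close> of the dual space acting by \<open>v \<mapsto> u \<bullet> v\<close>.
  The degree 0 component of a polynomial function is its value at the origin.
\<close>

definition HBT :: "'a::euclidean_space set \<Rightarrow> ('a \<Rightarrow> complex) set" where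
  "HBT N = {restrict p (span N) | p. polynomial_function p}"

definition iota :: "('a::euclidean_space, nat set) multi_fan \<Rightarrow> nat set \<Rightarrow> mpoly set \<Rightarrow> 'a \<Rightarrow> complex"
  where
  "iota \<Delta> I X v =
     the_elem (mpoly_eval
       (\<lambda>i. if i \<in> I then complex_of_real (dual_vec \<Delta> I i \<bullet> v) else 0) ` X)"

text \<open>
  The defining formula of the index map is a sum of rational functions, which is evaluated off the
  zero sets of the denominators; the polynomial function is determined by its values there.
\<close>

definition index_map ::
  "('a::euclidean_space, nat set) multi_fan \<Rightarrow> mpoly set \<Rightarrow> 'a \<Rightarrow> complex" where
  "index_map \<Delta> X =
     (THE f. f \<in> HBT (lat \<Delta>) \<and>
        (\<forall>v\<in>span (lat \<Delta>). (\<forall>I\<in>facets \<Delta>. \<forall>i\<in>I. dual_vec \<Delta> I i \<bullet> v \<noteq> 0) \<longrightarrow>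
           f v = (\<Sum>I\<in>facets \<Delta>. of_int (weight \<Delta> I) * iota \<Delta> I X v /
                    (of_nat (card (GI \<Delta> I)) *
                     (\<Prod>i\<in>I. complex_of_real (dual_vec \<Delta> I i \<bullet> v))))))"

text \<open>
  The map induced by the index map on \<open>H\<^sup>*(\<Delta>)\<close>, an element of which is a set of elements of
  \<open>H\<^sub>T\<^sup>*(\<Delta>)\<close>: the target \<open>H\<^sup>*(BT)\<close> is taken modulo its elements of positive degree. Its extension
  to \<open>H\<^sup>*\<^sup>*(\<Delta>)\<close> depends on the component of degree \<open>2n\<close> only.
\<close>

definition fan_integral ::
  "('a::euclidean_space, nat set) multi_fan \<Rightarrow> mpoly set set \<Rightarrow> complex" where
  "fan_integral \<Delta> Y = the_elem ((\<lambda>X. index_map \<Delta> X 0) ` Y)"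

definition fan_integral_hat ::
  "('a::euclidean_space, nat set) multi_fan \<Rightarrow> (nat \<Rightarrow> mpoly set set) \<Rightarrow> complex" where
  "fan_integral_hat \<Delta> f = fan_integral \<Delta> (f (fan_dim \<Delta>))"

section \<open>Characteristic classes\<close>

definition c1 ::
  "('a::euclidean_space, nat set) multi_fan \<Rightarrow> (nat set \<Rightarrow> 'a set) \<Rightarrow> mpoly set set" where
  "c1 \<Delta> F =
     (\<Oplus>\<^bsub>HH \<Delta>\<^esub>i\<in>{1..nrays \<Delta>}.
        HH_class \<Delta> (mconst (complex_of_real (offset \<Delta> F i))) \<otimes>\<^bsub>HH \<Delta>\<^esub> HH_class \<Delta> (mvar i))"

definition exp_c1 ::
  "('a::euclidean_space, nat set) multi_fan \<Rightarrow> (nat set \<Rightarrow> 'a set) \<Rightarrow> nat \<Rightarrow> mpoly set set" where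
  "exp_c1 \<Delta> F = fps_subst \<Delta> (fps_exp 1) (c1 \<Delta> F)"

text \<open>
  The Maclaurin series of \<open>x / (1 - \<rho> e\<^sup>-\<^sup>x)\<close>. For \<open>\<rho> = 1\<close> the denominator has subdegree 1; division
  of formal power series over a field cancels the common factor.
\<close>

definition todd_fps :: "complex \<Rightarrow> complex fps" where
  "todd_fps \<rho> = fps_X / (1 - fps_const \<rho> * fps_exp (- 1))"

definition todd_class ::
  "('a::euclidean_space, nat set) multi_fan \<Rightarrow> nat \<Rightarrow> mpoly set set" where
  "todd_class \<Delta> =
     (\<Oplus>\<^bsub>HHH \<Delta>\<^esub>g\<in>G_fan \<Delta>. \<Otimes>\<^bsub>HHH \<Delta>\<^esub>i\<in>{1..nrays \<Delta>}.
        fps_subst \<Delta> (todd_fps (rho i g)) (HH_class \<Delta> (mvar i)))"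

end

theory Submission
  imports Defs "HOL-Complex_Analysis.Complex_Analysis"
begin

text \<open>
  Write \<open>\<langle>u, v\<rangle>\<close> for the pairing with the generic vector \<open>v\<close>. Summing \<open>e\<^sup>s\<^sup>\<langle>\<^sup>u\<^sup>,\<^sup>v\<^sup>\<rangle>\<close> over the lattice points
  \<open>u\<close> of the shifted cone at a facet \<open>I\<close> gives geometric series averaged over the characters of
  \<open>G\<^sub>I\<close>. This is the \<open>I\<close>-summand of the index map, applied to \<open>e\<^sup>c \<T>(\<Delta>)\<close> and evaluated at \<open>s v\<close>:
  a Laurent series in \<open>s\<close> whose constant term comes from the component of degree \<open>n\<close>. So the
  constant terms add up to the integral. On the other hand the Duistermaat-Heckman function has
  bounded support, so the sum over all facets is a finite sum of exponentials, whose constant term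
  is \<open>\<sharp>(\<P>)\<close>.

  Completeness is used through the projected multi-fans at the walls \<open>K\<close>, \<open>|K| = n - 1\<close>: their
  pre-completeness balances the weights on the two sides of \<open>K\<close>. This cancels the poles of the index
  sum, so that it is polynomial, and it makes the Duistermaat-Heckman function independent of the
  generic vector; choosing that vector near \<open>- u\<close> shows that it vanishes at \<open>u\<close> far from the vertices.
\<close>

section \<open>Polynomials and their evaluation\<close>

text \<open>The direction of the shift fixes the shape of the Todd factor. With every offset raised
  by a small positive amount, the lattice coordinates of the cone at I run through c_i + 1, c_i + 2,
  ... where <u_i, v> > 0 and through c_i, c_i - 1, ... where <u_i, v> < 0. The geometric series z +
  z^2 + ... and 1 + 1/z + ... expand -1 / (1 - 1/z) and 1 / (1 - 1/z), so the sign (-1)^I turns both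
  into the same rational function. All cones are flipped towards v, hence the series converge
  together for s < 0, and power series in s are compared on that half line only. The obstacle is
  that \<open>index_map\<close> is a definite description, so the rational sum has to be shown
  polynomial first. Residues of that sum and jumps of the Duistermaat-Heckman function reduce to one
  identity, a sum over pairs of a facet I and i in I grouped by the wall I - {i}. Points where two
  forms of one facet vanish are avoided by density or by moving a path. The orders |G_I| fit in
  because |G_I| |<u_i, z>| is the same for all facets I = K + {i} around a wall K.\<close>

definition mon_eval :: "(nat \<Rightarrow> complex) \<Rightarrow> (nat \<Rightarrow>\<^sub>0 nat) \<Rightarrow> complex" where
  "mon_eval f m = (\<Prod>i\<in>Poly_Mapping.keys m. f i ^ Poly_Mapping.lookup m i)"

lemma mon_eval_superset:
  assumes "finite S" "Poly_Mapping.keys m \<subseteq> S"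
  shows "mon_eval f m = (\<Prod>i\<in>S. f i ^ Poly_Mapping.lookup m i)"
  unfolding mon_eval_def using assms
  by (intro prod.mono_neutral_left) (auto simp: in_keys_iff)

lemma mon_eval_add: "mon_eval f (a + b) = mon_eval f a * mon_eval f b"
proof -
  let ?S = "Poly_Mapping.keys a \<union> Poly_Mapping.keys b"
  have "Poly_Mapping.keys (a + b) \<subseteq> ?S" by (rule keys_add)
  then show ?thesis
    using mon_eval_superset[of ?S "a + b" f] mon_eval_superset[of ?S a f] mon_eval_superset[of ?S b f]
    by (simp add: lookup_add power_add prod.distrib)
qed

lemma mpoly_eval_superset:
  assumes "finite S" "Poly_Mapping.keys p \<subseteq> S"
  shows "mpoly_eval f p = (\<Sum>m\<in>S. Poly_Mapping.lookup p m * mon_eval f m)"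
  unfolding mpoly_eval_def mon_eval_def[symmetric] using assms
  by (intro sum.mono_neutral_left) (auto simp: in_keys_iff)

lemma mpoly_eval_zero [simp]: "mpoly_eval f 0 = 0"
  by (simp add: mpoly_eval_def)

lemma mpoly_eval_add: "mpoly_eval f (p + q) = mpoly_eval f p + mpoly_eval f q"
proof -
  let ?S = "Poly_Mapping.keys p \<union> Poly_Mapping.keys q"
  have "Poly_Mapping.keys (p + q) \<subseteq> ?S" by (rule keys_add)
  then show ?thesis
    using mpoly_eval_superset[of ?S "p + q" f] mpoly_eval_superset[of ?S p f]
      mpoly_eval_superset[of ?S q f]
    by (simp add: lookup_add distrib_right sum.distrib)
qed

lemma mpoly_eval_sum: "mpoly_eval f (sum p A) = (\<Sum>x\<in>A. mpoly_eval f (p x))"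
  by (induction A rule: infinite_finite_induct) (auto simp: mpoly_eval_add)

lemma mpoly_eval_single: "mpoly_eval f (Poly_Mapping.single m c) = c * mon_eval f m"
  using mpoly_eval_superset[of "{m}" "Poly_Mapping.single m c" f] by simp

lemma mpoly_sum_single:
  "p = (\<Sum>m\<in>Poly_Mapping.keys p. Poly_Mapping.single m (Poly_Mapping.lookup p m))"
  for p :: "'a \<Rightarrow>\<^sub>0 'b::comm_monoid_add"
  by (rule poly_mapping_eqI) (auto simp: lookup_sum lookup_single when_def in_keys_iff)

lemma mpoly_eval_mult: "mpoly_eval f (p * q) = mpoly_eval f p * mpoly_eval f q"
proof -
  let ?P = "Poly_Mapping.keys p" and ?Q = "Poly_Mapping.keys q"
  have "p * q = (\<Sum>m\<in>?P. \<Sum>l\<in>?Q. Poly_Mapping.single (m + l)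
      (Poly_Mapping.lookup p m * Poly_Mapping.lookup q l))"
    by (subst (1) mpoly_sum_single[of p], subst (1) mpoly_sum_single[of q])
      (simp add: sum_product mult_single)
  then show ?thesis
    by (simp add: mpoly_eval_sum mpoly_eval_single mon_eval_add
        mpoly_eval_superset[of ?P p] mpoly_eval_superset[of ?Q q] sum_product mult_ac)
qed

lemma mpoly_eval_const [simp]: "mpoly_eval f (mconst c) = c"
  by (simp add: mconst_def mpoly_eval_single mon_eval_def)

lemma mpoly_eval_one [simp]: "mpoly_eval f 1 = 1"
  by (metis mpoly_eval_const mconst_def single_one)

lemma mpoly_eval_var [simp]: "mpoly_eval f (mvar i) = f i"
  by (simp add: mvar_def mpoly_eval_single mon_eval_def)

lemma mpoly_eval_power: "mpoly_eval f (p ^ k) = mpoly_eval f p ^ k"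
  by (induction k) (auto simp: mpoly_eval_mult)

lemma mpoly_eval_prod: "mpoly_eval f (prod p A) = (\<Prod>x\<in>A. mpoly_eval f (p x))"
  by (induction A rule: infinite_finite_induct) (auto simp: mpoly_eval_mult)

section \<open>Homogeneous polynomials and scaling\<close>

definition homog :: "nat \<Rightarrow> nat \<Rightarrow> mpoly set" where
  "homog d k = {p \<in> carrier (poly_ring d). \<forall>m\<in>Poly_Mapping.keys p. mdeg m = k}"

lemma carrier_poly_ring:
  "p \<in> carrier (poly_ring d) \<longleftrightarrow> (\<forall>m\<in>Poly_Mapping.keys p. Poly_Mapping.keys m \<subseteq> {1..d})"
  by (simp add: poly_ring_def)

lemma poly_ring_simps [simp]:
  "x \<otimes>\<^bsub>poly_ring d\<^esub> y = x * y" "x \<oplus>\<^bsub>poly_ring d\<^esub> y = x + y"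
  "\<one>\<^bsub>poly_ring d\<^esub> = 1" "\<zero>\<^bsub>poly_ring d\<^esub> = 0"
  by (simp_all add: poly_ring_def)

lemma carrier_poly_ring_add:
  "p \<in> carrier (poly_ring d) \<Longrightarrow> q \<in> carrier (poly_ring d) \<Longrightarrow> p + q \<in> carrier (poly_ring d)"
  using keys_add[of p q] unfolding carrier_poly_ring by blast

lemma carrier_poly_ring_minus:
  "p \<in> carrier (poly_ring d) \<Longrightarrow> - p \<in> carrier (poly_ring d)"
  unfolding carrier_poly_ring by (auto simp: in_keys_iff)

lemma carrier_poly_ring_mult:
  assumes "p \<in> carrier (poly_ring d)" "q \<in> carrier (poly_ring d)"
  shows "p * q \<in> carrier (poly_ring d)"
  unfolding carrier_poly_ring
proof
  fix m assume "m \<in> Poly_Mapping.keys (p * q)"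
  then obtain a b where "m = a + b" "a \<in> Poly_Mapping.keys p" "b \<in> Poly_Mapping.keys q"
    using keys_mult[of p q] by blast
  then show "Poly_Mapping.keys m \<subseteq> {1..d}"
    using assms keys_add[of a b] unfolding carrier_poly_ring by blast
qed

lemma carrier_poly_ring_const [simp]: "mconst c \<in> carrier (poly_ring d)"
  by (simp add: carrier_poly_ring mconst_def)

lemma carrier_poly_ring_01 [simp]: "0 \<in> carrier (poly_ring d)" "1 \<in> carrier (poly_ring d)"
  by (simp_all add: carrier_poly_ring)

lemma carrier_poly_ring_var [simp]: "i \<in> {1..d} \<Longrightarrow> mvar i \<in> carrier (poly_ring d)"
  by (simp add: carrier_poly_ring mvar_def)

lemma carrier_poly_ring_sum:
  "(\<And>x. x \<in> A \<Longrightarrow> p x \<in> carrier (poly_ring d)) \<Longrightarrow> sum p A \<in> carrier (poly_ring d)"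
  by (induction A rule: infinite_finite_induct) (auto intro: carrier_poly_ring_add)

lemma carrier_poly_ring_prod:
  "(\<And>x. x \<in> A \<Longrightarrow> p x \<in> carrier (poly_ring d)) \<Longrightarrow> prod p A \<in> carrier (poly_ring d)"
  by (induction A rule: infinite_finite_induct) (auto intro: carrier_poly_ring_mult)

lemma cring_poly_ring: "cring (poly_ring d)"
proof (rule cringI)
  show "abelian_group (poly_ring d)"
    by (rule abelian_groupI)
      (auto intro: carrier_poly_ring_add simp: add.assoc add.commute
        intro!: bexI[OF _ carrier_poly_ring_minus])
  show "Group.comm_monoid (poly_ring d)"
    by (rule comm_monoidI) (auto intro: carrier_poly_ring_mult simp: mult.assoc mult.commute)
qed (auto simp: distrib_right)

lemma mdeg_superset:
  "finite S \<Longrightarrow> Poly_Mapping.keys m \<subseteq> S \<Longrightarrow> mdeg m = (\<Sum>i\<in>S. Poly_Mapping.lookup m i)"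
  unfolding mdeg_def by (intro sum.mono_neutral_left) (auto simp: in_keys_iff)

lemma mdeg_add: "mdeg (a + b) = mdeg a + mdeg b"
proof -
  let ?S = "Poly_Mapping.keys a \<union> Poly_Mapping.keys b"
  have "Poly_Mapping.keys (a + b) \<subseteq> ?S" by (rule keys_add)
  then show ?thesis
    using mdeg_superset[of ?S "a + b"] mdeg_superset[of ?S a] mdeg_superset[of ?S b]
    by (simp add: lookup_add sum.distrib)
qed

lemma homog_carrier: "p \<in> homog d k \<Longrightarrow> p \<in> carrier (poly_ring d)"
  by (simp add: homog_def)

lemma homog_add: "p \<in> homog d k \<Longrightarrow> q \<in> homog d k \<Longrightarrow> p + q \<in> homog d k"
  using keys_add[of p q] unfolding homog_def by (auto intro: carrier_poly_ring_add)

lemma homog_mult: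
  assumes "p \<in> homog d k" "q \<in> homog d l"
  shows "p * q \<in> homog d (k + l)"
proof -
  have "mdeg m = k + l" if m: "m \<in> Poly_Mapping.keys (p * q)" for m
  proof -
    obtain a b where "m = a + b" "a \<in> Poly_Mapping.keys p" "b \<in> Poly_Mapping.keys q"
      using keys_mult[of p q] m by blast
    then show ?thesis using assms by (auto simp: homog_def mdeg_add)
  qed
  then show ?thesis using assms by (auto simp: homog_def intro: carrier_poly_ring_mult)
qed

lemma homog_0 [simp]: "0 \<in> homog d k"
  by (simp add: homog_def)

lemma homog_const [simp]: "mconst c \<in> homog d 0"
  by (simp add: homog_def) (simp add: mconst_def mdeg_def)

lemma homog_1 [simp]: "1 \<in> homog d 0"
  by (simp add: homog_def mdeg_def)

lemma homog_var [simp]: "i \<in> {1..d} \<Longrightarrow> mvar i \<in> homog d 1"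
  by (simp add: homog_def) (simp add: mvar_def mdeg_def)

lemma homog_sum: "(\<And>x. x \<in> A \<Longrightarrow> p x \<in> homog d k) \<Longrightarrow> sum p A \<in> homog d k"
  by (induction A rule: infinite_finite_induct) (auto intro: homog_add)

lemma homog_power: "p \<in> homog d 1 \<Longrightarrow> p ^ k \<in> homog d k"
  by (induction k) (auto dest: homog_mult)

text \<open>Scaling detects the degree. In degree n the factor s^n cancels against the n linear
  forms in each denominator of the index sum.\<close>

lemma mpoly_eval_homog:
  assumes "p \<in> homog d k"
  shows "mpoly_eval (\<lambda>i. s * f i) p = s ^ k * mpoly_eval f p"
proof -
  have "mon_eval (\<lambda>i. s * f i) m = s ^ k * mon_eval f m" if "m \<in> Poly_Mapping.keys p" for m
    using that assms
    by (auto simp: mon_eval_def power_mult_distrib prod.distrib homog_def mdeg_def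
        simp flip: power_sum)
  then show ?thesis
    by (simp add: mpoly_eval_superset[of "Poly_Mapping.keys p" p] sum_distrib_left mult_ac)
qed

text \<open>
  Maps onto \<open>H\<^sup>*\<^sup>*(\<Delta>)\<close>; among power series of polynomials the ring laws come from the type class.
\<close>

definition graded :: "nat \<Rightarrow> mpoly fps set" where
  "graded d = {P. \<forall>k. fps_nth P k \<in> homog d k}"

lemma graded_add: "P \<in> graded d \<Longrightarrow> Q \<in> graded d \<Longrightarrow> P + Q \<in> graded d"
  by (auto simp: graded_def intro: homog_add)

lemma graded_mult:
  assumes "P \<in> graded d" "Q \<in> graded d" shows "P * Q \<in> graded d"
  unfolding graded_def
proof safe
  fix k
  have "fps_nth P i * fps_nth Q (k - i) \<in> homog d k" if "i \<le> k" for i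
    using homog_mult[of "fps_nth P i" d i "fps_nth Q (k - i)" "k - i"] assms that
    by (auto simp: graded_def)
  then show "fps_nth (P * Q) k \<in> homog d k"
    unfolding fps_mult_nth by (intro homog_sum) auto
qed

lemma graded_01 [simp]: "0 \<in> graded d" "1 \<in> graded d"
  by (auto simp: graded_def fps_one_nth)

lemma graded_sum: "(\<And>x. x \<in> A \<Longrightarrow> P x \<in> graded d) \<Longrightarrow> sum P A \<in> graded d"
  by (induction A rule: infinite_finite_induct) (auto intro: graded_add)

lemma graded_prod: "(\<And>x. x \<in> A \<Longrightarrow> P x \<in> graded d) \<Longrightarrow> prod P A \<in> graded d"
  by (induction A rule: infinite_finite_induct) (auto intro: graded_mult)

text \<open>Polynomial counterpart of \<open>fps_subst\<close>. For linear \<open>y\<close> the k-th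
  coefficient is a form of degree k, so the series variable only records the grading.\<close>

definition lin_subst :: "complex fps \<Rightarrow> mpoly \<Rightarrow> mpoly fps" where
  "lin_subst a y = Abs_fps (\<lambda>k. mconst (fps_nth a k) * y ^ k)"

lemma graded_lin_subst: "y \<in> homog d 1 \<Longrightarrow> lin_subst a y \<in> graded d"
  unfolding graded_def lin_subst_def
  using homog_mult[OF homog_const homog_power] by fastforce

text \<open>For graded \<open>P\<close>, homogeneity makes this the expansion in s of the value of
  \<open>P\<close> at the point s f.\<close>

definition fps_eval :: "(nat \<Rightarrow> complex) \<Rightarrow> mpoly fps \<Rightarrow> complex fps" where
  "fps_eval f P = Abs_fps (\<lambda>k. mpoly_eval f (fps_nth P k))"

lemma fps_eval_nth [simp]: "fps_nth (fps_eval f P) k = mpoly_eval f (fps_nth P k)"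
  by (simp add: fps_eval_def)

lemma fps_eval_0 [simp]: "fps_eval f 0 = 0"
  by (simp add: fps_eq_iff)

lemma fps_eval_1 [simp]: "fps_eval f 1 = 1"
  by (simp add: fps_eq_iff fps_one_nth)

lemma fps_eval_add: "fps_eval f (P + Q) = fps_eval f P + fps_eval f Q"
  by (simp add: fps_eq_iff mpoly_eval_add)

lemma fps_eval_mult: "fps_eval f (P * Q) = fps_eval f P * fps_eval f Q"
  by (simp add: fps_eq_iff fps_mult_nth mpoly_eval_sum mpoly_eval_mult)

lemma fps_eval_sum: "fps_eval f (sum P A) = (\<Sum>x\<in>A. fps_eval f (P x))"
  by (induction A rule: infinite_finite_induct) (auto simp: fps_eval_add)

lemma fps_eval_prod: "fps_eval f (prod P A) = (\<Prod>x\<in>A. fps_eval f (P x))"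
  by (induction A rule: infinite_finite_induct) (auto simp: fps_eval_mult)

lemma fps_eval_lin_subst:
  "fps_eval f (lin_subst a y) = Abs_fps (\<lambda>k. fps_nth a k * mpoly_eval f y ^ k)"
  by (simp add: fps_eq_iff lin_subst_def mpoly_eval_mult mpoly_eval_power)

section \<open>The cohomology rings\<close>

lemma cring_morphism_sum:
  assumes "h \<in> ring_hom (poly_ring d) S" "cring S"
    and "\<And>x. x \<in> A \<Longrightarrow> p x \<in> carrier (poly_ring d)"
  shows "h (sum p A) = (\<Oplus>\<^bsub>S\<^esub>x\<in>A. h (p x))"
proof -
  interpret S: cring S by fact
  interpret R: cring "poly_ring d" by (rule cring_poly_ring)
  interpret h: ring_hom_cring "poly_ring d" S h
    by (rule ring_hom_cring.intro) (unfold_locales, use assms(1) in \<open>auto simp: ring_hom_cring_axioms_def\<close>)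
  have c: "h y \<in> carrier S" if "y \<in> carrier (poly_ring d)" for y
    using that by (rule h.hom_closed)
  show ?thesis
    using assms(3)
  proof (induction A rule: infinite_finite_induct)
    case (insert x A)
    then show ?case
      using h.hom_add[of "p x" "sum p A"] by (simp add: carrier_poly_ring_sum S.finsum_insert c)
  qed (use h.hom_zero in auto)
qed

context
  fixes \<Delta> :: "('a::euclidean_space, nat set) multi_fan"
begin

lemma carrier_poly_ring_power:
  "p \<in> carrier (poly_ring d) \<Longrightarrow> p ^ k \<in> carrier (poly_ring d)"
  by (induction k) (auto intro: carrier_poly_ring_mult)

lemma ideal_SR: "ideal (SR_ideal \<Delta>) (poly_ring (nrays \<Delta>))"
  unfolding SR_ideal_def
  by (rule ring.genideal_ideal)
    (auto intro!: carrier_poly_ring_prod cring.axioms(1)[OF cring_poly_ring])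

lemma cring_HT: "cring (HT \<Delta>)"
  unfolding HT_def by (rule ideal.quotient_is_cring[OF ideal_SR cring_poly_ring])

lemma HT_class_hom: "HT_class \<Delta> \<in> ring_hom (poly_ring (nrays \<Delta>)) (HT \<Delta>)"
  unfolding HT_def HT_class_def[abs_def] by (rule ideal.rcos_ring_hom[OF ideal_SR])

lemma carrier_HT: "carrier (HT \<Delta>) = HT_class \<Delta> ` carrier (poly_ring (nrays \<Delta>))"
  by (auto simp: HT_def FactRing_def A_RCOSETS_def' HT_class_def)

lemma ideal_lin: "ideal (lin_ideal \<Delta>) (HT \<Delta>)"
  unfolding lin_ideal_def
  by (rule ring.genideal_ideal)
    (auto intro!: cring.axioms(1)[OF cring_HT] carrier_poly_ring_sum carrier_poly_ring_mult
      simp: pi_star_def carrier_HT)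

lemma cring_HH: "cring (HH \<Delta>)"
  unfolding HH_def by (rule ideal.quotient_is_cring[OF ideal_lin cring_HT])

lemma HH_class_hom: "HH_class \<Delta> \<in> ring_hom (poly_ring (nrays \<Delta>)) (HH \<Delta>)"
proof -
  have "(\<lambda>X. lin_ideal \<Delta> +>\<^bsub>HT \<Delta>\<^esub> X) \<in> ring_hom (HT \<Delta>) (HH \<Delta>)"
    unfolding HH_def by (rule ideal.rcos_ring_hom[OF ideal_lin])
  from ring_hom_trans[OF HT_class_hom this] show ?thesis
    by (simp add: HH_class_def[abs_def] comp_def)
qed

interpretation HH: cring "HH \<Delta>" by (rule cring_HH)

lemma HH_class_closed: "p \<in> carrier (poly_ring (nrays \<Delta>)) \<Longrightarrow> HH_class \<Delta> p \<in> carrier (HH \<Delta>)"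
  using ring_hom_closed[OF HH_class_hom] .

lemma HH_class_mult:
  "p \<in> carrier (poly_ring (nrays \<Delta>)) \<Longrightarrow> q \<in> carrier (poly_ring (nrays \<Delta>)) \<Longrightarrow>
    HH_class \<Delta> p \<otimes>\<^bsub>HH \<Delta>\<^esub> HH_class \<Delta> q = HH_class \<Delta> (p * q)"
  using ring_hom_mult[OF HH_class_hom] by simp

lemma HH_class_add:
  "p \<in> carrier (poly_ring (nrays \<Delta>)) \<Longrightarrow> q \<in> carrier (poly_ring (nrays \<Delta>)) \<Longrightarrow>
    HH_class \<Delta> p \<oplus>\<^bsub>HH \<Delta>\<^esub> HH_class \<Delta> q = HH_class \<Delta> (p + q)"
  using ring_hom_add[OF HH_class_hom] by simp

lemma HH_class_one: "\<one>\<^bsub>HH \<Delta>\<^esub> = HH_class \<Delta> 1"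
  using ring_hom_one[OF HH_class_hom] by simp

lemma HH_class_zero: "\<zero>\<^bsub>HH \<Delta>\<^esub> = HH_class \<Delta> 0"
  using ring_hom_zero[OF HH_class_hom cring.axioms(1)[OF cring_poly_ring] HH.ring_axioms] by simp

lemma HH_class_sum:
  "(\<And>x. x \<in> A \<Longrightarrow> p x \<in> carrier (poly_ring (nrays \<Delta>))) \<Longrightarrow>
    (\<Oplus>\<^bsub>HH \<Delta>\<^esub>x\<in>A. HH_class \<Delta> (p x)) = HH_class \<Delta> (sum p A)"
  using cring_morphism_sum[OF HH_class_hom cring_HH] by metis

lemma HH_class_power:
  "p \<in> carrier (poly_ring (nrays \<Delta>)) \<Longrightarrow>
    HH_class \<Delta> p [^]\<^bsub>HH \<Delta>\<^esub> (k::nat) = HH_class \<Delta> (p ^ k)"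
  by (induction k)
    (simp_all add: HH_class_one HH_class_mult carrier_poly_ring_power mult.commute)

section \<open>Elements of \<open>HHH \<Delta>\<close> as classes of graded series\<close>

definition graded_class :: "mpoly fps \<Rightarrow> nat \<Rightarrow> mpoly set set" where
  "graded_class P k = HH_class \<Delta> (fps_nth P k)"

lemma carrier_HHH: "carrier (HHH \<Delta>) = graded_class ` graded (nrays \<Delta>)"
proof (intro equalityI subsetI)
  fix f assume "f \<in> carrier (HHH \<Delta>)"
  then have "\<forall>k. \<exists>p. p \<in> homog (nrays \<Delta>) k \<and> f k = HH_class \<Delta> p"
    by (fastforce simp: HHH_def HH_piece_def homog_def)
  then obtain p where p: "\<And>k. p k \<in> homog (nrays \<Delta>) k" "\<And>k. f k = HH_class \<Delta> (p k)"
    by metis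
  then show "f \<in> graded_class ` graded (nrays \<Delta>)"
    by (intro image_eqI[of _ _ "Abs_fps p"]) (auto simp: graded_class_def graded_def)
qed (auto simp: HHH_def HH_piece_def homog_def graded_def graded_class_def)

lemma graded_nth_carrier: "P \<in> graded (nrays \<Delta>) \<Longrightarrow> fps_nth P k \<in> carrier (poly_ring (nrays \<Delta>))"
  unfolding graded_def by (auto intro: homog_carrier)

lemma graded_class_add:
  "P \<in> graded (nrays \<Delta>) \<Longrightarrow> Q \<in> graded (nrays \<Delta>) \<Longrightarrow>
    graded_class P \<oplus>\<^bsub>HHH \<Delta>\<^esub> graded_class Q = graded_class (P + Q)"
  by (simp add: HHH_def graded_class_def[abs_def] HH_class_add graded_nth_carrier)

lemma graded_class_mult:
  assumes "P \<in> graded (nrays \<Delta>)" "Q \<in> graded (nrays \<Delta>)"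
  shows "graded_class P \<otimes>\<^bsub>HHH \<Delta>\<^esub> graded_class Q = graded_class (P * Q)"
proof -
  have "(\<Oplus>\<^bsub>HH \<Delta>\<^esub>j\<in>{..k}. graded_class P j \<otimes>\<^bsub>HH \<Delta>\<^esub> graded_class Q (k - j)) = graded_class (P * Q) k" for k
  proof -
    have "graded_class (P * Q) k =
        (\<Oplus>\<^bsub>HH \<Delta>\<^esub>j\<in>{..k}. HH_class \<Delta> (fps_nth P j * fps_nth Q (k - j)))"
      using assms
      by (simp add: graded_class_def fps_mult_nth atMost_atLeast0 HH_class_sum
          carrier_poly_ring_mult graded_nth_carrier)
    also have "\<dots> = (\<Oplus>\<^bsub>HH \<Delta>\<^esub>j\<in>{..k}. graded_class P j \<otimes>\<^bsub>HH \<Delta>\<^esub> graded_class Q (k - j))"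
      using assms by (simp add: graded_class_def HH_class_mult graded_nth_carrier)
    finally show ?thesis ..
  qed
  then show ?thesis by (simp add: HHH_def)
qed

lemma graded_class_zero: "\<zero>\<^bsub>HHH \<Delta>\<^esub> = graded_class 0"
  by (simp add: HHH_def graded_class_def[abs_def] HH_class_zero)

lemma graded_class_one: "\<one>\<^bsub>HHH \<Delta>\<^esub> = graded_class 1"
  by (auto simp: HHH_def graded_class_def HH_class_zero HH_class_one fps_one_nth fun_eq_iff)

lemma comm_monoid_HHH: "Group.comm_monoid (HHH \<Delta>)"
  by (rule comm_monoidI)
    (auto simp: carrier_HHH graded_class_mult graded_class_one graded_mult mult_ac)

lemma abelian_monoid_HHH: "abelian_monoid (HHH \<Delta>)"
  by (rule abelian_monoidI)
    (auto simp: carrier_HHH graded_class_add graded_class_zero graded_add add_ac)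

lemma graded_class_sum:
  assumes "\<And>x. x \<in> A \<Longrightarrow> P x \<in> graded (nrays \<Delta>)"
  shows "(\<Oplus>\<^bsub>HHH \<Delta>\<^esub>x\<in>A. graded_class (P x)) = graded_class (sum P A)"
proof -
  interpret abelian_monoid "HHH \<Delta>" by (rule abelian_monoid_HHH)
  show ?thesis using assms
    by (induction A rule: infinite_finite_induct)
      (auto simp: graded_class_zero finsum_insert carrier_HHH graded_class_add graded_sum)
qed

lemma graded_class_prod:
  assumes "\<And>x. x \<in> A \<Longrightarrow> P x \<in> graded (nrays \<Delta>)"
  shows "(\<Otimes>\<^bsub>HHH \<Delta>\<^esub>x\<in>A. graded_class (P x)) = graded_class (prod P A)"
proof -
  interpret Group.comm_monoid "HHH \<Delta>" by (rule comm_monoid_HHH)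
  show ?thesis using assms
    by (induction A rule: infinite_finite_induct)
      (auto simp: graded_class_one finprod_insert carrier_HHH graded_class_mult graded_prod)
qed

lemma fps_subst_graded:
  assumes "y \<in> homog (nrays \<Delta>) 1"
  shows "fps_subst \<Delta> a (HH_class \<Delta> y) = graded_class (lin_subst a y)"
proof
  fix k
  have "y \<in> carrier (poly_ring (nrays \<Delta>))" using assms by (rule homog_carrier)
  moreover have "y ^ k \<in> carrier (poly_ring (nrays \<Delta>))" using homog_power[OF assms] by (rule homog_carrier)
  ultimately show "fps_subst \<Delta> a (HH_class \<Delta> y) k = graded_class (lin_subst a y) k"
    by (simp add: fps_subst_def graded_class_def lin_subst_def HH_class_power HH_class_mult)
qed

definition c1_poly :: "(nat set \<Rightarrow> 'a set) \<Rightarrow> mpoly" where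
  "c1_poly F = (\<Sum>i\<in>{1..nrays \<Delta>}. mconst (complex_of_real (offset \<Delta> F i)) * mvar i)"

text \<open>A polynomial representative of e^{c_1} T(\<Delta>), which turns computations in the
  quotient rings into evaluation of its coefficients.\<close>

definition RR_series :: "(nat set \<Rightarrow> 'a set) \<Rightarrow> mpoly fps" where
  "RR_series F = lin_subst (fps_exp 1) (c1_poly F) *
     (\<Sum>g\<in>G_fan \<Delta>. \<Prod>i\<in>{1..nrays \<Delta>}. lin_subst (todd_fps (rho i g)) (mvar i))"

lemma c1_poly_homog: "c1_poly F \<in> homog (nrays \<Delta>) 1"
  unfolding c1_poly_def using homog_mult[OF homog_const homog_var] by (intro homog_sum) fastforce

lemma c1_class: "c1 \<Delta> F = HH_class \<Delta> (c1_poly F)"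
  unfolding c1_def c1_poly_def
proof -
  have "(\<Oplus>\<^bsub>HH \<Delta>\<^esub>i\<in>{1..nrays \<Delta>}. HH_class \<Delta> (mconst (complex_of_real (offset \<Delta> F i))) \<otimes>\<^bsub>HH \<Delta>\<^esub>
        HH_class \<Delta> (mvar i)) =
      (\<Oplus>\<^bsub>HH \<Delta>\<^esub>i\<in>{1..nrays \<Delta>}. HH_class \<Delta> (mconst (complex_of_real (offset \<Delta> F i)) * mvar i))"
    by (intro HH.finsum_cong' refl)
      (auto simp: HH_class_mult HH_class_closed carrier_poly_ring_mult simp del: One_nat_def)
  then show "(\<Oplus>\<^bsub>HH \<Delta>\<^esub>i\<in>{1..nrays \<Delta>}. HH_class \<Delta> (mconst (complex_of_real (offset \<Delta> F i))) \<otimes>\<^bsub>HH \<Delta>\<^esub>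
        HH_class \<Delta> (mvar i)) =
      HH_class \<Delta> (\<Sum>i\<in>{1..nrays \<Delta>}. mconst (complex_of_real (offset \<Delta> F i)) * mvar i)"
    by (subst (asm) HH_class_sum) (auto simp: carrier_poly_ring_mult simp del: One_nat_def)
qed

lemma graded_todd: "(\<Sum>g\<in>G_fan \<Delta>. \<Prod>i\<in>{1..nrays \<Delta>}. lin_subst (todd_fps (rho i g)) (mvar i)) \<in> graded (nrays \<Delta>)"
  by (intro graded_sum graded_prod graded_lin_subst homog_var)

lemma RR_series_graded: "RR_series F \<in> graded (nrays \<Delta>)"
  unfolding RR_series_def
  by (intro graded_mult graded_todd graded_lin_subst c1_poly_homog)

lemma RR_class: "exp_c1 \<Delta> F \<otimes>\<^bsub>HHH \<Delta>\<^esub> todd_class \<Delta> = graded_class (RR_series F)"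
proof -
  interpret sum: abelian_monoid "HHH \<Delta>" by (rule abelian_monoid_HHH)
  interpret prod: Group.comm_monoid "HHH \<Delta>" by (rule comm_monoid_HHH)
  have factor: "(\<Otimes>\<^bsub>HHH \<Delta>\<^esub>i\<in>{1..nrays \<Delta>}.
      graded_class (lin_subst (todd_fps (rho i g)) (mvar i))) =
      graded_class (\<Prod>i\<in>{1..nrays \<Delta>}. lin_subst (todd_fps (rho i g)) (mvar i))" for g
    by (rule graded_class_prod) (intro graded_lin_subst homog_var; assumption)
  have factor_mem: "graded_class (\<Prod>i\<in>{1..nrays \<Delta>}. lin_subst (todd_fps (rho i g)) (mvar i)) \<in>
      graded_class ` graded (nrays \<Delta>)" for g
    by (intro graded_prod imageI graded_lin_subst homog_var)
  have "todd_class \<Delta> = (\<Oplus>\<^bsub>HHH \<Delta>\<^esub>g\<in>G_fan \<Delta>. \<Otimes>\<^bsub>HHH \<Delta>\<^esub>i\<in>{1..nrays \<Delta>}.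
      graded_class (lin_subst (todd_fps (rho i g)) (mvar i)))"
    unfolding todd_class_def
    by (intro sum.finsum_cong' prod.finprod_cong')
      (auto simp: fps_subst_graded carrier_HHH graded_lin_subst factor factor_mem
        simp del: One_nat_def)
  also have "\<dots> = (\<Oplus>\<^bsub>HHH \<Delta>\<^esub>g\<in>G_fan \<Delta>.
      graded_class (\<Prod>i\<in>{1..nrays \<Delta>}. lin_subst (todd_fps (rho i g)) (mvar i)))"
    by (simp add: factor del: One_nat_def)
  also have "\<dots> = graded_class
      (\<Sum>g\<in>G_fan \<Delta>. \<Prod>i\<in>{1..nrays \<Delta>}. lin_subst (todd_fps (rho i g)) (mvar i))"
    by (rule graded_class_sum) (intro graded_prod graded_lin_subst homog_var)
  finally show ?thesis
    unfolding exp_c1_def c1_class fps_subst_graded[OF c1_poly_homog]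
    by (simp add: RR_series_def graded_class_mult graded_todd graded_lin_subst c1_poly_homog
        del: One_nat_def)
qed

end

section \<open>Polynomial functions and linear forms\<close>

lemma eventually_line_generic:
  fixes x z :: "'a::euclidean_space"
  assumes "finite A" "\<And>a. a \<in> A \<Longrightarrow> a \<bullet> x \<noteq> 0 \<or> a \<bullet> z \<noteq> 0"
  shows "\<forall>\<^sub>F t in at 0. \<forall>a\<in>A. a \<bullet> (x + t *\<^sub>R z) \<noteq> 0"
proof -
  have "\<forall>\<^sub>F t in at 0. a \<bullet> (x + t *\<^sub>R z) \<noteq> 0" if "a \<in> A" for a
  proof (cases "a \<bullet> x = 0")
    case True
    then have "a \<bullet> z \<noteq> 0" using assms(2) that by blast
    then show ?thesis using True by (auto simp: inner_add_right eventually_at_filter)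
  next
    case False
    have "((\<lambda>t. a \<bullet> (x + t *\<^sub>R z)) \<longlongrightarrow> a \<bullet> (x + 0 *\<^sub>R z)) (at 0)" by (intro tendsto_intros)
    then show ?thesis using False by (auto intro: tendsto_imp_eventually_ne)
  qed
  then show ?thesis using assms(1) by (simp add: eventually_ball_finite)
qed

text \<open>Finitely many proper subspaces of \<open>V\<close> cannot fill a ball: the forms are
  made nonzero one at a time, by a step so small that the earlier ones stay nonzero.\<close>

lemma perturb_generic:
  fixes x :: "'a::euclidean_space"
  assumes "subspace V" "finite A" "\<And>a. a \<in> A \<Longrightarrow> \<exists>y\<in>V. a \<bullet> y \<noteq> 0" "x \<in> V" "e > 0"
  shows "\<exists>y\<in>V. dist y x < e \<and> (\<forall>a\<in>A. a \<bullet> y \<noteq> 0)"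
  using assms(2,3,5)
proof (induction A arbitrary: e)
  case (insert a A)
  obtain y where y: "y \<in> V" "dist y x < e / 2" "\<forall>b\<in>A. b \<bullet> y \<noteq> 0"
    using insert.IH[of "e / 2"] insert.prems by auto
  obtain z where z: "z \<in> V" "a \<bullet> z \<noteq> 0" using insert.prems(1) by blast
  have "\<forall>\<^sub>F t in at 0. \<forall>b\<in>insert a A. b \<bullet> (y + t *\<^sub>R z) \<noteq> 0"
    using y(3) z(2) insert.hyps by (intro eventually_line_generic) auto
  moreover have "\<forall>\<^sub>F t in at 0. dist (y + t *\<^sub>R z) y < e / 2"
  proof -
    have "((\<lambda>t. y + t *\<^sub>R z) \<longlongrightarrow> y + 0 *\<^sub>R z) (at 0)" by (intro tendsto_intros)
    then show ?thesis using insert.prems(2) by (auto dest!: tendstoD[where e = "e / 2"])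
  qed
  ultimately have "\<forall>\<^sub>F t in at (0::real). (\<forall>b\<in>insert a A. b \<bullet> (y + t *\<^sub>R z) \<noteq> 0) \<and>
      dist (y + t *\<^sub>R z) y < e / 2"
    by eventually_elim auto
  then obtain t where t: "\<forall>b\<in>insert a A. b \<bullet> (y + t *\<^sub>R z) \<noteq> 0" "dist (y + t *\<^sub>R z) y < e / 2"
    using eventually_happens[of _ "at (0::real)"] by auto
  have "dist (y + t *\<^sub>R z) x < e" using t(2) y(2) dist_triangle_half_r dist_commute by metis
  then show ?case using t(1) y(1) z(1) assms(1)
    by (intro bexI[of _ "y + t *\<^sub>R z"]) (auto intro: subspace_add subspace_scale)
qed (use assms(4) in \<open>auto intro!: bexI[of _ x]\<close>)

lemma continuous_eq_on_dense:
  fixes f g :: "'a::metric_space \<Rightarrow> 'b::t2_space"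
  assumes "isCont f x" "isCont g x"
    and "\<And>e. e > 0 \<Longrightarrow> \<exists>y. dist y x < e \<and> f y = g y"
  shows "f x = g x"
proof -
  have "\<forall>n. \<exists>y. dist y x < inverse (Suc n) \<and> f y = g y"
    by (intro allI assms(3)) simp
  then obtain y where y: "\<And>n. dist (y n) x < inverse (real (Suc n))" "\<And>n. f (y n) = g (y n)"
    by metis
  have "y \<longlonglongrightarrow> x"
    unfolding tendsto_iff
  proof safe
    fix e :: real assume "e > 0"
    then have "\<forall>\<^sub>F n in sequentially. inverse (real (Suc n)) < e"
      using LIMSEQ_inverse_real_of_nat by (auto dest: order_tendstoD)
    then show "\<forall>\<^sub>F n in sequentially. dist (y n) x < e"
      by eventually_elim (use y(1) less_trans in blast)
  qed
  then have "(\<lambda>n. f (y n)) \<longlonglongrightarrow> f x" "(\<lambda>n. g (y n)) \<longlonglongrightarrow> g x"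
    using assms(1,2) by (simp_all add: isCont_tendsto_compose)
  then show ?thesis using y(2) by (simp add: LIMSEQ_unique)
qed

section \<open>Complex polynomial functions and division by a linear form\<close>

lemma polynomial_function_complex:
  "polynomial_function f \<longleftrightarrow>
    real_polynomial_function (\<lambda>x. Re (f x)) \<and> real_polynomial_function (\<lambda>x. Im (f x))"
  for f :: "'a::euclidean_space \<Rightarrow> complex"
  by (simp add: polynomial_function_iff_Basis_inner Basis_complex_def inner_complex_def)

lemma polynomial_function_cmult:
  fixes f g :: "'a::euclidean_space \<Rightarrow> complex"
  assumes "polynomial_function f" "polynomial_function g"
  shows "polynomial_function (\<lambda>x. f x * g x)"
  using assms unfolding polynomial_function_complex
  by (auto intro!: real_polynomial_function.intros(3,4) real_polynomial_function_diff)

lemma polynomial_function_cprod: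
  fixes f :: "'b \<Rightarrow> 'a::euclidean_space \<Rightarrow> complex"
  shows "(\<And>i. i \<in> A \<Longrightarrow> polynomial_function (f i)) \<Longrightarrow> polynomial_function (\<lambda>x. \<Prod>i\<in>A. f i x)"
  by (induction A rule: infinite_finite_induct) (auto intro: polynomial_function_cmult)

lemma polynomial_function_cpower:
  fixes f :: "'a::euclidean_space \<Rightarrow> complex"
  shows "polynomial_function f \<Longrightarrow> polynomial_function (\<lambda>x. f x ^ k)"
  by (induction k) (auto intro: polynomial_function_cmult)

lemma polynomial_function_csum:
  fixes f :: "'b \<Rightarrow> 'a::euclidean_space \<Rightarrow> complex"
  shows "(\<And>i. i \<in> A \<Longrightarrow> polynomial_function (f i)) \<Longrightarrow> polynomial_function (\<lambda>x. \<Sum>i\<in>A. f i x)"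
  by (induction A rule: infinite_finite_induct) (auto intro: polynomial_function_add)

lemma polynomial_function_inner_complex:
  "polynomial_function (\<lambda>x::'a::euclidean_space. complex_of_real (a \<bullet> x))"
  unfolding polynomial_function_complex
  by (auto intro: real_polynomial_function.intros bounded_linear_inner_right)

lemma isCont_polynomial_function: "polynomial_function f \<Longrightarrow> isCont f x"
  for f :: "'a::euclidean_space \<Rightarrow> 'b::euclidean_space"
  using continuous_on_polymonial_function[of f UNIV] by (simp add: continuous_on_eq_continuous_at)

text \<open>The remainder of \<open>Q\<close> on division by the form \<open>a\<close> is its value
  at the orthogonal projection to the kernel of \<open>a\<close>. Induction over the construction of
  polynomial functions yields the quotient.\<close>

lemma real_polynomial_function_division:
  fixes Q :: "'a::euclidean_space \<Rightarrow> real"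
  assumes "real_polynomial_function Q" "a \<noteq> 0"
  shows "\<exists>R. real_polynomial_function R \<and>
    (\<forall>x. Q (x - ((a \<bullet> x) / (a \<bullet> a)) *\<^sub>R a) = Q x - (a \<bullet> x) * R x)"
  using assms(1)
proof induction
  case (linear f)
  then interpret bounded_linear f .
  have "f (x - ((a \<bullet> x) / (a \<bullet> a)) *\<^sub>R a) = f x - (a \<bullet> x) * (f a / (a \<bullet> a))" for x
    by (simp add: diff scaleR)
  then show ?case by (blast intro: real_polynomial_function.intros(2))
next
  case (const c)
  then show ?case by (intro exI[of _ "\<lambda>x. 0"]) (auto intro: real_polynomial_function.intros(2))
next
  case (add f g)
  then obtain R S where "real_polynomial_function R" "real_polynomial_function S"
    "\<forall>x. f (x - ((a \<bullet> x) / (a \<bullet> a)) *\<^sub>R a) = f x - (a \<bullet> x) * R x"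
    "\<forall>x. g (x - ((a \<bullet> x) / (a \<bullet> a)) *\<^sub>R a) = g x - (a \<bullet> x) * S x" by blast
  then show ?case
    by (intro exI[of _ "\<lambda>x. R x + S x"])
      (auto intro: real_polynomial_function.intros simp: algebra_simps)
next
  case (mult f g)
  then obtain R S where *: "real_polynomial_function R" "real_polynomial_function S"
    "\<forall>x. f (x - ((a \<bullet> x) / (a \<bullet> a)) *\<^sub>R a) = f x - (a \<bullet> x) * R x"
    "\<forall>x. g (x - ((a \<bullet> x) / (a \<bullet> a)) *\<^sub>R a) = g x - (a \<bullet> x) * S x" by blast
  \<comment> \<open>Quotient from f g - f' g' = (f - f') g + f' (g - g'), where the prime denotes
    composition with the projection.\<close>
  have "real_polynomial_function (\<lambda>x. R x * g x + (f x - (a \<bullet> x) * R x) * S x)"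
    using mult.hyps *(1,2) real_polynomial_function.intros(1)[OF bounded_linear_inner_right[of a]]
    by (intro real_polynomial_function.intros(3,4) real_polynomial_function_diff)
  moreover have "f (x - ((a \<bullet> x) / (a \<bullet> a)) *\<^sub>R a) * g (x - ((a \<bullet> x) / (a \<bullet> a)) *\<^sub>R a) =
      f x * g x - (a \<bullet> x) * (R x * g x + (f x - (a \<bullet> x) * R x) * S x)" for x
    unfolding *(3,4)[rule_format] by (simp add: algebra_simps)
  ultimately show ?case by blast
qed

text \<open>The remainder is a value of \<open>Q\<close> on the kernel of \<open>a\<close>, hence 0;
  \<open>a \<in> V\<close> keeps the projected point inside \<open>V\<close>.\<close>

lemma polynomial_function_division:
  fixes Q :: "'a::euclidean_space \<Rightarrow> complex"
  assumes "polynomial_function Q" "subspace V" "a \<in> V" "a \<noteq> 0"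
    and "\<And>x. x \<in> V \<Longrightarrow> a \<bullet> x = 0 \<Longrightarrow> Q x = 0"
  shows "\<exists>R. polynomial_function R \<and> (\<forall>x\<in>V. Q x = complex_of_real (a \<bullet> x) * R x)"
proof -
  obtain R S where R: "real_polynomial_function R" "real_polynomial_function S"
    "\<forall>x. Re (Q (x - ((a \<bullet> x) / (a \<bullet> a)) *\<^sub>R a)) = Re (Q x) - (a \<bullet> x) * R x"
    "\<forall>x. Im (Q (x - ((a \<bullet> x) / (a \<bullet> a)) *\<^sub>R a)) = Im (Q x) - (a \<bullet> x) * S x"
    using real_polynomial_function_division[of "\<lambda>x. Re (Q x)" a]
      real_polynomial_function_division[of "\<lambda>x. Im (Q x)" a] assms(1,4)
    unfolding polynomial_function_complex by blast
  have "Q x = complex_of_real (a \<bullet> x) * Complex (R x) (S x)" if "x \<in> V" for x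
  proof -
    have "Q (x - ((a \<bullet> x) / (a \<bullet> a)) *\<^sub>R a) = 0"
      using assms(2,3,4) that
      by (intro assms(5)) (auto intro: subspace_diff subspace_scale simp: inner_diff_right)
    then show ?thesis using R(3,4) by (auto simp: complex_eq_iff)
  qed
  moreover have "polynomial_function (\<lambda>x. Complex (R x) (S x))"
    using R(1,2) by (simp add: polynomial_function_complex)
  ultimately show ?thesis by blast
qed

text \<open>
  The poles are tested only at the points satisfying \<open>P\<close>, dense in the kernel of each form, and
  along one transversal direction \<open>z\<close>.
\<close>

lemma polynomial_if_no_poles:
  fixes f Q :: "'a::euclidean_space \<Rightarrow> complex"
  assumes "subspace V" "finite A" "z \<in> V" "\<And>a. a \<in> A \<Longrightarrow> a \<bullet> z \<noteq> 0" "set L \<subseteq> A" "A \<subseteq> V"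
    and "polynomial_function Q"
    and "\<And>x. x \<in> V \<Longrightarrow> \<forall>a\<in>A. a \<bullet> x \<noteq> 0 \<Longrightarrow> Q x = f x * (\<Prod>a\<leftarrow>L. complex_of_real (a \<bullet> x))"
    and dense: "\<And>a x e. a \<in> set L \<Longrightarrow> x \<in> V \<Longrightarrow> a \<bullet> x = 0 \<Longrightarrow> e > 0 \<Longrightarrow>
      \<exists>y\<in>V. dist y x < e \<and> a \<bullet> y = 0 \<and> P y"
    and lim: "\<And>x. x \<in> V \<Longrightarrow> P x \<Longrightarrow> ((\<lambda>t. complex_of_real t * f (x + t *\<^sub>R z)) \<longlongrightarrow> 0) (at 0)"
  shows "\<exists>p. polynomial_function p \<and> (\<forall>x\<in>V. (\<forall>a\<in>A. a \<bullet> x \<noteq> 0) \<longrightarrow> f x = p x)"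
  using assms(5,7,8) dense
\<comment> \<open>Each entry of \<open>L\<close> is divided out of the numerator \<open>Q\<close>;
  for the empty list the remaining numerator agrees with \<open>f\<close> off the kernels.\<close>
proof (induction L arbitrary: Q)
  case Nil
  then show ?case by auto
next
  case (Cons a L)
  have a: "a \<in> A" "a \<in> V" "a \<noteq> 0" using Cons.prems(1) assms(4)[of a] assms(6) by auto
  \<comment> \<open>On the kernel of \<open>a\<close> the form takes the value t (a . z) at x + t z,
    so Q (x + t z) is t f (x + t z) times a factor that converges.\<close>
  have zero: "Q x = 0" if x: "x \<in> V" "a \<bullet> x = 0" "P x" for x
  proof -
    have ev: "\<forall>\<^sub>F t in at 0. \<forall>b\<in>A. b \<bullet> (x + t *\<^sub>R z) \<noteq> 0"
      using assms(2,4) by (intro eventually_line_generic) auto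
    have "isCont (\<lambda>t. Q (x + t *\<^sub>R z)) 0"
      by (rule isCont_o2[of 0 "\<lambda>t. x + t *\<^sub>R z" Q])
        (auto intro: isCont_polynomial_function Cons.prems(2) continuous_intros)
    then have "((\<lambda>t. Q (x + t *\<^sub>R z)) \<longlongrightarrow> Q (x + 0 *\<^sub>R z)) (at 0)"
      by (rule isContD)
    moreover have "((\<lambda>t. Q (x + t *\<^sub>R z)) \<longlongrightarrow> 0) (at 0)"
    proof -
      let ?g = "\<lambda>t. complex_of_real t * f (x + t *\<^sub>R z)"
      let ?h = "\<lambda>t. complex_of_real (a \<bullet> z) * (\<Prod>b\<leftarrow>L. complex_of_real (b \<bullet> (x + t *\<^sub>R z)))"
      have "isCont (\<lambda>t. \<Prod>b\<leftarrow>L. complex_of_real (b \<bullet> (x + t *\<^sub>R z))) 0"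
        by (induction L) (auto intro!: continuous_intros)
      then have "(?h \<longlongrightarrow> ?h 0) (at 0)" unfolding isCont_def by (intro tendsto_mult_left)
      from tendsto_mult[OF lim[OF x(1,3)] this]
      have "((\<lambda>t. ?g t * ?h t) \<longlongrightarrow> 0 * ?h 0) (at 0)" .
      moreover have "\<forall>\<^sub>F t in at 0. ?g t * ?h t = Q (x + t *\<^sub>R z)"
        using ev
      proof eventually_elim
        case (elim t)
        have "x + t *\<^sub>R z \<in> V" using x(1) assms(1,3) by (simp add: subspace_add subspace_scale)
        then show ?case using Cons.prems(3) elim x(2) by (simp add: inner_add_right algebra_simps)
      qed
      ultimately show ?thesis by (simp add: filterlim_cong[OF refl refl])
    qed
    ultimately show ?thesis by (simp add: tendsto_unique[of "at (0::real)"])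
  qed
  have "Q x = 0" if "x \<in> V" "a \<bullet> x = 0" for x
    by (rule continuous_eq_on_dense[where f = Q and g = "\<lambda>_. 0" and x = x])
      (use Cons.prems(4)[of a] that zero isCont_polynomial_function[OF Cons.prems(2)] in
        \<open>auto simp: Bex_def\<close>, metis)
  then obtain R where R: "polynomial_function R" "\<And>x. x \<in> V \<Longrightarrow> Q x = complex_of_real (a \<bullet> x) * R x"
    using polynomial_function_division[OF Cons.prems(2) assms(1) a(2,3)] by blast
  show ?case
  proof (rule Cons.IH[OF _ R(1)])
    fix x assume x: "x \<in> V" "\<forall>a\<in>A. a \<bullet> x \<noteq> 0"
    then have "complex_of_real (a \<bullet> x) * R x =
        complex_of_real (a \<bullet> x) * (f x * (\<Prod>a\<leftarrow>L. complex_of_real (a \<bullet> x)))"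
      using Cons.prems(3)[OF x] R(2) by (simp add: mult_ac)
    then show "R x = f x * (\<Prod>a\<leftarrow>L. complex_of_real (a \<bullet> x))" using x(2) a(1) by simp
  qed (use Cons.prems in auto)
qed

section \<open>Lattices\<close>

text \<open>The vector dual to \<open>b\<close> is the part of \<open>b\<close> orthogonal to the
  span of the other vectors, divided by its squared norm, which is also its pairing with
  \<open>b\<close>.\<close>

lemma dual_basis_exists:
  fixes B :: "'a::euclidean_space set"
  assumes "independent B"
  obtains f where "\<And>b. b \<in> B \<Longrightarrow> f b \<in> span B"
    "\<And>b c. b \<in> B \<Longrightarrow> c \<in> B \<Longrightarrow> f b \<bullet> c = (if b = c then 1 else 0)"
proof -
  have "\<exists>z\<in>span B. \<forall>c\<in>B. z \<bullet> c = (if b = c then 1 else 0)" if b: "b \<in> B" for b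
  proof -
    obtain y z where yz: "y \<in> span (B - {b})" "\<And>w. w \<in> span (B - {b}) \<Longrightarrow> orthogonal z w" "b = y + z"
      using orthogonal_subspace_decomp_exists[of "B - {b}" b] by metis
    have "b \<notin> span (B - {b})" using assms b by (auto simp: dependent_def)
    then have z0: "z \<noteq> 0" using yz by auto
    have zb: "z \<bullet> b = z \<bullet> z" using yz(2)[OF yz(1)] yz(3) by (simp add: orthogonal_def inner_add_right)
    have zc: "z \<bullet> c = 0" if "c \<in> B" "c \<noteq> b" for c
      using yz(2)[of c] that by (simp add: orthogonal_def span_base)
    have "z \<in> span B"
      using yz(1,3) b span_mono[of "B - {b}" B] span_diff[of b B y] by (auto simp: span_base)
    then show ?thesis
      using z0 zb zc by (intro bexI[of _ "(1 / (z \<bullet> z)) *\<^sub>R z"]) (auto simp: span_scale)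
  qed
  then show thesis using that by metis
qed

text \<open>The pairings with \<open>g\<close> are integers, bounded by Cauchy-Schwarz, and
  determine the point. Applied with the dual basis to the lattice and with the lattice basis to the
  dual lattice.\<close>

lemma finite_integral_ball:
  fixes S :: "'a::euclidean_space set"
  assumes "finite B" "\<And>x b. x \<in> S \<Longrightarrow> b \<in> B \<Longrightarrow> g b \<bullet> x \<in> \<int>"
    and "\<And>x y. x \<in> S \<Longrightarrow> y \<in> S \<Longrightarrow> (\<And>b. b \<in> B \<Longrightarrow> g b \<bullet> x = g b \<bullet> y) \<Longrightarrow> x = y"
  shows "finite {x \<in> S. norm x \<le> C}"
proof (rule inj_on_finite[of "\<lambda>x. restrict (\<lambda>b. \<lfloor>g b \<bullet> x\<rfloor>) B"])
  show "inj_on (\<lambda>x. restrict (\<lambda>b. \<lfloor>g b \<bullet> x\<rfloor>) B) {x \<in> S. norm x \<le> C}"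
  proof (rule inj_onI)
    fix x y assume xy: "x \<in> {x \<in> S. norm x \<le> C}" "y \<in> {x \<in> S. norm x \<le> C}"
      and eq: "restrict (\<lambda>b. \<lfloor>g b \<bullet> x\<rfloor>) B = restrict (\<lambda>b. \<lfloor>g b \<bullet> y\<rfloor>) B"
    have "g b \<bullet> x = g b \<bullet> y" if "b \<in> B" for b
      using fun_cong[OF eq, of b] that assms(2)[of x b] assms(2)[of y b] xy
      by (auto elim!: Ints_cases)
    then show "x = y" using assms(3) xy by blast
  qed
  let ?K = "\<lambda>b. \<lceil>norm (g b) * C\<rceil>"
  have "\<lfloor>g b \<bullet> x\<rfloor> \<in> {- ?K b - 1..?K b}" if "norm x \<le> C" for x b
  proof -
    have "\<bar>g b \<bullet> x\<bar> \<le> norm (g b) * C"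
      using Cauchy_Schwarz_ineq2[of "g b" x] mult_left_mono[OF that norm_ge_zero[of "g b"]] by linarith
    then show ?thesis by (simp add: abs_le_iff) linarith
  qed
  then show "(\<lambda>x. restrict (\<lambda>b. \<lfloor>g b \<bullet> x\<rfloor>) B) ` {x \<in> S. norm x \<le> C} \<subseteq> (\<Pi>\<^sub>E b\<in>B. {- ?K b - 1..?K b})"
    by (auto intro!: restrict_PiE_iff[THEN iffD2])
  show "finite (\<Pi>\<^sub>E b\<in>B. {- ?K b - 1..?K b})" using assms(1) by (intro finite_PiE) auto
qed

lemma basis_in_lattice:
  fixes B :: "'a::real_vector set"
  assumes "finite B" "b \<in> B"
  shows "\<exists>c::'a \<Rightarrow> int. b = (\<Sum>x\<in>B. of_int (c x) *\<^sub>R x)"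
proof
  have "(\<Sum>x\<in>B. of_int (if x = b then 1 else 0) *\<^sub>R x) = (\<Sum>x\<in>B. if x = b then x else 0)"
    by (intro sum.cong) auto
  then show "b = (\<Sum>x\<in>B. of_int (if x = b then 1 else 0) *\<^sub>R x)" using assms by simp
qed

lemma lattice_basis:
  assumes "is_lattice N"
  obtains B where "independent B" "finite B" "span N = span B"
    "\<And>x. x \<in> N \<longleftrightarrow> (\<exists>c::_ \<Rightarrow> int. x = (\<Sum>b\<in>B. of_int (c b) *\<^sub>R b))"
proof -
  obtain B where B: "independent B" "N = {\<Sum>b\<in>B. of_int (c b) *\<^sub>R b | c :: 'a \<Rightarrow> int. True}"
    using assms by (auto simp: is_lattice_def)
  have fin: "finite B" using B(1) by (rule independent_imp_finite)
  have "b \<in> N" if "b \<in> B" for b using basis_in_lattice[OF fin that] unfolding B(2) by blast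
  moreover have "N \<subseteq> span B" unfolding B(2) by (auto intro!: span_sum span_scale intro: span_base)
  ultimately have "span N = span B"
    by (metis span_mono span_span subset_antisym subsetI)
  with B fin that show thesis by auto
qed

lemma lattice_closed:
  assumes "is_lattice N"
  shows "0 \<in> N" "x \<in> N \<Longrightarrow> y \<in> N \<Longrightarrow> x + y \<in> N" "x \<in> N \<Longrightarrow> y \<in> N \<Longrightarrow> x - y \<in> N"
    "x \<in> N \<Longrightarrow> of_int k *\<^sub>R x \<in> N"
proof -
  obtain B where B: "\<And>x. x \<in> N \<longleftrightarrow> (\<exists>c::_ \<Rightarrow> int. x = (\<Sum>b\<in>B. of_int (c b) *\<^sub>R b))"
    using lattice_basis[OF assms] by metis
  show "0 \<in> N" unfolding B by (rule exI[of _ "\<lambda>_. 0"]) simp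
  show "x + y \<in> N" "x - y \<in> N" if xy: "x \<in> N" "y \<in> N"
  proof -
    obtain c e where "x = (\<Sum>b\<in>B. of_int (c b) *\<^sub>R b)" "y = (\<Sum>b\<in>B. of_int (e b) *\<^sub>R b)"
      using xy unfolding B by blast
    then have *: "x + y = (\<Sum>b\<in>B. of_int (c b + e b) *\<^sub>R b)" "x - y = (\<Sum>b\<in>B. of_int (c b - e b) *\<^sub>R b)"
      by (simp_all add: scaleR_left_distrib scaleR_left_diff_distrib sum.distrib sum_subtractf)
    show "x + y \<in> N" unfolding B by (rule exI[of _ "\<lambda>b. c b + e b"]) fact
    show "x - y \<in> N" unfolding B by (rule exI[of _ "\<lambda>b. c b - e b"]) fact
  qed
  show "of_int k *\<^sub>R x \<in> N" if x: "x \<in> N"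
  proof -
    obtain c where "x = (\<Sum>b\<in>B. of_int (c b) *\<^sub>R b)" using x unfolding B by blast
    then have "of_int k *\<^sub>R x = (\<Sum>b\<in>B. of_int (k * c b) *\<^sub>R b)" by (simp add: scaleR_sum_right)
    then show ?thesis unfolding B by (rule exI[of _ "\<lambda>b. k * c b"])
  qed
qed

lemma lattice_sum:
  assumes "is_lattice N" "\<And>i. i \<in> A \<Longrightarrow> f i \<in> N" shows "sum f A \<in> N"
  using assms(2) by (induction A rule: infinite_finite_induct)
    (auto intro: lattice_closed[OF assms(1)])

lemma finite_lattice_ball:
  assumes "is_lattice N" shows "finite {x \<in> N. norm x \<le> C}"
proof -
  obtain B where B: "independent B" "finite B"
    "\<And>x. x \<in> N \<longleftrightarrow> (\<exists>c::_ \<Rightarrow> int. x = (\<Sum>b\<in>B. of_int (c b) *\<^sub>R b))"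
    using lattice_basis[OF assms] by metis
  obtain f where f: "\<And>b c. b \<in> B \<Longrightarrow> c \<in> B \<Longrightarrow> f b \<bullet> c = (if b = c then 1 else 0)"
    using dual_basis_exists[OF B(1)] by metis
  have fx: "f b \<bullet> (\<Sum>c\<in>B. of_int (e c) *\<^sub>R c) = of_int (e b)" if "b \<in> B" for b and e :: "'a \<Rightarrow> int"
    using that B(2) by (simp add: inner_sum_right f if_distrib[of "(*) _"] sum.delta' cong: if_cong)
  show ?thesis
  proof (rule finite_integral_ball[OF B(2)])
    show "f b \<bullet> x \<in> \<int>" if "x \<in> N" "b \<in> B" for x b
      using that fx by (auto simp: B(3))
    show "x = y" if xy: "x \<in> N" "y \<in> N" and eq: "\<And>b. b \<in> B \<Longrightarrow> f b \<bullet> x = f b \<bullet> y" for x y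
    proof -
      obtain c e where "x = (\<Sum>b\<in>B. of_int (c b) *\<^sub>R b)" "y = (\<Sum>b\<in>B. of_int (e b) *\<^sub>R b)"
        using xy[unfolded B(3)] by blast
      then show ?thesis using eq fx by (auto intro!: sum.cong)
    qed
  qed
qed

lemma dual_lattice_iff:
  assumes "span N = span B" "\<And>x. x \<in> N \<longleftrightarrow> (\<exists>c::_ \<Rightarrow> int. x = (\<Sum>b\<in>B. of_int (c b) *\<^sub>R b))" "finite B"
  shows "u \<in> dual_lattice N \<longleftrightarrow> u \<in> span B \<and> (\<forall>b\<in>B. u \<bullet> b \<in> \<int>)"
proof -
  have "b \<in> N" if "b \<in> B" for b using basis_in_lattice[OF assms(3) that] unfolding assms(2) by blast
  then show ?thesis
    using assms(1) by (auto simp: dual_lattice_def assms(2) inner_sum_right intro!: Ints_sum Ints_mult)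
qed

lemma finite_dual_lattice_ball:
  assumes "is_lattice N" shows "finite {u \<in> dual_lattice N. norm u \<le> C}"
proof -
  obtain B where B: "independent B" "finite B" "span N = span B"
    "\<And>x. x \<in> N \<longleftrightarrow> (\<exists>c::_ \<Rightarrow> int. x = (\<Sum>b\<in>B. of_int (c b) *\<^sub>R b))"
    using lattice_basis[OF assms] by metis
  note iff = dual_lattice_iff[OF B(3,4,2)]
  show ?thesis
  proof (rule finite_integral_ball[OF B(2)])
    show "b \<bullet> u \<in> \<int>" if "u \<in> dual_lattice N" "b \<in> B" for u b
      using that by (simp add: iff inner_commute)
    show "x = y" if "x \<in> dual_lattice N" "y \<in> dual_lattice N" "\<And>b. b \<in> B \<Longrightarrow> b \<bullet> x = b \<bullet> y" for x y
    proof -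
      have "x - y \<in> span B" using that by (simp add: iff span_diff)
      moreover have "orthogonal (x - y) b" if "b \<in> B" for b
        using \<open>\<And>b. b \<in> B \<Longrightarrow> b \<bullet> x = b \<bullet> y\<close>[OF that]
        by (simp add: orthogonal_def inner_commute[of _ b] inner_diff_right)
      ultimately have "orthogonal (x - y) (x - y)" using orthogonal_to_span by blast
      then show ?thesis by (simp add: orthogonal_def)
    qed
  qed
qed

text \<open>Such a \<open>T\<close> is infinite cyclic, generated by its least positive element g,
  so the half-open interval from 0 to c contains |c| / g of its elements; c = 1 gives the
  comparison. Dividing by c covers both signs of c.\<close>

lemma card_real_subgroup:
  fixes T :: "real set"
  assumes diff: "\<And>x y. x \<in> T \<Longrightarrow> y \<in> T \<Longrightarrow> x - y \<in> T"
    and fin: "finite {x \<in> T. 0 \<le> x \<and> x < 1}" and one: "1 \<in> T" and c: "c \<in> T" "c \<noteq> 0"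
  shows "real (card {x \<in> T. 0 \<le> x / c \<and> x / c < 1}) = \<bar>c\<bar> * card {x \<in> T. 0 \<le> x \<and> x < 1}"
proof -
  have zero: "0 \<in> T" using diff[OF one one] by simp
  have neg: "- x \<in> T" if "x \<in> T" for x using diff[OF zero that] by simp
  have add: "x + y \<in> T" if "x \<in> T" "y \<in> T" for x y using diff[OF that(1) neg[OF that(2)]] by simp
  define P where "P = {x \<in> T. 0 < x \<and> x \<le> 1}"
  have "P \<subseteq> insert 1 {x \<in> T. 0 \<le> x \<and> x < 1}" by (auto simp: P_def)
  then have P: "finite P" "P \<noteq> {}" using fin one by (auto simp: P_def intro: finite_subset intro!: exI[of _ 1])
  define g where "g = Min P"
  have gP: "g \<in> P" unfolding g_def using P by simp
  then have g: "g \<in> T" "0 < g" by (auto simp: P_def)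
  have mult_nat: "of_nat k * g \<in> T" for k :: nat
    by (induction k) (auto simp: zero algebra_simps intro: add g(1))
  have mult: "of_int k * g \<in> T" for k :: int
    by (cases k rule: int_cases2) (use mult_nat neg in auto)
  have T: "T = range (\<lambda>k::int. of_int k * g)"
  proof (intro equalityI subsetI)
    fix x assume x: "x \<in> T"
    define e where "e = x - of_int \<lfloor>x / g\<rfloor> * g"
    have e: "e \<in> T" unfolding e_def by (intro diff x mult)
    have "of_int \<lfloor>x / g\<rfloor> \<le> x / g" "x / g < of_int \<lfloor>x / g\<rfloor> + 1" by linarith+
    then have "of_int \<lfloor>x / g\<rfloor> * g \<le> x" "x < (of_int \<lfloor>x / g\<rfloor> + 1) * g"
      using pos_le_divide_eq[OF g(2)] pos_divide_less_eq[OF g(2)] by blast+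
    then have e01: "0 \<le> e" "e < g" by (simp_all add: e_def algebra_simps)
    have "e = 0"
    proof (rule ccontr)
      assume "e \<noteq> 0"
      then have "e \<in> P" using e e01 gP by (auto simp: P_def)
      then have "g \<le> e" unfolding g_def using P by simp
      then show False using e01 by simp
    qed
    then show "x \<in> range (\<lambda>k::int. of_int k * g)" by (auto simp: e_def)
  qed (use mult in auto)
  have count: "real (card {x \<in> T. 0 \<le> x / b \<and> x / b < 1}) = \<bar>b\<bar> / g" if "b \<in> T" "b \<noteq> 0" for b
  proof -
    obtain m :: int where m: "b = of_int m * g" using \<open>b \<in> T\<close> unfolding T by auto
    then have m0: "m \<noteq> 0" using that by auto
    have "{x \<in> T. 0 \<le> x / b \<and> x / b < 1} = (\<lambda>k. of_int (sgn m * k) * g) ` {0..<\<bar>m\<bar>}"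
    proof (intro equalityI subsetI)
      fix x assume "x \<in> {x \<in> T. 0 \<le> x / b \<and> x / b < 1}"
      then obtain k :: int where k: "x = of_int k * g" "0 \<le> x / b" "x / b < 1" unfolding T by auto
      have "x / b = of_int k / of_int m" using k(1) m g(2) by simp
      then have "0 \<le> sgn m * k" "sgn m * k < \<bar>m\<bar>"
        using k(2,3) m0 by (cases "m > 0"; auto simp: zero_le_divide_iff divide_less_eq)+
      moreover have "k = sgn m * (sgn m * k)" using m0 by (cases "m > 0") auto
      ultimately show "x \<in> (\<lambda>k. of_int (sgn m * k) * g) ` {0..<\<bar>m\<bar>}"
        using k(1) by (intro image_eqI[of _ _ "sgn m * k"]) auto
    next
      fix x assume "x \<in> (\<lambda>k. of_int (sgn m * k) * g) ` {0..<\<bar>m\<bar>}"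
      then obtain k where "x = of_int (sgn m * k) * g" "k \<in> {0..<\<bar>m\<bar>}" by (rule imageE)
      then have k: "x = of_int (sgn m * k) * g" "0 \<le> k" "k < \<bar>m\<bar>" by auto
      have "x / b = of_int (sgn m * k) / of_int m" using k(1) m g(2) by simp
      also have "\<dots> = of_int k / of_int \<bar>m\<bar>" using m0 by (cases "m > 0") auto
      finally have "x / b = of_int k / of_int \<bar>m\<bar>" .
      moreover have "0 \<le> of_int k / (of_int \<bar>m\<bar> :: real)" "of_int k / (of_int \<bar>m\<bar> :: real) < 1"
        using k(2,3) m0 by (auto simp: divide_less_eq)
      moreover have "x \<in> T" unfolding k(1) by (rule mult)
      ultimately show "x \<in> {x \<in> T. 0 \<le> x / b \<and> x / b < 1}" by simp
    qed
    moreover have "inj_on (\<lambda>k. of_int (sgn m * k) * g) {0..<\<bar>m\<bar>}"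
      using g(2) m0 by (auto simp: inj_on_def sgn_0_0)
    ultimately have "card {x \<in> T. 0 \<le> x / b \<and> x / b < 1} = nat \<bar>m\<bar>"
      by (simp add: card_image)
    then show ?thesis using m g(2) by (simp add: abs_mult)
  qed
  show ?thesis using count[OF c] count[OF one] by simp
qed

section \<open>Facets of a complete simplicial multi-fan\<close>

text \<open>The linear algebra of a simplicial multi-fan: at every facet I the vectors
  \<open>r i\<close> and \<open>u I i\<close>, \<open>i \<in> I\<close>, are dual bases of
  \<open>span N\<close>, the former inside the lattice. No cone and no face other than the facets
  appears.\<close>

locale facet_bases =
  fixes N :: "'a::euclidean_space set" and r :: "nat \<Rightarrow> 'a" and Fac :: "nat set set"
    and u :: "nat set \<Rightarrow> nat \<Rightarrow> 'a" and n :: nat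
  assumes lattice: "is_lattice N"
    and finite_Fac: "finite Fac"
    and finite_facet: "I \<in> Fac \<Longrightarrow> finite I"
    and card_facet: "I \<in> Fac \<Longrightarrow> card I = n"
    and ray_mem: "I \<in> Fac \<Longrightarrow> i \<in> I \<Longrightarrow> r i \<in> N"
    and dual_mem: "I \<in> Fac \<Longrightarrow> i \<in> I \<Longrightarrow> u I i \<in> span N"
    and dual: "I \<in> Fac \<Longrightarrow> i \<in> I \<Longrightarrow> j \<in> I \<Longrightarrow> u I i \<bullet> r j = (if i = j then 1 else 0)"
    and expand: "I \<in> Fac \<Longrightarrow> x \<in> span N \<Longrightarrow> x = (\<Sum>i\<in>I. (u I i \<bullet> x) *\<^sub>R r i)"
begin

lemma coord:
  assumes "I \<in> Fac" "i \<in> I"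
  shows "u I i \<bullet> (\<Sum>j\<in>I. c j *\<^sub>R r j) = c i"
proof -
  have "u I i \<bullet> (\<Sum>j\<in>I. c j *\<^sub>R r j) = (\<Sum>j\<in>I. if j = i then c j else 0)"
    unfolding inner_sum_right using assms by (intro sum.cong) (auto simp: dual)
  then show ?thesis using assms finite_facet by simp
qed

lemma span_inner_eqI:
  assumes "I \<in> Fac" "x \<in> span N" "x' \<in> span N" "\<And>i. i \<in> I \<Longrightarrow> x \<bullet> r i = x' \<bullet> r i"
  shows "x = x'"
proof -
  have "(x - x') \<bullet> (x - x') = (x - x') \<bullet> (\<Sum>i\<in>I. (u I i \<bullet> (x - x')) *\<^sub>R r i)"
    using expand[OF assms(1) span_diff[OF assms(2,3)]] by simp
  also have "\<dots> = 0" by (simp add: inner_sum_right inner_diff_left assms(4))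
  finally show ?thesis by simp
qed

text \<open>Representatives of \<open>G\<^sub>J\<close> in the unit cube.\<close>

definition par :: "nat set \<Rightarrow> (nat \<Rightarrow> real) set" where
  "par J = {a. (\<forall>i. i \<notin> J \<longrightarrow> a i = 0) \<and> (\<forall>i\<in>J. 0 \<le> a i \<and> a i < 1) \<and> (\<Sum>i\<in>J. a i *\<^sub>R r i) \<in> N}"

lemma par_mono:
  assumes "I \<in> Fac" "J \<subseteq> I"
  shows "par J = {a \<in> par I. \<forall>i\<in>I - J. a i = 0}"
proof -
  have "(\<Sum>i\<in>J. a i *\<^sub>R r i) = (\<Sum>i\<in>I. a i *\<^sub>R r i)" if "\<forall>i\<in>I - J. a i = 0" for a
    using assms that finite_facet by (intro sum.mono_neutral_left) auto
  then show ?thesis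
    using assms(2) unfolding par_def
    by (auto simp: subset_iff)
qed

lemma finite_par:
  assumes "I \<in> Fac" "J \<subseteq> I"
  shows "finite (par J)"
proof -
  have "finite (par I)"
  proof (rule inj_on_finite[of "\<lambda>a. \<Sum>i\<in>I. a i *\<^sub>R r i"])
    show "inj_on (\<lambda>a. \<Sum>i\<in>I. a i *\<^sub>R r i) (par I)"
    proof (rule inj_onI, rule ext)
      fix a b i assume "a \<in> par I" "b \<in> par I" "(\<Sum>i\<in>I. a i *\<^sub>R r i) = (\<Sum>i\<in>I. b i *\<^sub>R r i)"
      then show "a i = b i"
        using coord[OF assms(1), of i a] coord[OF assms(1), of i b] by (cases "i \<in> I") (auto simp: par_def)
    qed
    have "norm (\<Sum>i\<in>I. a i *\<^sub>R r i) \<le> (\<Sum>i\<in>I. norm (r i))" if "a \<in> par I" for a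
      using that by (intro sum_norm_le) (auto simp: par_def mult_left_le_one_le)
    then show "(\<lambda>a. \<Sum>i\<in>I. a i *\<^sub>R r i) ` par I \<subseteq> {x \<in> N. norm x \<le> (\<Sum>i\<in>I. norm (r i))}"
      by (auto simp: par_def)
  qed (rule finite_lattice_ball[OF lattice])
  then show ?thesis using par_mono[OF assms] by simp
qed

lemma int_comb_mem:
  assumes "I \<in> Fac" "\<And>i. i \<in> I \<Longrightarrow> c i \<in> \<int>" shows "(\<Sum>i\<in>I. c i *\<^sub>R r i) \<in> N"
proof (rule lattice_sum[OF lattice])
  fix i assume i: "i \<in> I"
  then obtain k where "c i = of_int k" using assms(2) by (auto elim: Ints_cases)
  then show "c i *\<^sub>R r i \<in> N" using lattice_closed(4)[OF lattice ray_mem[OF assms(1) i]] by simp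
qed

lemma par_reduce:
  assumes "I \<in> Fac" "(\<Sum>i\<in>I. c i *\<^sub>R r i) \<in> N"
  shows "(\<lambda>i. if i \<in> I then frac (c i) else 0) \<in> par I"
proof -
  have "(\<Sum>i\<in>I. frac (c i) *\<^sub>R r i) = (\<Sum>i\<in>I. c i *\<^sub>R r i) - (\<Sum>i\<in>I. of_int \<lfloor>c i\<rfloor> *\<^sub>R r i)"
    by (simp add: frac_def scaleR_left_diff_distrib sum_subtractf)
  also have "\<dots> \<in> N" by (intro lattice_closed(3)[OF lattice assms(2)] int_comb_mem[OF assms(1)]) auto
  finally have "(\<Sum>i\<in>I. frac (c i) *\<^sub>R r i) \<in> N" .
  then show ?thesis by (simp add: par_def frac_lt_1 cong: sum.cong)
qed

text \<open>Translation by an element of the group N / N_I, written on representatives in the unit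
  cube. It is injective because coordinates of representatives differ by less than 1, and onto
  because \<open>par I\<close> is finite.\<close>

lemma card_par_translate:
  assumes "I \<in> Fac" "a \<in> par I"
  defines "\<phi> \<equiv> \<lambda>b i. if i \<in> I then frac (b i + a i) else 0"
  shows "bij_betw \<phi> (par I) (par I)"
proof -
  have memb: "\<phi> b \<in> par I" if "b \<in> par I" for b
  proof -
    have "(\<Sum>i\<in>I. (b i + a i) *\<^sub>R r i) \<in> N"
      using assms(2) that
      by (auto simp: scaleR_left_distrib sum.distrib par_def intro: lattice_closed[OF lattice])
    then show ?thesis unfolding \<phi>_def by (rule par_reduce[OF assms(1)])
  qed
  have "inj_on \<phi> (par I)"
  proof (rule inj_onI, rule ext)
    fix b c i assume bc: "b \<in> par I" "c \<in> par I" "\<phi> b = \<phi> c"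
    show "b i = c i"
    proof (cases "i \<in> I")
      case True
      then have "frac (b i + a i) = frac (c i + a i)" using fun_cong[OF bc(3), of i] by (simp add: \<phi>_def)
      then have "b i - c i = of_int (\<lfloor>b i + a i\<rfloor> - \<lfloor>c i + a i\<rfloor>)" by (simp add: frac_def)
      moreover have "\<bar>b i - c i\<bar> < 1" using bc True by (auto simp: par_def abs_less_iff) (smt (verit))+
      ultimately show ?thesis by (metis eq_iff_diff_eq_0 of_int_0 of_int_abs of_int_less_1_iff zabs_less_one_iff)
    qed (use bc in \<open>auto simp: par_def\<close>)
  qed
  then show ?thesis
    using memb finite_par[OF assms(1) subset_refl] by (metis bij_betw_def endo_inj_surj image_subsetI)
qed

definition slopes :: "nat set \<Rightarrow> nat \<Rightarrow> real set" where
  "slopes I i = (\<lambda>x. u I i \<bullet> x) ` N"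

text \<open>The i-th coordinate map from G_I to R/Z has kernel G_{I - {i}} and image
  \<open>slopes I i\<close> modulo 1; every fibre is a translate of the kernel.\<close>

lemma card_par_fibre:
  assumes "I \<in> Fac" "i \<in> I"
  shows "card (par I) = card (par (I - {i})) * card {t \<in> slopes I i. 0 \<le> t \<and> t < 1}"
    and "finite {t \<in> slopes I i. 0 \<le> t \<and> t < 1}"
proof -
  let ?T = "{t \<in> slopes I i. 0 \<le> t \<and> t < 1}"
  have fin: "finite (par I)" by (rule finite_par[OF assms(1) subset_refl])
  have img: "(\<lambda>a. a i) ` par I = ?T"
  proof (intro equalityI subsetI)
    fix t assume "t \<in> (\<lambda>a. a i) ` par I"
    then obtain a where "a \<in> par I" "t = a i" by auto
    then show "t \<in> ?T"
      using coord[OF assms, of a] assms by (auto simp: par_def slopes_def image_iff intro!: bexI[rotated])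
  next
    fix t assume t: "t \<in> ?T"
    then obtain x where x: "x \<in> N" "t = u I i \<bullet> x" by (auto simp: slopes_def)
    have "(\<Sum>j\<in>I. (u I j \<bullet> x) *\<^sub>R r j) \<in> N" using expand[OF assms(1) span_base[OF x(1)]] x(1) by simp
    from par_reduce[OF assms(1) this] show "t \<in> (\<lambda>a. a i) ` par I"
      by (rule image_eqI[rotated]) (use assms t x in \<open>simp add: frac_eq\<close>)
  qed
  show finT: "finite ?T" using fin unfolding img[symmetric] by simp
  have K: "par (I - {i}) = {a \<in> par I. a i = 0}" using par_mono[OF assms(1), of "I - {i}"] assms by auto
  have fib: "card {a \<in> par I. a i = t} = card (par (I - {i}))" if "t \<in> ?T" for t
  proof -
    obtain a where a: "a \<in> par I" "a i = t" using \<open>t \<in> ?T\<close> unfolding img[symmetric] by auto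
    define \<phi> where "\<phi> = (\<lambda>b j. if j \<in> I then frac (b j + a j) else 0)"
    have bij: "bij_betw \<phi> (par I) (par I)" unfolding \<phi>_def by (rule card_par_translate[OF assms(1) a(1)])
    have t01: "0 \<le> t" "t < 1" using \<open>t \<in> ?T\<close> by auto
    have eq: "\<phi> b i = t \<longleftrightarrow> b i = 0" if b: "b \<in> par I" for b
    proof
      assume "\<phi> b i = t"
      then have "frac (b i + t) = t" using assms(2) a(2) by (simp add: \<phi>_def)
      then have "b i = of_int \<lfloor>b i + t\<rfloor>" by (simp add: frac_def)
      moreover have "0 \<le> b i" "b i < 1" using b assms(2) by (auto simp: par_def)
      ultimately show "b i = 0" by (metis floor_eq_iff floor_of_int of_int_0 add_0)
    qed (use t01 assms(2) a(2) in \<open>simp add: \<phi>_def frac_eq\<close>)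
    have "\<phi> ` {b \<in> par I. b i = 0} = {a \<in> \<phi> ` par I. a i = t}"
      using eq by auto
    then have "\<phi> ` {b \<in> par I. b i = 0} = {a \<in> par I. a i = t}"
      using bij by (simp add: bij_betw_def)
    then have "bij_betw \<phi> {b \<in> par I. b i = 0} {a \<in> par I. a i = t}"
      using bij by (auto simp: bij_betw_def intro: inj_on_subset)
    then show ?thesis using K by (simp add: bij_betw_same_card)
  qed
  have "card (par I) = (\<Sum>t\<in>?T. card {a \<in> par I. a i = t})"
    unfolding card_eq_sum using sum.image_gen[OF fin, of "\<lambda>_. 1" "\<lambda>a. a i"] by (simp only: img)
  then show "card (par I) = card (par (I - {i})) * card ?T" using fib by simp
qed

lemma par_pos: "I \<in> Fac \<Longrightarrow> card (par I) > 0"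
  using finite_par[of I I] lattice_closed(1)[OF lattice]
  by (auto simp: card_gt_0_iff par_def intro!: exI[of _ "\<lambda>_. 0"])

text \<open>Both forms vanish on the hyperplane spanned by the common wall, so they are
  proportional; the factor is read off at \<open>r j\<close>, where \<open>u J j\<close> is
  1.\<close>

lemma wall_proportional:
  assumes I: "I \<in> Fac" "i \<in> I" and J: "J \<in> Fac" "j \<in> J" and K: "I - {i} = J - {j}"
    and z: "z \<in> span N"
  shows "u I i \<bullet> z = (u I i \<bullet> r j) * (u J j \<bullet> z)"
    and "u I i \<bullet> r j \<noteq> 0"
proof -
  have *: "u I i \<bullet> x = (u I i \<bullet> r j) * (u J j \<bullet> x)" if "x \<in> span N" for x
  proof -
    have "u I i \<bullet> x = (\<Sum>k\<in>J. (u J k \<bullet> x) * (u I i \<bullet> r k))"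
      by (subst expand[OF J(1) that]) (simp add: inner_sum_right)
    also have "\<dots> = (\<Sum>k\<in>J. if k = j then (u J j \<bullet> x) * (u I i \<bullet> r j) else 0)"
    proof (rule sum.cong)
      fix k assume "k \<in> J"
      then have "k \<in> I - {i}" if "k \<noteq> j" using K that by blast
      then show "(u J k \<bullet> x) * (u I i \<bullet> r k) = (if k = j then (u J j \<bullet> x) * (u I i \<bullet> r j) else 0)"
        using dual[OF I] by auto
    qed simp
    also have "\<dots> = (u I i \<bullet> r j) * (u J j \<bullet> x)" using J finite_facet by simp
    finally show ?thesis .
  qed
  show "u I i \<bullet> z = (u I i \<bullet> r j) * (u J j \<bullet> z)" by (rule *[OF z])
  show "u I i \<bullet> r j \<noteq> 0"
    using *[OF span_base[OF ray_mem[OF I]]] dual[OF I I(2)] by auto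
qed

text \<open>|G_I| is the order for the wall times the number of slopes in [0, 1), and passing from I
  to J rescales slopes by the factor between the two forms. So |G_I| |u_i| depends on the wall
  alone, and denominators around a wall differ only in sign.\<close>

lemma wall_index:
  assumes I: "I \<in> Fac" "i \<in> I" and J: "J \<in> Fac" "j \<in> J" and K: "I - {i} = J - {j}"
    and z: "z \<in> span N"
  shows "card (par I) * \<bar>u I i \<bullet> z\<bar> = card (par J) * \<bar>u J j \<bullet> z\<bar>"
proof -
  define c where "c = u I i \<bullet> r j"
  have c0: "c \<noteq> 0" unfolding c_def by (rule wall_proportional(2)[OF I J K z])
  have c: "u I i \<bullet> x = c * (u J j \<bullet> x)" if "x \<in> span N" for x
    unfolding c_def by (rule wall_proportional(1)[OF I J K that])
  \<comment> \<open>Dividing by c carries the slopes of I to those of J, so the unit window for J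
    corresponds to the window from 0 to c for I.\<close>
  have eq: "{t \<in> slopes J j. 0 \<le> t \<and> t < 1} = (\<lambda>t. t / c) ` {t \<in> slopes I i. 0 \<le> t / c \<and> t / c < 1}"
  proof -
    have "slopes J j = (\<lambda>t. t / c) ` slopes I i"
      unfolding slopes_def image_image using c0 by (intro image_cong) (simp_all add: c span_base)
    then show ?thesis by auto
  qed
  have "card {t \<in> slopes J j. 0 \<le> t \<and> t < 1} = card {t \<in> slopes I i. 0 \<le> t / c \<and> t / c < 1}"
    unfolding eq using c0 by (intro card_image) (auto simp: inj_on_def)
  moreover have "real (card {t \<in> slopes I i. 0 \<le> t / c \<and> t / c < 1}) =
      \<bar>c\<bar> * card {t \<in> slopes I i. 0 \<le> t \<and> t < 1}"
  proof (rule card_real_subgroup)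
    show "x - y \<in> slopes I i" if "x \<in> slopes I i" "y \<in> slopes I i" for x y
      using that lattice_closed(3)[OF lattice]
      by (auto simp: slopes_def image_iff inner_diff_right[symmetric])
    show "1 \<in> slopes I i"
      using ray_mem[OF I] dual[OF I I(2)] by (auto simp: slopes_def image_iff intro!: bexI[of _ "r i"])
    show "c \<in> slopes I i"
      using ray_mem[OF J] by (auto simp: slopes_def c_def)
  qed (use card_par_fibre(2)[OF I] c0 in auto)
  ultimately have "real (card (par J)) = card (par I) * \<bar>c\<bar>"
    unfolding card_par_fibre(1)[OF I] card_par_fibre(1)[OF J] K by simp
  then show ?thesis by (simp add: c[OF z] abs_mult)
qed

end

section \<open>Facets around a wall and balanced weights\<close>

definition wall_ext :: "'i set set \<Rightarrow> 'i set \<Rightarrow> 'i set" where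
  "wall_ext Fac K = {j. j \<notin> K \<and> insert j K \<in> Fac}"

text \<open>
  Of completeness only the balancing of weights around walls is used, stated with a test vector
  \<open>z\<close>: the sign of \<open>u (insert j K) j \<bullet> z\<close> tells on which side of the wall \<open>K\<close> the ray \<open>j\<close> lies.
\<close>

locale balanced_fan = facet_bases N r Fac u n
  for N :: "'a::euclidean_space set" and r Fac u n +
  fixes w :: "nat set \<Rightarrow> int"
  assumes balanced: "I \<in> Fac \<Longrightarrow> i \<in> I \<Longrightarrow> z \<in> span N \<Longrightarrow>
      (\<Sum>j\<in>wall_ext Fac (I - {i}). of_int (w (insert j (I - {i}))) *
         sgn (u (insert j (I - {i})) j \<bullet> z)) = 0"
begin

text \<open>By \<open>wall_index\<close> the denominators share one absolute value \<gamma>, so this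
  is the balancing identity divided by \<gamma>. It is the form in which balancing enters the
  residues.\<close>

lemma balanced_index:
  assumes I: "I \<in> Fac" "i \<in> I" and z: "z \<in> span N"
  shows "(\<Sum>j\<in>wall_ext Fac (I - {i}). of_int (w (insert j (I - {i}))) /
    (card (par (insert j (I - {i}))) * (u (insert j (I - {i})) j \<bullet> z))) = 0"
proof -
  let ?K = "I - {i}"
  define \<gamma> where "\<gamma> = card (par I) * \<bar>u I i \<bullet> z\<bar>"
  have "1 / (card (par (insert j ?K)) * (u (insert j ?K) j \<bullet> z)) = sgn (u (insert j ?K) j \<bullet> z) / \<gamma>"
    if "j \<in> wall_ext Fac ?K" for j
  proof -
    have j: "insert j ?K \<in> Fac" "j \<notin> ?K" using that by (auto simp: wall_ext_def)
    have "insert j ?K - {j} = ?K" using j(2) by blast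
    then have "\<gamma> = card (par (insert j ?K)) * \<bar>u (insert j ?K) j \<bullet> z\<bar>"
      unfolding \<gamma>_def by (intro wall_index I j z) auto
    then show ?thesis by (simp add: sgn_real_def abs_if)
  qed
  then have "(\<Sum>j\<in>wall_ext Fac ?K. of_int (w (insert j ?K)) /
      (card (par (insert j ?K)) * (u (insert j ?K) j \<bullet> z))) =
    (\<Sum>j\<in>wall_ext Fac ?K. of_int (w (insert j ?K)) * sgn (u (insert j ?K) j \<bullet> z)) / \<gamma>"
    unfolding sum_divide_distrib by (intro sum.cong) (auto simp: divide_inverse)
  then show ?thesis using balanced[OF I z] by simp
qed

text \<open>Pairs (I, i) are grouped by their wall I - {i}: by \<open>sat\<close> the set
  \<open>Z\<close> consists of full groups, \<open>h\<close> is constant on a group, and the values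
  of \<open>s\<close> in a group cancel. The ring is left general because residues are complex and
  jumps are real.\<close>

lemma sum_walls:
  fixes s :: "nat set \<Rightarrow> nat \<Rightarrow> 'b::comm_ring_1" and h :: "nat set \<Rightarrow> 'b"
  assumes "\<And>I i. I \<in> Fac \<Longrightarrow> i \<in> I \<Longrightarrow>
      (\<Sum>j\<in>wall_ext Fac (I - {i}). s (insert j (I - {i})) j) = 0"
    and Z: "Z \<subseteq> Sigma Fac id"
    and sat: "\<And>I i J j. (I, i) \<in> Z \<Longrightarrow> J \<in> Fac \<Longrightarrow> j \<in> J \<Longrightarrow> I - {i} = J - {j} \<Longrightarrow> (J, j) \<in> Z"
  shows "(\<Sum>(I, i)\<in>Z. s I i * h (I - {i})) = 0"
proof -
  have finZ: "finite Z"
    using Z finite_Fac finite_facet by (auto intro!: finite_subset[OF Z] finite_SigmaI)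
  let ?f = "\<lambda>(I, i). I - {i}"
  have "(\<Sum>(I, i)\<in>Z. s I i * h (I - {i})) =
      (\<Sum>K\<in>?f ` Z. \<Sum>p\<in>{p \<in> Z. ?f p = K}. case p of (I, i) \<Rightarrow> s I i * h (I - {i}))"
    by (rule sum.image_gen[OF finZ])
  also have "\<dots> = 0"
  proof (rule sum.neutral, rule ballI)
    fix K assume "K \<in> ?f ` Z"
    then obtain I i where Ii: "(I, i) \<in> Z" "K = I - {i}" by auto
    then have I: "I \<in> Fac" "i \<in> I" using Z by auto
    have "bij_betw (\<lambda>j. (insert j K, j)) (wall_ext Fac K) {p \<in> Z. ?f p = K}"
    proof (rule bij_betwI[where g = snd])
      show "(\<lambda>j. (insert j K, j)) \<in> wall_ext Fac K \<rightarrow> {p \<in> Z. ?f p = K}"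
        using sat[OF Ii(1)] Ii(2) by (auto simp: wall_ext_def)
      show "snd \<in> {p \<in> Z. ?f p = K} \<rightarrow> wall_ext Fac K"
        using Z by (auto simp: wall_ext_def insert_absorb)
      show "(insert (snd p) K, snd p) = p" if "p \<in> {p \<in> Z. ?f p = K}" for p
        using that Z by auto
    qed auto
    from sum.reindex_bij_betw[OF this, of "\<lambda>p. case p of (I, i) \<Rightarrow> s I i * h (I - {i})"]
    have "(\<Sum>p\<in>{p \<in> Z. ?f p = K}. case p of (I, i) \<Rightarrow> s I i * h (I - {i})) =
        (\<Sum>j\<in>wall_ext Fac K. s (insert j K) j * h (insert j K - {j}))"
      by simp
    also have "\<dots> = (\<Sum>j\<in>wall_ext Fac K. s (insert j K) j * h K)"
      by (intro sum.cong) (auto simp: wall_ext_def)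
    also have "\<dots> = 0" using assms(1)[OF I] Ii(2) by (simp flip: sum_distrib_right)
    finally show "(\<Sum>p\<in>{p \<in> Z. ?f p = K}. case p of (I, i) \<Rightarrow> s I i * h (I - {i})) = 0" .
  qed
  finally show ?thesis .
qed

text \<open>Coordinates of x in the ray basis at I, extended by 0 so that a point in the span of a
  wall has the same coordinates at every facet around that wall.\<close>

definition y :: "nat set \<Rightarrow> 'a \<Rightarrow> nat \<Rightarrow> real" where
  "y I x i = (if i \<in> I then u I i \<bullet> x else 0)"

lemma y_wall:
  assumes I: "I \<in> Fac" "i \<in> I" and J: "J \<in> Fac" "j \<in> J" and K: "I - {i} = J - {j}"
    and x: "x \<in> span N" "u I i \<bullet> x = 0"
  shows "y J x = y I x" "u J j \<bullet> x = 0"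
proof -
  define c where "c = (\<lambda>k. if k \<in> I - {i} then u I k \<bullet> x else 0)"
  have "x = (\<Sum>k\<in>I. (u I k \<bullet> x) *\<^sub>R r k)" by (rule expand[OF I(1) x(1)])
  also have "\<dots> = (\<Sum>k\<in>I - {i}. c k *\<^sub>R r k)"
    using I finite_facet x(2) by (intro sum.mono_neutral_cong_right) (auto simp: c_def)
  also have "\<dots> = (\<Sum>k\<in>J. c k *\<^sub>R r k)"
    using J finite_facet unfolding K by (intro sum.mono_neutral_left) (auto simp: c_def K)
  finally have "u J k \<bullet> x = c k" if "k \<in> J" for k using coord[OF J(1) that, of c] by simp
  moreover have "c j = 0" using K by (auto simp: c_def)
  ultimately show "u J j \<bullet> x = 0" "y J x = y I x"
    using J I x(2) K by (auto simp: y_def c_def fun_eq_iff)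
qed

end

section \<open>Generic vectors and the walls through a point\<close>

context balanced_fan
begin

definition forms :: "'a set" where
  "forms = (\<Union>I\<in>Fac. u I ` I)"

definition gen :: "'a \<Rightarrow> bool" where
  "gen x \<longleftrightarrow> x \<in> span N \<and> (\<forall>a\<in>forms. a \<bullet> x \<noteq> 0)"

lemma finite_forms: "finite forms"
  unfolding forms_def using finite_Fac finite_facet by auto

lemma formsI: "I \<in> Fac \<Longrightarrow> i \<in> I \<Longrightarrow> u I i \<in> forms"
  by (auto simp: forms_def)

lemma forms_subset: "forms \<subseteq> span N"
  unfolding forms_def using dual_mem by auto

lemma forms_nontrivial: "a \<in> forms \<Longrightarrow> \<exists>y\<in>span N. a \<bullet> y \<noteq> 0"
proof -
  assume "a \<in> forms"
  then obtain I i where I: "I \<in> Fac" "i \<in> I" "a = u I i" by (auto simp: forms_def)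
  then show ?thesis
    using dual[of I i i] span_base[OF ray_mem[of I i]] by (intro bexI[of _ "r i"]) auto
qed

lemma genD: "gen x \<Longrightarrow> I \<in> Fac \<Longrightarrow> i \<in> I \<Longrightarrow> u I i \<bullet> x \<noteq> 0" "gen x \<Longrightarrow> x \<in> span N"
  by (auto simp: gen_def formsI)

lemma gen_dense: "x \<in> span N \<Longrightarrow> e > 0 \<Longrightarrow> \<exists>y. gen y \<and> dist y x < e"
  using perturb_generic[of "span N" forms x e] finite_forms forms_nontrivial
  by (auto simp: gen_def)

text \<open>Failure is a condition of codimension 2. At points with this property the poles of the
  index sum are simple, and each product of signs has at most one factor about to jump.\<close>

definition codim1 :: "'a \<Rightarrow> bool" where
  "codim1 x \<longleftrightarrow> (\<forall>I\<in>Fac. \<forall>i\<in>I. \<forall>k\<in>I. u I i \<bullet> x = 0 \<longrightarrow> u I k \<bullet> x = 0 \<longrightarrow> i = k)"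

definition walls_at :: "'a \<Rightarrow> (nat set \<times> nat) set" where
  "walls_at x = {(I, i). I \<in> Fac \<and> i \<in> I \<and> u I i \<bullet> x = 0}"

text \<open>All facets around a wall through x give x the same coordinates, so
  \<open>h (I - {i}) (y I x)\<close> depends on the wall only. The \<open>SOME\<close> selects these
  coordinates, because \<open>sum_walls\<close> takes a function of the wall.\<close>

lemma sum_walls_at:
  fixes s :: "nat set \<Rightarrow> nat \<Rightarrow> 'b::comm_ring_1" and h :: "nat set \<Rightarrow> (nat \<Rightarrow> real) \<Rightarrow> 'b"
  assumes "\<And>I i. I \<in> Fac \<Longrightarrow> i \<in> I \<Longrightarrow>
      (\<Sum>j\<in>wall_ext Fac (I - {i}). s (insert j (I - {i})) j) = 0"
    and x: "x \<in> span N"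
  shows "(\<Sum>I\<in>Fac. \<Sum>i | i \<in> I \<and> u I i \<bullet> x = 0. s I i * h (I - {i}) (y I x)) = 0"
proof -
  define c where "c K = (SOME c. \<exists>I i. (I, i) \<in> walls_at x \<and> I - {i} = K \<and> c = y I x)" for K
  have c: "c (I - {i}) = y I x" if "(I, i) \<in> walls_at x" for I i
  proof -
    have "\<exists>c J j. (J, j) \<in> walls_at x \<and> J - {j} = I - {i} \<and> c = y J x" using that by blast
    from someI_ex[OF this] obtain J j
      where J: "(J, j) \<in> walls_at x" "J - {j} = I - {i}" "c (I - {i}) = y J x"
      unfolding c_def[symmetric] by blast
    have "y I x = y J x"
      using J(1) that by (intro y_wall(1)[OF _ _ _ _ J(2) x]) (auto simp: walls_at_def)
    then show ?thesis using J(3) by simp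
  qed
  have "(\<Sum>I\<in>Fac. \<Sum>i | i \<in> I \<and> u I i \<bullet> x = 0. s I i * h (I - {i}) (y I x)) =
      (\<Sum>(I, i)\<in>(SIGMA I:Fac. {i. i \<in> I \<and> u I i \<bullet> x = 0}). s I i * h (I - {i}) (y I x))"
    by (rule sum.Sigma) (use finite_Fac finite_facet in auto)
  also have "\<dots> = (\<Sum>(I, i)\<in>walls_at x. s I i * h (I - {i}) (c (I - {i})))"
    by (intro sum.cong) (auto simp: c, auto simp: walls_at_def)
  also have "\<dots> = 0"
  proof (rule sum_walls[OF assms(1)])
    fix I i J j assume "(I, i) \<in> walls_at x" "J \<in> Fac" "j \<in> J" "I - {i} = J - {j}"
    then show "(J, j) \<in> walls_at x"
      using y_wall(2)[of I i J j x] x by (simp add: walls_at_def)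
  qed (auto simp: walls_at_def)
  finally show ?thesis .
qed

text \<open>A point of the kernel V of \<open>a\<close> is moved within V off every form that is not
  identically 0 there. Two forms of one facet are independent and cannot both vanish on the
  hyperplane V.\<close>

lemma codim1_dense:
  assumes a: "a \<in> forms" and x: "x \<in> span N" "a \<bullet> x = 0" and e: "e > 0"
  shows "\<exists>y\<in>span N. dist y x < e \<and> a \<bullet> y = 0 \<and> codim1 y"
proof -
  define V where "V = {x \<in> span N. a \<bullet> x = 0}"
  have V: "subspace V"
    unfolding V_def using subspace_span[of N]
    by (auto simp: subspace_def inner_add_right)
  define A where "A = {b \<in> forms. \<exists>y\<in>V. b \<bullet> y \<noteq> 0}"
  obtain y where y: "y \<in> V" "dist y x < e" "\<forall>b\<in>A. b \<bullet> y \<noteq> 0"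
    using perturb_generic[OF V, of A x e] finite_forms x e by (auto simp: A_def V_def)
  have "i = k" if I: "I \<in> Fac" "i \<in> I" "k \<in> I" and z: "u I i \<bullet> y = 0" "u I k \<bullet> y = 0" for I i k
  proof (rule ccontr)
    assume ne: "i \<noteq> k"
    have i: "\<forall>t\<in>V. u I i \<bullet> t = 0" and k: "\<forall>t\<in>V. u I k \<bullet> t = 0"
      using y(3) z formsI I by (auto simp: A_def)
    have r: "r i \<in> span N" "r k \<in> span N" using ray_mem I span_base by blast+
    \<comment> \<open>The combination of \<open>r i\<close> and \<open>r k\<close> killed by
      \<open>a\<close>. As \<open>u I k\<close> vanishes on it, a . r i = 0, so \<open>r i\<close>
      lies in V although \<open>u I i\<close> is 1 there.\<close>
    define t where "t = (a \<bullet> r k) *\<^sub>R r i - (a \<bullet> r i) *\<^sub>R r k"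
    have "t \<in> V" using r by (auto simp: V_def t_def span_diff span_scale inner_diff_right)
    then have "u I k \<bullet> t = 0" using k by blast
    then have "a \<bullet> r i = 0" using ne I by (simp add: t_def inner_diff_right dual)
    then have "r i \<in> V" using r by (simp add: V_def)
    then show False using i I dual[of I i i] by auto
  qed
  then show ?thesis using y by (intro bexI[of _ y]) (auto simp: V_def codim1_def)
qed

text \<open>
  Each pole along a wall is simple, and its residues at the facets containing that wall cancel.
\<close>

theorem index_sum_polynomial:
  fixes E :: "(nat \<Rightarrow> complex) \<Rightarrow> complex"
  assumes E: "\<And>I. I \<in> Fac \<Longrightarrow> polynomial_function (\<lambda>x. E (\<lambda>i. complex_of_real (y I x i)))"
  shows "\<exists>p. polynomial_function p \<and> (\<forall>x. gen x \<longrightarrow>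
    (\<Sum>I\<in>Fac. of_int (w I) * E (\<lambda>i. complex_of_real (y I x i)) /
      (of_nat (card (par I)) * (\<Prod>i\<in>I. complex_of_real (u I i \<bullet> x)))) = p x)"
proof -
  define F where "F I x = of_int (w I) / of_nat (card (par I)) * E (\<lambda>i. complex_of_real (y I x i))" for I x
  define f where "f x = (\<Sum>I\<in>Fac. F I x / (\<Prod>i\<in>I. complex_of_real (u I i \<bullet> x)))" for x
  define Q where "Q x = (\<Sum>I\<in>Fac. F I x * (\<Prod>J\<in>Fac - {I}. \<Prod>j\<in>J. complex_of_real (u J j \<bullet> x)))" for x
  obtain z where z: "gen z" using gen_dense[of 0 1] by (auto simp: span_zero)
  have polyF: "polynomial_function (F I)" if "I \<in> Fac" for I
    unfolding F_def by (intro polynomial_function_cmult polynomial_function_const E that)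
  \<comment> \<open>A list rather than a set of forms: equal forms arising from different facets
    enter the common denominator with multiplicity.\<close>
  obtain ps where ps: "set ps = Sigma Fac id" "distinct ps"
    using finite_distinct_list[of "Sigma Fac id"] finite_Fac finite_facet by auto
  define L where "L = map (\<lambda>(I, i). u I i) ps"
  have prodL: "(\<Prod>a\<leftarrow>L. complex_of_real (a \<bullet> x)) = (\<Prod>I\<in>Fac. \<Prod>i\<in>I. complex_of_real (u I i \<bullet> x))" for x
  proof -
    have "(\<Prod>a\<leftarrow>L. complex_of_real (a \<bullet> x)) = (\<Prod>p\<leftarrow>ps. case p of (I, i) \<Rightarrow> complex_of_real (u I i \<bullet> x))"
      unfolding L_def map_map by (intro arg_cong[of _ _ prod_list] map_cong) auto
    also have "\<dots> = (\<Prod>p\<in>Sigma Fac id. case p of (I, i) \<Rightarrow> complex_of_real (u I i \<bullet> x))"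
      using ps by (metis prod.distinct_set_conv_list)
    also have "\<dots> = (\<Prod>I\<in>Fac. \<Prod>i\<in>I. complex_of_real (u I i \<bullet> x))"
      by (subst prod.Sigma) (use finite_Fac finite_facet in \<open>auto simp: id_def\<close>)
    finally show ?thesis .
  qed
  have "\<exists>p. polynomial_function p \<and> (\<forall>x\<in>span N. (\<forall>a\<in>forms. a \<bullet> x \<noteq> 0) \<longrightarrow> f x = p x)"
  proof (rule polynomial_if_no_poles[where L = L and z = z and Q = Q and P = codim1])
    show "set L \<subseteq> forms" using ps(1) by (auto simp: L_def intro: formsI)
    show "polynomial_function Q"
      unfolding Q_def
      by (intro polynomial_function_csum polynomial_function_cmult polynomial_function_cprod
          polynomial_function_inner_complex polyF)
    show "Q x = f x * (\<Prod>a\<leftarrow>L. complex_of_real (a \<bullet> x))"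
      if x: "x \<in> span N" "\<forall>a\<in>forms. a \<bullet> x \<noteq> 0" for x
      unfolding prodL f_def Q_def sum_distrib_right
    proof (rule sum.cong)
      fix I assume I: "I \<in> Fac"
      have "(\<Prod>i\<in>I. complex_of_real (u I i \<bullet> x)) \<noteq> 0"
        using x I finite_facet formsI by auto
      then show "F I x * (\<Prod>J\<in>Fac - {I}. \<Prod>j\<in>J. complex_of_real (u J j \<bullet> x)) =
          F I x / (\<Prod>i\<in>I. complex_of_real (u I i \<bullet> x)) *
          (\<Prod>I\<in>Fac. \<Prod>i\<in>I. complex_of_real (u I i \<bullet> x))"
        using prod.remove[OF finite_Fac I, of "\<lambda>I. \<Prod>i\<in>I. complex_of_real (u I i \<bullet> x)"] by simp
    qed simp
    show "\<exists>y\<in>span N. dist y x < e \<and> a \<bullet> y = 0 \<and> codim1 y"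
      if "a \<in> set L" "x \<in> span N" "a \<bullet> x = 0" "e > 0" for a x e
      using codim1_dense[of a x e] that ps(1) formsI by (auto simp: L_def)
    show "((\<lambda>t. complex_of_real t * f (x + t *\<^sub>R z)) \<longlongrightarrow> 0) (at 0)"
      if x: "x \<in> span N" "codim1 x" for x
    proof -
      \<comment> \<open>Factors of the residue along z: \<open>s\<close> collects the weight, the
        order of the group and the slope of the vanishing form, \<open>h\<close> whatever the wall
        determines.\<close>
      define s where "s I i = complex_of_real (of_int (w I) / (card (par I) * (u I i \<bullet> z)))" for I i
      define h where "h K c = E (\<lambda>i. complex_of_real (c i)) / (\<Prod>k\<in>K. complex_of_real (c k))"
        for K :: "nat set" and c
      have tends: "((\<lambda>t. complex_of_real t * (F I (x + t *\<^sub>R z) / (\<Prod>i\<in>I. complex_of_real (u I i \<bullet> (x + t *\<^sub>R z)))))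
          \<longlongrightarrow> (\<Sum>i | i \<in> I \<and> u I i \<bullet> x = 0. s I i * h (I - {i}) (y I x))) (at 0)" if I: "I \<in> Fac" for I
      proof -
        have cF: "((\<lambda>t. F I (x + t *\<^sub>R z)) \<longlongrightarrow> F I x) (at 0)"
        proof -
          have "isCont (\<lambda>t. F I (x + t *\<^sub>R z)) 0"
            by (rule isCont_o2[of 0 "\<lambda>t. x + t *\<^sub>R z" "F I"])
              (auto intro: isCont_polynomial_function polyF I continuous_intros)
          then show ?thesis by (simp add: isCont_def)
        qed
        have cP: "((\<lambda>t. \<Prod>i\<in>K. complex_of_real (u I i \<bullet> (x + t *\<^sub>R z))) \<longlongrightarrow>
            (\<Prod>i\<in>K. complex_of_real (u I i \<bullet> x))) (at 0)" for K
        proof -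
          have "isCont (\<lambda>t. \<Prod>i\<in>K. complex_of_real (u I i \<bullet> (x + t *\<^sub>R z))) 0"
            by (intro continuous_intros)
          then show ?thesis by (simp add: isCont_def)
        qed
        show ?thesis
        proof (cases "\<exists>i\<in>I. u I i \<bullet> x = 0")
          case True
          then obtain i where i: "i \<in> I" "u I i \<bullet> x = 0" by blast
          then have set: "{i. i \<in> I \<and> u I i \<bullet> x = 0} = {i}"
            using x(2) I by (auto simp: codim1_def)
          have nz: "(\<Prod>i\<in>I - {i}. complex_of_real (u I i \<bullet> x)) \<noteq> 0"
            using set I finite_facet by auto
          have "((\<lambda>t. F I (x + t *\<^sub>R z) / complex_of_real (u I i \<bullet> z) /
                (\<Prod>i\<in>I - {i}. complex_of_real (u I i \<bullet> (x + t *\<^sub>R z)))) \<longlongrightarrow>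
              F I x / complex_of_real (u I i \<bullet> z) / (\<Prod>i\<in>I - {i}. complex_of_real (u I i \<bullet> x))) (at 0)"
            by (intro tendsto_divide cF cP tendsto_const nz) (use genD(1)[OF z I i(1)] in auto)
          moreover
          have prod_y: "(\<Prod>k\<in>I - {i}. complex_of_real (y I x k)) =
              (\<Prod>k\<in>I - {i}. complex_of_real (u I k \<bullet> x))"
            by (intro prod.cong) (auto simp: y_def)
          then have "F I x / complex_of_real (u I i \<bullet> z) / (\<Prod>i\<in>I - {i}. complex_of_real (u I i \<bullet> x)) =
              (\<Sum>i | i \<in> I \<and> u I i \<bullet> x = 0. s I i * h (I - {i}) (y I x))"
            unfolding set by (simp add: F_def s_def h_def)
          moreover have "\<forall>\<^sub>F t in at 0. F I (x + t *\<^sub>R z) / complex_of_real (u I i \<bullet> z) /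
                (\<Prod>i\<in>I - {i}. complex_of_real (u I i \<bullet> (x + t *\<^sub>R z))) =
              complex_of_real t * (F I (x + t *\<^sub>R z) / (\<Prod>i\<in>I. complex_of_real (u I i \<bullet> (x + t *\<^sub>R z))))"
            unfolding eventually_at_filter
            by (intro always_eventually)
              (simp add: inner_add_right i(2) prod.remove[OF finite_facet[OF I] i(1)])
          ultimately show ?thesis by (simp add: filterlim_cong[OF refl refl])
        next
          case False
          then have nz: "(\<Prod>i\<in>I. complex_of_real (u I i \<bullet> x)) \<noteq> 0" using finite_facet[OF I] by simp
          have "((\<lambda>t. complex_of_real t * (F I (x + t *\<^sub>R z) / (\<Prod>i\<in>I. complex_of_real (u I i \<bullet> (x + t *\<^sub>R z)))))
            \<longlongrightarrow> complex_of_real 0 * (F I x / (\<Prod>i\<in>I. complex_of_real (u I i \<bullet> x)))) (at 0)"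
            by (intro tendsto_mult tendsto_divide cF cP nz tendsto_of_real tendsto_ident_at)
          moreover have "{i. i \<in> I \<and> u I i \<bullet> x = 0} = {}" using False by blast
          ultimately show ?thesis by (simp only: sum.empty) simp
        qed
      qed
      have "(\<Sum>I\<in>Fac. \<Sum>i | i \<in> I \<and> u I i \<bullet> x = 0. s I i * h (I - {i}) (y I x)) = 0"
      proof (rule sum_walls_at[OF _ x(1)])
        fix I i assume "I \<in> Fac" "i \<in> I"
        from balanced_index[OF this genD(2)[OF z]]
        show "(\<Sum>j\<in>wall_ext Fac (I - {i}). s (insert j (I - {i})) j) = 0"
          unfolding s_def by (simp only: of_real_sum[symmetric]) simp
      qed
      moreover have "((\<lambda>t. \<Sum>I\<in>Fac. complex_of_real t * (F I (x + t *\<^sub>R z) /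
            (\<Prod>i\<in>I. complex_of_real (u I i \<bullet> (x + t *\<^sub>R z))))) \<longlongrightarrow>
          (\<Sum>I\<in>Fac. \<Sum>i | i \<in> I \<and> u I i \<bullet> x = 0. s I i * h (I - {i}) (y I x))) (at 0)"
        by (intro tendsto_sum tends)
      ultimately show ?thesis by (simp add: f_def sum_distrib_left)
    qed
  qed (use finite_forms forms_subset z in \<open>auto simp: gen_def\<close>)
  then show ?thesis by (auto simp: gen_def f_def F_def mult_ac)
qed

section \<open>Wall crossing\<close>

text \<open>
  If \<open>a i\<close> is the sign of \<open>\<langle>q, r i\<rangle>\<close> minus the offset of the \<open>i\<close>-th hyperplane, the product is nonzero
  exactly when \<open>q\<close> lies in the cone at \<open>I\<close> flipped according to \<open>x\<close>; up to the factor \<open>(-2)\<^sup>n\<close> this is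
  then the Duistermaat-Heckman function at \<open>q\<close>.
\<close>

definition sign_sum :: "(nat \<Rightarrow> real) \<Rightarrow> 'a \<Rightarrow> real" where
  "sign_sum a x = (\<Sum>I\<in>Fac. of_int (w I) * (\<Prod>i\<in>I. a i + sgn (u I i \<bullet> x)))"

lemma eventually_sgn_line:
  fixes x z :: 'a
  shows "\<forall>\<^sub>F t in nhds 0. sgn (b \<bullet> (x + t *\<^sub>R z)) = (if b \<bullet> x = 0 then sgn t * sgn (b \<bullet> z) else sgn (b \<bullet> x))"
proof (cases "b \<bullet> x = 0")
  case True
  then show ?thesis by (simp add: inner_add_right sgn_mult)
next
  case False
  have "((\<lambda>t. b \<bullet> (x + t *\<^sub>R z)) \<longlongrightarrow> b \<bullet> (x + 0 *\<^sub>R z)) (nhds 0)"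
    by (intro tendsto_intros filterlim_ident)
  then have lim: "((\<lambda>t. b \<bullet> (x + t *\<^sub>R z)) \<longlongrightarrow> b \<bullet> x) (nhds 0)" by simp
  show ?thesis
  proof (cases "b \<bullet> x > 0")
    case True
    then have "\<forall>\<^sub>F t in nhds 0. b \<bullet> (x + t *\<^sub>R z) > 0" using lim by (rule order_tendstoD(1)[rotated])
    then show ?thesis by eventually_elim (use True in simp)
  next
    case neg: False
    then have "b \<bullet> x < 0" using False by simp
    with lim have "\<forall>\<^sub>F t in nhds 0. b \<bullet> (x + t *\<^sub>R z) < 0" by (rule order_tendstoD(2))
    then show ?thesis by eventually_elim (use \<open>b \<bullet> x < 0\<close> in simp)
  qed
qed

text \<open>Near a wall one factor per adjacent facet depends on t, through sgn t, and the total
  coefficient of sgn t is the balancing sum, which is 0. Since sgn 0 = 0 the value on the wall fits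
  in, so constancy holds on a full neighbourhood of t = 0.\<close>

lemma sign_sum_local_const:
  assumes x: "x \<in> span N" "codim1 x" and z: "z \<in> span N"
  shows "\<forall>\<^sub>F t in nhds 0. sign_sum a (x + t *\<^sub>R z) = sign_sum a x"
proof -
  define s where "s I i = of_int (w I) * sgn (u I i \<bullet> z)" for I i
  define h where "h K c = (\<Prod>k\<in>K. a k + sgn (c k))" for K :: "nat set" and c :: "nat \<Rightarrow> real"
  have cancel: "(\<Sum>I\<in>Fac. \<Sum>i | i \<in> I \<and> u I i \<bullet> x = 0. s I i * h (I - {i}) (y I x)) = 0"
    by (rule sum_walls_at[OF _ x(1)]) (use balanced z in \<open>simp add: s_def\<close>)
  have "\<forall>\<^sub>F t in nhds 0. \<forall>b\<in>forms. sgn (b \<bullet> (x + t *\<^sub>R z)) =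
      (if b \<bullet> x = 0 then sgn t * sgn (b \<bullet> z) else sgn (b \<bullet> x))"
    using finite_forms eventually_sgn_line by (simp add: eventually_ball_finite)
  then show ?thesis
  proof eventually_elim
    case (elim t)
    have "of_int (w I) * (\<Prod>i\<in>I. a i + sgn (u I i \<bullet> (x + t *\<^sub>R z))) =
        of_int (w I) * (\<Prod>i\<in>I. a i + sgn (u I i \<bullet> x)) +
        sgn t * (\<Sum>i | i \<in> I \<and> u I i \<bullet> x = 0. s I i * h (I - {i}) (y I x))" if I: "I \<in> Fac" for I
    proof (cases "\<exists>i\<in>I. u I i \<bullet> x = 0")
      case True
      then obtain i where i: "i \<in> I" "u I i \<bullet> x = 0" by blast
      then have set: "{i. i \<in> I \<and> u I i \<bullet> x = 0} = {i}"
        using x(2) I by (auto simp: codim1_def)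
      then have "u I k \<bullet> x \<noteq> 0" if "k \<in> I - {i}" for k using that by auto
      then have "(\<Prod>k\<in>I - {i}. a k + sgn (u I k \<bullet> (x + t *\<^sub>R z))) = h (I - {i}) (y I x)"
        unfolding h_def using elim formsI[OF I] by (intro prod.cong) (auto simp: y_def)
      moreover have "(\<Prod>k\<in>I - {i}. a k + sgn (u I k \<bullet> x)) = h (I - {i}) (y I x)"
        unfolding h_def by (intro prod.cong) (auto simp: y_def)
      ultimately show ?thesis
        unfolding set using elim formsI[OF I i(1)] i(2)
        by (simp add: prod.remove[OF finite_facet[OF I] i(1)] s_def algebra_simps sgn_mult)
    next
      case False
      then have "{i. i \<in> I \<and> u I i \<bullet> x = 0} = {}" by blast
      moreover have "(\<Prod>i\<in>I. a i + sgn (u I i \<bullet> (x + t *\<^sub>R z))) = (\<Prod>i\<in>I. a i + sgn (u I i \<bullet> x))"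
        using False elim formsI[OF I] by (intro prod.cong) auto
      ultimately show ?thesis by (simp only: sum.empty mult_zero_right add_0_right)
    qed
    then have "sign_sum a (x + t *\<^sub>R z) = sign_sum a x +
        sgn t * (\<Sum>I\<in>Fac. \<Sum>i | i \<in> I \<and> u I i \<bullet> x = 0. s I i * h (I - {i}) (y I x))"
      by (simp add: sign_sum_def sum.distrib sum_distrib_left)
    then show ?case using cancel by simp
  qed
qed

text \<open>If two coordinates of one facet vanished at a point of the line through v and v', the
  determinant of their values at v and v' would be 0. By \<open>det\<close> the whole line therefore
  consists of \<open>codim1\<close> points, and a locally constant function on it is
  constant.\<close>

lemma sign_sum_segment:
  assumes v: "gen v" and v': "gen v'"
    and det: "\<And>I i k. I \<in> Fac \<Longrightarrow> i \<in> I \<Longrightarrow> k \<in> I \<Longrightarrow> i \<noteq> k \<Longrightarrow>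
      (u I i \<bullet> v) * (u I k \<bullet> v') \<noteq> (u I k \<bullet> v) * (u I i \<bullet> v')"
  shows "sign_sum a v = sign_sum a v'"
proof -
  define \<gamma> where "\<gamma> t = v + t *\<^sub>R (v' - v)" for t
  have span: "\<gamma> t \<in> span N" "v' - v \<in> span N" for t
    using v v' by (auto simp: gen_def \<gamma>_def span_add span_scale span_diff)
  have "codim1 (\<gamma> t)" for t
    unfolding codim1_def
  proof (intro ballI impI, rule ccontr)
    fix I i k assume I: "I \<in> Fac" "i \<in> I" "k \<in> I" "u I i \<bullet> \<gamma> t = 0" "u I k \<bullet> \<gamma> t = 0" "i \<noteq> k"
    let ?p = "u I i \<bullet> v" and ?q = "u I k \<bullet> v" and ?p' = "u I i \<bullet> v'" and ?q' = "u I k \<bullet> v'"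
    have e: "(1 - t) * ?p + t * ?p' = 0" "(1 - t) * ?q + t * ?q' = 0"
      using I(4,5) by (auto simp: \<gamma>_def inner_add_right inner_diff_right algebra_simps)
    \<comment> \<open>Cramer's rule: both 1 - t and t annihilate the determinant, and they are not
      both 0.\<close>
    have "(1 - t) * (?p * ?q' - ?q * ?p') = ((1 - t) * ?p + t * ?p') * ?q' - ((1 - t) * ?q + t * ?q') * ?p'"
      by (simp add: algebra_simps)
    moreover have "t * (?p * ?q' - ?q * ?p') = ((1 - t) * ?q + t * ?q') * ?p - ((1 - t) * ?p + t * ?p') * ?q"
      by (simp add: algebra_simps)
    ultimately have "?p * ?q' - ?q * ?p' = 0" unfolding e by (cases "t = 0") auto
    then show False using det[OF I(1-3,6)] by simp
  qed
  then have loc: "\<forall>\<^sub>F s in nhds 0. sign_sum a (\<gamma> t + s *\<^sub>R (v' - v)) = sign_sum a (\<gamma> t)" for t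
    using sign_sum_local_const span by blast
  have "\<forall>\<^sub>F s in at t. sign_sum a (\<gamma> t) = sign_sum a (\<gamma> s)" for t
  proof -
    have "filterlim (\<lambda>s. s - t) (nhds 0) (at t)"
      by (rule tendsto_eq_intros | simp)+
    from eventually_compose_filterlim[OF loc[of t] this] show ?thesis
      by eventually_elim (simp add: \<gamma>_def algebra_simps)
  qed
  then have "sign_sum a (\<gamma> 0) = sign_sum a (\<gamma> 1)"
    using connected_local_const[of "UNIV :: real set" 0 1 "\<lambda>t. sign_sum a (\<gamma> t)"] by simp
  then show ?thesis by (simp add: \<gamma>_def)
qed

text \<open>The point v' is perturbed, without changing the sign of any form, until the determinants
  of \<open>sign_sum_segment\<close> are nonzero. Each is a linear form in the second point,
  nontrivial because its value at \<open>r k\<close> is u_i . v.\<close>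

theorem sign_sum_indep:
  assumes v: "gen v" and v': "gen v'"
  shows "sign_sum a v = sign_sum a v'"
proof -
  have "\<forall>\<^sub>F x in nhds v'. sgn (b \<bullet> x) = sgn (b \<bullet> v')" if "b \<in> forms" for b
  proof -
    have lim: "((\<lambda>x. b \<bullet> x) \<longlongrightarrow> b \<bullet> v') (nhds v')" by (intro tendsto_intros filterlim_ident)
    have "b \<bullet> v' \<noteq> 0" using v' that by (simp add: gen_def)
    then consider "b \<bullet> v' > 0" | "b \<bullet> v' < 0" by linarith
    then show ?thesis
    proof cases
      case 1
      from order_tendstoD(1)[OF lim this] show ?thesis by eventually_elim (use 1 in simp)
    next
      case 2
      from order_tendstoD(2)[OF lim this] show ?thesis by eventually_elim (use 2 in simp)
    qed
  qed
  then have "\<forall>\<^sub>F x in nhds v'. \<forall>b\<in>forms. sgn (b \<bullet> x) = sgn (b \<bullet> v')"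
    using finite_forms by (simp add: eventually_ball_finite)
  then obtain e where e: "e > 0" "\<And>x b. dist x v' < e \<Longrightarrow> b \<in> forms \<Longrightarrow> sgn (b \<bullet> x) = sgn (b \<bullet> v')"
    unfolding eventually_nhds_metric by blast
  define A where "A = (\<Union>I\<in>Fac. (\<lambda>(i, k). (u I i \<bullet> v) *\<^sub>R u I k - (u I k \<bullet> v) *\<^sub>R u I i) ` (I \<times> I - Id))"
  have "\<exists>y\<in>span N. b \<bullet> y \<noteq> 0" if "b \<in> A" for b
  proof -
    obtain I i k where b: "I \<in> Fac" "i \<in> I" "k \<in> I" "i \<noteq> k"
      "b = (u I i \<bullet> v) *\<^sub>R u I k - (u I k \<bullet> v) *\<^sub>R u I i"
      using \<open>b \<in> A\<close> unfolding A_def by auto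
    have "b \<bullet> r k = u I i \<bullet> v" using b by (simp add: inner_diff_left dual)
    then show ?thesis using genD(1)[OF v b(1,2)] ray_mem[OF b(1,3)] span_base by metis
  qed
  moreover have "finite A" unfolding A_def using finite_Fac finite_facet by auto
  moreover have "v' \<in> span N" using v' by (simp add: gen_def)
  ultimately obtain x where x: "x \<in> span N" "dist x v' < e" "\<forall>b\<in>A. b \<bullet> x \<noteq> 0"
    using perturb_generic[of "span N" A v' e] e(1) by auto
  have sg: "sgn (b \<bullet> x) = sgn (b \<bullet> v')" if "b \<in> forms" for b using e(2) x(2) that by blast
  then have "gen x" using x(1) v' unfolding gen_def by (metis sgn_zero_iff)
  then have "sign_sum a v = sign_sum a x"
  proof (rule sign_sum_segment[OF v])
    fix I i k assume I: "I \<in> Fac" "i \<in> I" "k \<in> I" "i \<noteq> k"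
    then have "(u I i \<bullet> v) *\<^sub>R u I k - (u I k \<bullet> v) *\<^sub>R u I i \<in> A"
      unfolding A_def by (auto intro!: bexI[of _ I] image_eqI[of _ _ "(i, k)"])
    then show "(u I i \<bullet> v) * (u I k \<bullet> x) \<noteq> (u I k \<bullet> v) * (u I i \<bullet> x)"
      using x(3) by (force simp: inner_diff_left)
  qed
  also have "\<dots> = sign_sum a v'"
    unfolding sign_sum_def using sg formsI by (intro sum.cong arg_cong2[of _ _ _ _ "(*)"] prod.cong) auto
  finally show ?thesis .
qed

text \<open>
  For a point \<open>q\<close> far from all vertices \<open>p I\<close> the test vector can be chosen near \<open>- q\<close>, where every
  summand vanishes.
\<close>

lemma sign_sum_far:
  assumes v: "gen v" and q: "q \<in> span N"
    and p: "\<And>I i. I \<in> Fac \<Longrightarrow> i \<in> I \<Longrightarrow> p I \<bullet> r i = c i"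
    and off: "\<And>I i. I \<in> Fac \<Longrightarrow> i \<in> I \<Longrightarrow> q \<bullet> r i \<noteq> c i"
    and far: "\<And>I. I \<in> Fac \<Longrightarrow> norm (p I) < norm q"
  shows "sign_sum (\<lambda>i. sgn (q \<bullet> r i - c i)) v = 0"
proof -
  have "\<forall>\<^sub>F x in nhds (- q). x \<bullet> (q - p I) < 0" if I: "I \<in> Fac" for I
  proof (rule order_tendstoD(2))
    show "((\<lambda>x. x \<bullet> (q - p I)) \<longlongrightarrow> (- q) \<bullet> (q - p I)) (nhds (- q))" by (intro tendsto_intros filterlim_ident)
    have "q \<bullet> p I \<le> norm q * norm (p I)" by (rule norm_cauchy_schwarz)
    also have "\<dots> < norm q * norm q"
      using far[OF I] norm_ge_zero[of "p I"] by (intro mult_strict_left_mono) linarith+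
    finally show "(- q) \<bullet> (q - p I) < 0"
      by (simp add: inner_diff_right power2_norm_eq_inner[symmetric] power2_eq_square)
  qed
  then have "\<forall>\<^sub>F x in nhds (- q). \<forall>I\<in>Fac. x \<bullet> (q - p I) < 0"
    using finite_Fac by (simp add: eventually_ball_finite)
  then obtain e where e: "e > 0" "\<And>x I. dist x (- q) < e \<Longrightarrow> I \<in> Fac \<Longrightarrow> x \<bullet> (q - p I) < 0"
    unfolding eventually_nhds_metric by blast
  obtain x where x: "gen x" "dist x (- q) < e" using gen_dense[of "- q" e] q e(1) by (auto simp: span_neg)
  have "(\<Prod>i\<in>I. sgn (q \<bullet> r i - c i) + sgn (u I i \<bullet> x)) = 0" if I: "I \<in> Fac" for I
  proof (rule ccontr)
    assume "(\<Prod>i\<in>I. sgn (q \<bullet> r i - c i) + sgn (u I i \<bullet> x)) \<noteq> 0"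
    then have ne: "sgn (q \<bullet> r i - c i) + sgn (u I i \<bullet> x) \<noteq> 0" if "i \<in> I" for i
      using that finite_facet[OF I] by auto
    \<comment> \<open>Two signs with nonzero sum agree. Summed over I these products give x . (q - p
      I), which was made negative.\<close>
    have "(u I i \<bullet> x) * (q \<bullet> r i - c i) \<ge> 0" if "i \<in> I" for i
      using ne[OF that] off[OF I that] genD(1)[OF x(1) I that]
      by (auto simp: sgn_real_def zero_le_mult_iff split: if_splits)
    then have "0 \<le> (\<Sum>i\<in>I. (u I i \<bullet> x) * (q \<bullet> r i - c i))" by (rule sum_nonneg)
    also have "\<dots> = (\<Sum>i\<in>I. (u I i \<bullet> x) *\<^sub>R r i) \<bullet> (q - p I)"
      unfolding inner_sum_left using p[OF I]
      by (intro sum.cong) (auto simp: inner_diff_right inner_commute)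
    also have "\<dots> = x \<bullet> (q - p I)" using expand[OF I genD(2)[OF x(1)]] by simp
    finally show False using e(2)[OF x(2) I] by simp
  qed
  then have "sign_sum (\<lambda>i. sgn (q \<bullet> r i - c i)) x = 0" by (simp add: sign_sum_def)
  then show ?thesis using sign_sum_indep[OF v x(1)] by simp
qed

end

lemma finite_sum_has_sum:
  fixes f :: "'i \<Rightarrow> 'a \<Rightarrow> 'b::topological_comm_monoid_add"
  shows "(\<And>i. i \<in> I \<Longrightarrow> (f i has_sum s i) A) \<Longrightarrow> ((\<lambda>x. \<Sum>i\<in>I. f i x) has_sum (\<Sum>i\<in>I. s i)) A"
  by (induction I rule: infinite_finite_induct) (auto intro: has_sum_add has_sum_0)

section \<open>Generating functions of cones\<close>

text \<open>Summability is read off from the value: a family that is not summable has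
  \<open>infsum\<close> 0, whereas the product of the norm sums is nonzero by
  \<open>nz\<close>.\<close>

lemma has_sum_prod_PiE:
  fixes f :: "'i \<Rightarrow> 'b \<Rightarrow> complex"
  assumes A: "finite A"
    and summ: "\<And>x. x \<in> A \<Longrightarrow> (\<lambda>k. norm (f x k)) summable_on B x"
    and nz: "\<And>x. x \<in> A \<Longrightarrow> \<exists>k\<in>B x. f x k \<noteq> 0"
  shows "((\<lambda>g. \<Prod>x\<in>A. f x (g x)) has_sum (\<Prod>x\<in>A. infsum (f x) (B x))) (Pi\<^sub>E A B)"
proof -
  have "infsum (\<lambda>k. norm (f x k)) (B x) \<noteq> 0" if x: "x \<in> A" for x
  proof
    assume "infsum (\<lambda>k. norm (f x k)) (B x) = 0"
    then have "norm (f x k) = 0" if "k \<in> B x" for k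
      using nonneg_infsum_le_0D[OF _ summ[OF x] _ that] by auto
    then show False using nz[OF x] by auto
  qed
  then have ne: "(\<Prod>x\<in>A. infsum (\<lambda>k. norm (f x k)) (B x)) \<noteq> 0" using A by simp
  have eq: "infsum (\<lambda>g. \<Prod>x\<in>A. norm (f x (g x))) (Pi\<^sub>E A B) =
      (\<Prod>x\<in>A. infsum (\<lambda>k. norm (f x k)) (B x))"
    by (rule infsum_prod_PiE_abs[OF A]) (use summ in simp)
  have "infsum (\<lambda>g. \<Prod>x\<in>A. norm (f x (g x))) (Pi\<^sub>E A B) \<noteq> 0" unfolding eq by (rule ne)
  then have "(\<lambda>g. \<Prod>x\<in>A. norm (f x (g x))) summable_on Pi\<^sub>E A B"
    by (rule contrapos_np) (rule infsum_not_exists)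
  then have "(\<lambda>g. \<Prod>x\<in>A. f x (g x)) summable_on Pi\<^sub>E A B"
    by - (rule abs_summable_summable, simp add: prod_norm)
  moreover have "infsum (\<lambda>g. \<Prod>x\<in>A. f x (g x)) (Pi\<^sub>E A B) = (\<Prod>x\<in>A. infsum (f x) (B x))"
    by (rule infsum_prod_PiE_abs[OF A summ])
  ultimately show ?thesis by (metis has_sum_infsum)
qed

lemma geometric_infsum:
  fixes b :: complex
  assumes "norm b < 1"
  shows "(\<lambda>k. norm (a * b ^ k)) summable_on UNIV" "infsum (\<lambda>k. a * b ^ k) UNIV = a / (1 - b)"
proof -
  have s: "summable (\<lambda>k. norm (a * b ^ k))"
    using assms by (simp add: norm_mult norm_power summable_geometric summable_mult)
  then show "(\<lambda>k. norm (a * b ^ k)) summable_on UNIV"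
    by (simp add: summable_on_UNIV_nonneg_real_iff)
  have "(\<lambda>k. a * b ^ k) sums (a * (1 / (1 - b)))"
    using assms by (intro sums_mult geometric_sums)
  then have "((\<lambda>k. a * b ^ k) has_sum (a * (1 / (1 - b)))) UNIV"
    by (rule norm_summable_imp_has_sum[OF s])
  then show "infsum (\<lambda>k. a * b ^ k) UNIV = a / (1 - b)" by (simp add: infsumI)
qed

section \<open>The standard character of R/Z\<close>

definition unit_char :: "real \<Rightarrow> complex" where
  "unit_char x = exp (2 * complex_of_real pi * \<i> * complex_of_real x)"

lemma unit_char_add: "unit_char (x + y) = unit_char x * unit_char y"
  by (simp add: unit_char_def distrib_left exp_add)

lemma unit_char_0 [simp]: "unit_char 0 = 1"
  by (simp add: unit_char_def)

lemma unit_char_eq_1_iff: "unit_char x = 1 \<longleftrightarrow> x \<in> \<int>"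
proof -
  have "2 * (pi * x) = 2 * real_of_int k * pi \<longleftrightarrow> x = real_of_int k" for k
    by (auto simp: field_simps)
  then show ?thesis by (simp add: unit_char_def exp_eq_1 Ints_def image_iff mult.assoc)
qed

lemma unit_char_cong:
  assumes "x - y \<in> \<int>" shows "unit_char x = unit_char y"
proof -
  have "unit_char x = unit_char (x - y) * unit_char y" by (simp flip: unit_char_add)
  then show ?thesis using assms by (simp add: unit_char_eq_1_iff[THEN iffD2])
qed

lemma unit_char_frac: "unit_char (frac x) = unit_char x"
  by (rule unit_char_cong) (simp add: frac_def)

lemma norm_unit_char [simp]: "norm (unit_char x) = 1"
proof -
  have "unit_char x = exp (\<i> * complex_of_real (2 * pi * x))" by (simp add: unit_char_def mult_ac)
  then show ?thesis by (simp only: norm_exp_i_times)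
qed

lemma unit_char_nonzero [simp]: "unit_char x \<noteq> 0"
  by (simp add: unit_char_def)

lemma unit_char_minus: "unit_char (- x) = 1 / unit_char x"
  by (simp add: unit_char_def exp_minus divide_inverse)

lemma unit_char_sum: "unit_char (sum f A) = (\<Prod>x\<in>A. unit_char (f x))"
  by (induction A rule: infinite_finite_induct) (auto simp: unit_char_add)

lemma unit_char_power: "unit_char (real k * x) = unit_char x ^ k"
  by (simp add: unit_char_def mult_ac flip: exp_of_nat_mult)

lemma dual_lattice_diff_iff:
  assumes "p \<in> dual_lattice N"
  shows "q - p \<in> dual_lattice N \<longleftrightarrow> q \<in> dual_lattice N"
proof
  assume "q - p \<in> dual_lattice N"
  then have *: "q - p \<in> span N" "p \<in> span N" "\<And>x. x \<in> N \<Longrightarrow> (q - p) \<bullet> x + p \<bullet> x \<in> \<int>"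
    using assms unfolding dual_lattice_def by (auto intro: Ints_add)
  then have "q \<in> span N" using span_add[OF *(1,2)] by simp
  then show "q \<in> dual_lattice N" using *(3) by (simp add: dual_lattice_def inner_diff_left)
next
  assume "q \<in> dual_lattice N"
  then show "q - p \<in> dual_lattice N"
    using assms by (auto simp: dual_lattice_def inner_diff_left intro: span_diff Ints_diff)
qed

section \<open>Lattice points of the shifted cones and their generating function\<close>

locale lattice_vertices = balanced_fan N r Fac u n w
  for N :: "'a::euclidean_space set" and r Fac u n w +
  fixes c :: "nat \<Rightarrow> real" and p :: "nat set \<Rightarrow> 'a" and v :: 'a
  assumes vertex_mem: "I \<in> Fac \<Longrightarrow> p I \<in> dual_lattice N"
    and vertex_eq: "I \<in> Fac \<Longrightarrow> i \<in> I \<Longrightarrow> p I \<bullet> r i = c i"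
    and gen_v: "gen v"
begin

definition pos :: "nat set \<Rightarrow> nat set" where
  "pos I = {i \<in> I. u I i \<bullet> v > 0}"

text \<open>The flipped cone with offsets c_i + \<epsilon>, 0 < \<epsilon> < 1, as seen by lattice
  points: for integers, being at least c_i + \<epsilon> means being at least c_i + 1, and being at
  most c_i + \<epsilon> means being at most c_i.\<close>

definition in_cone :: "nat set \<Rightarrow> 'a \<Rightarrow> bool" where
  "in_cone I q \<longleftrightarrow> (\<forall>i\<in>I. if i \<in> pos I then c i + 1 \<le> q \<bullet> r i else q \<bullet> r i \<le> c i)"

definition count :: "'a \<Rightarrow> int" where
  "count q = (\<Sum>I\<in>Fac. (- 1) ^ card (pos I) * w I * of_bool (in_cone I q))"

lemma inner_ray_Ints: "I \<in> Fac \<Longrightarrow> i \<in> I \<Longrightarrow> q \<in> dual_lattice N \<Longrightarrow> q \<bullet> r i \<in> \<int>"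
  using ray_mem by (auto simp: dual_lattice_def)

lemma c_Ints: "I \<in> Fac \<Longrightarrow> i \<in> I \<Longrightarrow> c i \<in> \<int>"
  using inner_ray_Ints vertex_mem vertex_eq by metis

lemma pos_iff: "I \<in> Fac \<Longrightarrow> i \<in> I \<Longrightarrow> i \<notin> pos I \<longleftrightarrow> u I i \<bullet> v < 0"
  using genD(1)[OF gen_v, of I i] by (auto simp: pos_def)

lemma prod_pos:
  fixes x :: "'b::comm_ring_1"
  assumes "I \<in> Fac"
  shows "(\<Prod>i\<in>I. if i \<in> pos I then - x else x) = (- 1) ^ card (pos I) * x ^ n"
proof -
  have "(\<Prod>i\<in>I. if i \<in> pos I then - x else x) = (\<Prod>i\<in>I. (if i \<in> pos I then - 1 else 1) * x)"
    by (intro prod.cong) auto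
  also have "\<dots> = (\<Prod>i\<in>I. if i \<in> pos I then - 1 else 1) * x ^ n"
    by (simp add: prod.distrib card_facet[OF assms])
  also have "(\<Prod>i\<in>I. if i \<in> pos I then - 1 else 1 :: 'b) = (\<Prod>i\<in>pos I. - 1)"
    using finite_facet[OF assms] by (intro prod.mono_neutral_cong_right) (auto simp: pos_def)
  finally show ?thesis by simp
qed

text \<open>The half-integer c_i + 1/2 separates c_i from c_i + 1. A factor is 2 for i in
  \<open>pos I\<close> and -2 otherwise when q satisfies the i-th cone condition, and 0 when it does
  not.\<close>

lemma sign_sum_count:
  assumes q: "q \<in> dual_lattice N"
  shows "sign_sum (\<lambda>i. sgn (q \<bullet> r i - (c i + 1 / 2))) v = (- 2) ^ n * of_int (count q)"
proof -
  have "(\<Prod>i\<in>I. sgn (q \<bullet> r i - (c i + 1 / 2)) + sgn (u I i \<bullet> v)) =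
      (- 2) ^ n * (- 1) ^ card (pos I) * of_bool (in_cone I q)" if I: "I \<in> Fac" for I
  proof -
    have fac: "sgn (q \<bullet> r i - (c i + 1 / 2)) + sgn (u I i \<bullet> v) =
        (if if i \<in> pos I then c i + 1 \<le> q \<bullet> r i else q \<bullet> r i \<le> c i then if i \<in> pos I then 2 else - 2 else 0)"
      if i: "i \<in> I" for i
    proof -
      obtain a b where ab: "q \<bullet> r i = of_int a" "c i = of_int b"
        using inner_ray_Ints[OF I i q] c_Ints[OF I i] by (auto elim!: Ints_cases)
      have "a \<le> b \<or> b + 1 \<le> a" by linarith
      then have *: "q \<bullet> r i \<le> c i \<or> c i + 1 \<le> q \<bullet> r i"
        unfolding ab by (metis of_int_1 of_int_add of_int_le_iff)
      have s: "sgn (u I i \<bullet> v) = (if i \<in> pos I then 1 else - 1)"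
        using pos_iff[OF I i] by (auto simp: pos_def)
      show ?thesis using * unfolding s by (auto simp: sgn_real_def)
    qed
    show ?thesis
    proof (cases "in_cone I q")
      case True
      then have "(\<Prod>i\<in>I. sgn (q \<bullet> r i - (c i + 1 / 2)) + sgn (u I i \<bullet> v)) =
          (\<Prod>i\<in>I. if i \<in> pos I then - (- 2) else - 2)"
        using fac by (intro prod.cong) (auto simp: in_cone_def)
      then show ?thesis using True prod_pos[OF I, of "- 2 :: real"] by simp
    next
      case False
      then obtain i where "i \<in> I" "\<not> (if i \<in> pos I then c i + 1 \<le> q \<bullet> r i else q \<bullet> r i \<le> c i)"
        by (auto simp: in_cone_def)
      then have "\<exists>i\<in>I. sgn (q \<bullet> r i - (c i + 1 / 2)) + sgn (u I i \<bullet> v) = 0"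
        using fac by (intro bexI[of _ i]) auto
      then show ?thesis using False finite_facet[OF I] by (simp add: prod_zero_iff)
    qed
  qed
  then show ?thesis by (simp add: sign_sum_def count_def sum_distrib_left mult_ac)
qed

text \<open>The hyperplanes with offsets c_i + 1/2 meet in the points \<open>p' I\<close> and
  contain no lattice point. Beyond the norms of these points \<open>sign_sum_far\<close> applies,
  and a ball contains finitely many points of the dual lattice.\<close>

lemma finite_support: "finite {q \<in> dual_lattice N. count q \<noteq> 0}"
proof -
  define p' where "p' I = p I + (\<Sum>i\<in>I. (1 / 2) *\<^sub>R u I i)" for I
  have p': "p' I \<bullet> r i = c i + 1 / 2" if I: "I \<in> Fac" "i \<in> I" for I i
  proof -
    have "(\<Sum>j\<in>I. ((1 / 2) *\<^sub>R u I j) \<bullet> r i) = (\<Sum>j\<in>I. if j = i then 1 / 2 else 0)"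
      by (intro sum.cong) (auto simp: dual I)
    then show ?thesis
      using I finite_facet vertex_eq by (simp add: p'_def inner_add_left inner_sum_left)
  qed
  define C where "C = (\<Sum>I\<in>Fac. norm (p' I))"
  have "norm q \<le> C" if q: "q \<in> dual_lattice N" "count q \<noteq> 0" for q
  proof (rule ccontr)
    assume C: "\<not> norm q \<le> C"
    have "sign_sum (\<lambda>i. sgn (q \<bullet> r i - (c i + 1 / 2))) v = 0"
    proof (rule sign_sum_far[OF gen_v])
      show "q \<in> span N" using q by (simp add: dual_lattice_def)
      show "norm (p' I) < norm q" if "I \<in> Fac" for I
        using C member_le_sum[OF that, of "\<lambda>I. norm (p' I)"] finite_Fac by (simp add: C_def)
      show "q \<bullet> r i \<noteq> c i + 1 / 2" if I: "I \<in> Fac" "i \<in> I" for I i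
      proof
        assume eq: "q \<bullet> r i = c i + 1 / 2"
        obtain a b where "q \<bullet> r i = of_int a" "c i = of_int b"
          using inner_ray_Ints[OF I q(1)] c_Ints[OF I] by (auto elim!: Ints_cases)
        with eq have "2 * real_of_int a = 2 * real_of_int b + 1" by simp
        then have "2 * a = 2 * b + 1" by linarith
        then show False by presburger
      qed
    qed (use p' in auto)
    then show False using sign_sum_count[OF q(1)] q(2) by simp
  qed
  then have "{q \<in> dual_lattice N. count q \<noteq> 0} \<subseteq> {q \<in> dual_lattice N. norm q \<le> C}" by auto
  then show ?thesis using finite_dual_lattice_ball[OF lattice] by (rule finite_subset)
qed

text \<open>Orthogonality on the finite group N / N_I: x induces the character exp (2 pi i x . t),
  which is trivial exactly when x lies in the dual lattice. Otherwise translation by some b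
  multiplies the sum by a number other than 1.\<close>

lemma sum_characters:
  assumes I: "I \<in> Fac" and x: "x \<in> span N" "\<And>i. i \<in> I \<Longrightarrow> x \<bullet> r i \<in> \<int>"
  shows "(\<Sum>a\<in>par I. unit_char (\<Sum>i\<in>I. a i * (x \<bullet> r i))) = of_nat (card (par I)) * of_bool (x \<in> dual_lattice N)"
proof -
  have e: "(\<Sum>i\<in>I. a i * (x \<bullet> r i)) = x \<bullet> (\<Sum>i\<in>I. a i *\<^sub>R r i)" for a
    by (simp add: inner_sum_right)
  show ?thesis
  proof (cases "x \<in> dual_lattice N")
    case True
    then have "unit_char (\<Sum>i\<in>I. a i * (x \<bullet> r i)) = 1" if "a \<in> par I" for a
      using that by (auto simp: e unit_char_eq_1_iff dual_lattice_def par_def)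
    then show ?thesis using True by simp
  next
    case False
    then obtain t where t: "t \<in> N" "x \<bullet> t \<notin> \<int>" using x(1) by (auto simp: dual_lattice_def)
    define b where "b i = (if i \<in> I then frac (u I i \<bullet> t) else 0)" for i
    have b: "b \<in> par I"
      unfolding b_def using expand[OF I span_base[OF t(1)]] t(1) by (intro par_reduce[OF I]) simp
    have frac_char: "unit_char (\<Sum>i\<in>I. frac (f i) * (x \<bullet> r i)) = unit_char (\<Sum>i\<in>I. f i * (x \<bullet> r i))" for f
    proof (rule unit_char_cong)
      have "(\<Sum>i\<in>I. frac (f i) * (x \<bullet> r i)) - (\<Sum>i\<in>I. f i * (x \<bullet> r i)) =
          (\<Sum>i\<in>I. - of_int \<lfloor>f i\<rfloor> * (x \<bullet> r i))"
        by (simp add: frac_def algebra_simps sum_subtractf sum_negf)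
      also have "\<dots> \<in> \<int>" using x(2) by (intro Ints_sum Ints_mult) auto
      finally show "(\<Sum>i\<in>I. frac (f i) * (x \<bullet> r i)) - (\<Sum>i\<in>I. f i * (x \<bullet> r i)) \<in> \<int>" .
    qed
    have "unit_char (\<Sum>i\<in>I. b i * (x \<bullet> r i)) = unit_char (\<Sum>i\<in>I. (u I i \<bullet> t) * (x \<bullet> r i))"
      using frac_char[of "\<lambda>i. u I i \<bullet> t"] by (simp add: b_def cong: sum.cong)
    also have "\<dots> = unit_char (x \<bullet> t)" using e expand[OF I span_base[OF t(1)]] by metis
    finally have ne: "unit_char (\<Sum>i\<in>I. b i * (x \<bullet> r i)) \<noteq> 1" using t(2) by (simp add: unit_char_eq_1_iff)
    define S where "S = (\<Sum>a\<in>par I. unit_char (\<Sum>i\<in>I. a i * (x \<bullet> r i)))"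
    have "S = (\<Sum>a\<in>par I. unit_char (\<Sum>i\<in>I. (if i \<in> I then frac (a i + b i) else 0) * (x \<bullet> r i)))"
      unfolding S_def by (rule sum.reindex_bij_betw[OF card_par_translate[OF I b], symmetric])
    also have "\<dots> = (\<Sum>a\<in>par I. unit_char (\<Sum>i\<in>I. (a i + b i) * (x \<bullet> r i)))"
      using frac_char by (simp cong: sum.cong)
    also have "\<dots> = S * unit_char (\<Sum>i\<in>I. b i * (x \<bullet> r i))"
      by (simp add: S_def distrib_right sum.distrib unit_char_add sum_distrib_right)
    finally have "S = 0" using ne by auto
    then show ?thesis using False by (simp add: S_def)
  qed
qed

text \<open>
  The lattice points of the shifted cone at \<open>I\<close> have coordinates \<open>c i + step I i k\<close>, \<open>k \<ge> 0\<close>.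
\<close>

definition step :: "nat set \<Rightarrow> nat \<Rightarrow> nat \<Rightarrow> int" where
  "step I i k = (if i \<in> pos I then int k + 1 else - int k)"

text \<open>These points range over the part of the shifted cone in the lattice dual to N_I. That
  lattice contains \<open>dual_lattice N\<close>, possibly properly, so membership in the latter is
  a separate condition.\<close>

definition lat_pt :: "nat set \<Rightarrow> (nat \<Rightarrow> nat) \<Rightarrow> 'a" where
  "lat_pt I m = p I + (\<Sum>i\<in>I. of_int (step I i (m i)) *\<^sub>R u I i)"

lemma lat_pt_inner: "I \<in> Fac \<Longrightarrow> i \<in> I \<Longrightarrow> lat_pt I m \<bullet> r i = c i + of_int (step I i (m i))"
proof -
  assume I: "I \<in> Fac" "i \<in> I"
  have "(\<Sum>j\<in>I. (of_int (step I j (m j)) *\<^sub>R u I j) \<bullet> r i) =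
      (\<Sum>j\<in>I. if j = i then of_int (step I i (m i)) else 0)"
    by (intro sum.cong) (auto simp: dual I)
  then show ?thesis
    using I finite_facet vertex_eq by (simp add: lat_pt_def inner_add_left inner_sum_left)
qed

lemma lat_pt_span: "I \<in> Fac \<Longrightarrow> lat_pt I m \<in> span N"
  using vertex_mem[of I] dual_mem
  by (auto simp: lat_pt_def dual_lattice_def intro!: span_add span_sum span_scale)

lemma lat_pt_bij:
  assumes I: "I \<in> Fac"
  shows "bij_betw (lat_pt I) {m \<in> (\<Pi>\<^sub>E i\<in>I. UNIV). lat_pt I m \<in> dual_lattice N}
    {q \<in> dual_lattice N. in_cone I q}"
proof -
  have "inj_on (lat_pt I) (\<Pi>\<^sub>E i\<in>I. UNIV)"
  proof (rule inj_onI)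
    fix m l assume ml: "m \<in> (\<Pi>\<^sub>E i\<in>I. UNIV)" "l \<in> (\<Pi>\<^sub>E i\<in>I. UNIV)" "lat_pt I m = lat_pt I l"
    have "m i = l i" if "i \<in> I" for i
      using lat_pt_inner[OF I that, of m] lat_pt_inner[OF I that, of l] ml(3)
      by (auto simp: step_def split: if_splits)
    then show "m = l" using ml(1,2) by (intro PiE_ext) auto
  qed
  moreover have "\<exists>m\<in>(\<Pi>\<^sub>E i\<in>I. UNIV). lat_pt I m = q" if q: "q \<in> dual_lattice N" "in_cone I q" for q
  proof -
    have "\<exists>k. q \<bullet> r i = c i + of_int (step I i k)" if i: "i \<in> I" for i
    proof -
      obtain a b where ab: "q \<bullet> r i = of_int a" "c i = of_int b"
        using inner_ray_Ints[OF I i q(1)] c_Ints[OF I i] by (auto elim!: Ints_cases)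
      show ?thesis
      proof (cases "i \<in> pos I")
        case True
        then have "of_int b + 1 \<le> (of_int a :: real)" using q(2) i ab by (auto simp: in_cone_def)
        then have "b + 1 \<le> a" by linarith
        then show ?thesis using True ab by (intro exI[of _ "nat (a - b - 1)"]) (simp add: step_def)
      next
        case False
        then have "a \<le> b" using q(2) i ab by (auto simp: in_cone_def)
        then show ?thesis using False ab by (intro exI[of _ "nat (b - a)"]) (simp add: step_def)
      qed
    qed
    then obtain k where k: "\<And>i. i \<in> I \<Longrightarrow> q \<bullet> r i = c i + of_int (step I i (k i))" by metis
    have "lat_pt I (restrict k I) = q"
      by (rule span_inner_eqI[OF I lat_pt_span[OF I]])
        (use q k lat_pt_inner[OF I] in \<open>auto simp: dual_lattice_def\<close>)
    then show ?thesis by (intro bexI[of _ "restrict k I"]) auto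
  qed
  moreover have "in_cone I (lat_pt I m)" for m
    using lat_pt_inner[OF I] by (auto simp: in_cone_def step_def)
  ultimately show ?thesis
    by (auto simp: bij_betw_def image_iff intro: inj_on_subset)
qed

text \<open>Over all points \<open>lat_pt I m\<close> the sum factors into geometric series, one per
  coordinate. Averaging the sums twisted by the elements of \<open>par I\<close> keeps exactly the
  points of the dual lattice.\<close>

lemma cone_series:
  assumes I: "I \<in> Fac" and t: "t > 0"
  shows "((\<lambda>q. (- 1) ^ card (pos I) * exp (- complex_of_real (t * (q \<bullet> v)))) has_sum
    exp (- complex_of_real (t * (p I \<bullet> v))) / of_nat (card (par I)) *
      (\<Sum>a\<in>par I. \<Prod>i\<in>I. 1 / (1 - unit_char (a i) * exp (complex_of_real (t * (u I i \<bullet> v))))))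
    {q \<in> dual_lattice N. in_cone I q}"
proof -
  define \<zeta> where "\<zeta> a i = unit_char (a i) * exp (- complex_of_real (t * (u I i \<bullet> v)))" for a :: "nat \<Rightarrow> real" and i
  \<comment> \<open>Whichever of \<zeta> and 1 / \<zeta> lies inside the unit disc for t > 0. The
    extra factor in \<open>f\<close> starts the series at exponent 1 for i in \<open>pos I\<close>,
    in accordance with \<open>step\<close>.\<close>
  define b where "b a i = (if i \<in> pos I then \<zeta> a i else 1 / \<zeta> a i)" for a i
  define f where "f a i k = (if i \<in> pos I then b a i else 1) * b a i ^ k" for a i and k :: nat
  have \<zeta>0: "\<zeta> a i \<noteq> 0" for a i by (simp add: \<zeta>_def)
  have nb: "norm (b a i) < 1" if "i \<in> I" for a i
    using pos_iff[OF I that] t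
    by (auto simp: b_def \<zeta>_def norm_mult norm_divide pos_def mult_pos_neg zero_less_mult_iff)
  have fsum: "infsum (f a i) UNIV = (if i \<in> pos I then - 1 else 1) / (1 - 1 / \<zeta> a i)" if "i \<in> I" for a i
  proof -
    have "infsum (f a i) UNIV = (if i \<in> pos I then b a i else 1) / (1 - b a i)"
      unfolding f_def by (rule geometric_infsum(2)[OF nb[OF that]])
    moreover have "1 - \<zeta> a i \<noteq> 0" if "i \<in> pos I" using nb[OF \<open>i \<in> I\<close>, of a] that by (auto simp: b_def)
    moreover have "\<zeta> a i - 1 \<noteq> 0" if "i \<in> pos I" using nb[OF \<open>i \<in> I\<close>, of a] that by (auto simp: b_def)
    ultimately show ?thesis using \<zeta>0[of a i] by (auto simp: b_def divide_simps) (simp add: algebra_simps)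
  qed
  have hs: "((\<lambda>m. \<Prod>i\<in>I. f a i (m i)) has_sum
      ((- 1) ^ card (pos I) * (\<Prod>i\<in>I. 1 / (1 - 1 / \<zeta> a i)))) (\<Pi>\<^sub>E i\<in>I. UNIV)" for a
  proof -
    have "((\<lambda>m. \<Prod>i\<in>I. f a i (m i)) has_sum (\<Prod>i\<in>I. infsum (f a i) UNIV)) (\<Pi>\<^sub>E i\<in>I. UNIV)"
    proof (rule has_sum_prod_PiE[OF finite_facet[OF I]])
      fix i assume "i \<in> I"
      then show "(\<lambda>k. norm (f a i k)) summable_on UNIV" unfolding f_def by (intro geometric_infsum(1) nb)
      show "\<exists>k\<in>UNIV. f a i k \<noteq> 0" using \<zeta>0[of a i] by (auto simp: f_def b_def intro!: exI[of _ 0])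
    qed
    also have "(\<Prod>i\<in>I. infsum (f a i) UNIV) =
        (\<Prod>i\<in>I. (if i \<in> pos I then - 1 else 1) * (1 / (1 - 1 / \<zeta> a i)))"
      by (intro prod.cong) (simp_all add: fsum)
    also have "\<dots> = (- 1) ^ card (pos I) * (\<Prod>i\<in>I. 1 / (1 - 1 / \<zeta> a i))"
      unfolding prod.distrib using prod_pos[OF I, of "1::complex"] by simp
    finally show ?thesis .
  qed
  have f_eq: "f a i k = unit_char (a i * of_int (step I i k)) *
      exp (- complex_of_real (t * (of_int (step I i k) * (u I i \<bullet> v))))" for a i k
  proof -
    have u1: "unit_char (a i * (real k + 1)) = unit_char (a i) ^ (k + 1)"
      using unit_char_power[of "k + 1" "a i"] by (simp add: mult.commute add.commute)
    have u2: "unit_char (- (a i * real k)) = (1 / unit_char (a i)) ^ k"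
      using unit_char_power[of k "a i"] by (simp add: mult.commute unit_char_minus power_one_over)
    have e1: "exp (- complex_of_real (t * ((real k + 1) * s))) = exp (- complex_of_real (t * s)) ^ (k + 1)" for s
      unfolding exp_of_nat_mult[symmetric] by (simp add: algebra_simps)
    have e2: "exp (complex_of_real (t * (real k * s))) = (1 / exp (- complex_of_real (t * s))) ^ k" for s
      by (simp add: exp_minus field_simps flip: exp_of_nat_mult)
    show ?thesis
    proof (cases "i \<in> pos I")
      case True
      have "f a i k = \<zeta> a i ^ (k + 1)" using True by (simp add: f_def b_def)
      also have "\<dots> = unit_char (a i * (real k + 1)) * exp (- complex_of_real (t * ((real k + 1) * (u I i \<bullet> v))))"
        unfolding u1 e1 \<zeta>_def power_mult_distrib ..
      finally show ?thesis using True by (simp add: step_def)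
    next
      case False
      have "f a i k = (1 / \<zeta> a i) ^ k" using False by (simp add: f_def b_def)
      also have "\<dots> = unit_char (- (a i * real k)) * exp (complex_of_real (t * (real k * (u I i \<bullet> v))))"
        unfolding u2 e2 \<zeta>_def power_mult_distrib[symmetric] by simp
      finally show ?thesis using False by (simp add: step_def)
    qed
  qed
  define g where "g q = (- 1) ^ card (pos I) * exp (- complex_of_real (t * (q \<bullet> v)))" for q
  define \<kappa> where "\<kappa> = (- 1) ^ card (pos I) * exp (- complex_of_real (t * (p I \<bullet> v))) / of_nat (card (par I))"
  have cp: "of_nat (card (par I)) \<noteq> (0 :: complex)" using par_pos[OF I] by simp
  have pointwise: "\<kappa> * (\<Sum>a\<in>par I. \<Prod>i\<in>I. f a i (m i)) = of_bool (lat_pt I m \<in> dual_lattice N) * g (lat_pt I m)" for m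
  proof -
    let ?x = "lat_pt I m - p I"
    have x: "?x \<bullet> r i = of_int (step I i (m i))" if "i \<in> I" for i
      using lat_pt_inner[OF I that] vertex_eq[OF I that] by (simp add: inner_diff_left)
    have x_span: "?x \<in> span N"
      using lat_pt_span[OF I] vertex_mem[OF I] by (auto simp: dual_lattice_def intro: span_diff)
    have xv: "?x \<bullet> v = (\<Sum>i\<in>I. of_int (step I i (m i)) * (u I i \<bullet> v))"
      by (simp add: lat_pt_def inner_sum_left)
    have "(\<Sum>a\<in>par I. \<Prod>i\<in>I. f a i (m i)) =
        (\<Sum>a\<in>par I. unit_char (\<Sum>i\<in>I. a i * (?x \<bullet> r i))) * exp (- complex_of_real (t * (?x \<bullet> v)))"
      unfolding xv by (simp add: f_eq prod.distrib unit_char_sum sum_distrib_left sum_distrib_right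
          exp_sum[OF finite_facet[OF I]] x flip: sum_negf)
    also have "(\<Sum>a\<in>par I. unit_char (\<Sum>i\<in>I. a i * (?x \<bullet> r i))) =
        of_nat (card (par I)) * of_bool (lat_pt I m \<in> dual_lattice N)"
      using sum_characters[OF I x_span] x by (simp add: dual_lattice_diff_iff[OF vertex_mem[OF I]])
    finally show ?thesis
      using cp by (simp add: \<kappa>_def g_def inner_diff_left right_diff_distrib exp_diff exp_minus field_simps
          flip: exp_add)
  qed
  have "((\<lambda>m. \<kappa> * (\<Sum>a\<in>par I. \<Prod>i\<in>I. f a i (m i))) has_sum
      \<kappa> * (\<Sum>a\<in>par I. (- 1) ^ card (pos I) * (\<Prod>i\<in>I. 1 / (1 - 1 / \<zeta> a i)))) (\<Pi>\<^sub>E i\<in>I. UNIV)"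
    by (intro has_sum_cmult_right finite_sum_has_sum hs)
  then have "((\<lambda>m. g (lat_pt I m)) has_sum
      \<kappa> * (\<Sum>a\<in>par I. (- 1) ^ card (pos I) * (\<Prod>i\<in>I. 1 / (1 - 1 / \<zeta> a i))))
      {m \<in> (\<Pi>\<^sub>E i\<in>I. UNIV). lat_pt I m \<in> dual_lattice N}"
    unfolding pointwise by (rule has_sum_cong_neutral[THEN iffD1, rotated -1]) auto
  then have "(g has_sum \<kappa> * (\<Sum>a\<in>par I. (- 1) ^ card (pos I) * (\<Prod>i\<in>I. 1 / (1 - 1 / \<zeta> a i))))
      {q \<in> dual_lattice N. in_cone I q}"
    by (simp add: has_sum_reindex_bij_betw[OF lat_pt_bij[OF I]])
  also have "\<kappa> * (\<Sum>a\<in>par I. (- 1) ^ card (pos I) * (\<Prod>i\<in>I. 1 / (1 - 1 / \<zeta> a i))) =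
      exp (- complex_of_real (t * (p I \<bullet> v))) / of_nat (card (par I)) *
      (\<Sum>a\<in>par I. \<Prod>i\<in>I. 1 / (1 - unit_char (- a i) * exp (complex_of_real (t * (u I i \<bullet> v)))))"
    by (simp add: \<kappa>_def \<zeta>_def unit_char_minus exp_minus field_simps flip: sum_distrib_left power_add)
  \<comment> \<open>The terms 1 / \<zeta> carry inverse characters; inversion in G_I, which is a ->
    frac (- a) on representatives, reindexes the sum.\<close>
  also have "(\<Sum>a\<in>par I. \<Prod>i\<in>I. 1 / (1 - unit_char (- a i) * exp (complex_of_real (t * (u I i \<bullet> v))))) =
      (\<Sum>a\<in>par I. \<Prod>i\<in>I. 1 / (1 - unit_char (a i) * exp (complex_of_real (t * (u I i \<bullet> v)))))"
  proof (rule sum.reindex_bij_witness[where i = "\<lambda>a i. if i \<in> I then frac (- a i) else 0"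
        and j = "\<lambda>a i. if i \<in> I then frac (- a i) else 0"])
    fix a assume a: "a \<in> par I"
    have inv: "frac (- frac (- s)) = s" if "0 \<le> s" "s < 1" for s :: real
      using that by (simp add: frac_neg_frac frac_eq)
    show "(\<lambda>i. if i \<in> I then frac (- (if i \<in> I then frac (- a i) else 0)) else 0) = a"
      using a by (auto simp: par_def inv)
    then show "(\<lambda>i. if i \<in> I then frac (- (if i \<in> I then frac (- a i) else 0)) else 0) = a" .
    have "- (\<Sum>i\<in>I. a i *\<^sub>R r i) \<in> N"
      using lattice_closed(3)[OF lattice lattice_closed(1)[OF lattice]] a by (simp add: par_def)
    then show "(\<lambda>i. if i \<in> I then frac (- a i) else 0) \<in> par I"
      by (intro par_reduce[OF I]) (simp add: sum_negf)
    then show "(\<lambda>i. if i \<in> I then frac (- a i) else 0) \<in> par I" .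
    show "(\<Prod>i\<in>I. 1 / (1 - unit_char (if i \<in> I then frac (- a i) else 0) * exp (complex_of_real (t * (u I i \<bullet> v))))) =
        (\<Prod>i\<in>I. 1 / (1 - unit_char (- a i) * exp (complex_of_real (t * (u I i \<bullet> v)))))"
      by (intro prod.cong) (simp_all add: unit_char_frac)
  qed
  finally show ?thesis by (simp add: g_def)
qed

text \<open>For one and the same t > 0 all facet series converge, as every flipped generator pairs
  positively with v. Their weighted sum is a series over the dual lattice with only finitely many
  nonzero terms by \<open>finite_support\<close>.\<close>

theorem generating_function:
  assumes t: "t > 0"
  shows "(\<Sum>q | q \<in> dual_lattice N \<and> count q \<noteq> 0. of_int (count q) * exp (- complex_of_real (t * (q \<bullet> v)))) =
    (\<Sum>I\<in>Fac. of_int (w I) / of_nat (card (par I)) *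
      (\<Sum>a\<in>par I. exp (- complex_of_real (t * (p I \<bullet> v))) *
        (\<Prod>i\<in>I. 1 / (1 - unit_char (a i) * exp (complex_of_real (t * (u I i \<bullet> v)))))))"
proof -
  let ?h = "\<lambda>q. of_int (count q) * exp (- complex_of_real (t * (q \<bullet> v)))"
  let ?R = "\<lambda>I. exp (- complex_of_real (t * (p I \<bullet> v))) / of_nat (card (par I)) *
      (\<Sum>a\<in>par I. \<Prod>i\<in>I. 1 / (1 - unit_char (a i) * exp (complex_of_real (t * (u I i \<bullet> v)))))"
  have "((\<lambda>q. of_int (w I) * (of_bool (in_cone I q) *
      ((- 1) ^ card (pos I) * exp (- complex_of_real (t * (q \<bullet> v)))))) has_sum of_int (w I) * ?R I) (dual_lattice N)"
    if I: "I \<in> Fac" for I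
  proof (rule has_sum_cmult_right)
    show "((\<lambda>q. of_bool (in_cone I q) * ((- 1) ^ card (pos I) * exp (- complex_of_real (t * (q \<bullet> v)))))
        has_sum ?R I) (dual_lattice N)"
      by (rule has_sum_cong_neutral[THEN iffD1, OF _ _ _ cone_series[OF I t]]) auto
  qed
  then have "((\<lambda>q. \<Sum>I\<in>Fac. of_int (w I) * (of_bool (in_cone I q) *
      ((- 1) ^ card (pos I) * exp (- complex_of_real (t * (q \<bullet> v)))))) has_sum (\<Sum>I\<in>Fac. of_int (w I) * ?R I)) (dual_lattice N)"
    by (intro finite_sum_has_sum)
  moreover have "(\<Sum>I\<in>Fac. of_int (w I) * (of_bool (in_cone I q) *
      ((- 1) ^ card (pos I) * exp (- complex_of_real (t * (q \<bullet> v)))))) = ?h q" for q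
    by (simp add: count_def sum_distrib_right sum_distrib_left mult_ac)
  ultimately have "(?h has_sum (\<Sum>I\<in>Fac. of_int (w I) * ?R I)) (dual_lattice N)" by simp
  moreover have "(?h has_sum (\<Sum>q | q \<in> dual_lattice N \<and> count q \<noteq> 0. ?h q)) (dual_lattice N)"
    by (rule has_sum_finite_neutralI[OF finite_support]) auto
  ultimately have "(\<Sum>q | q \<in> dual_lattice N \<and> count q \<noteq> 0. ?h q) = (\<Sum>I\<in>Fac. of_int (w I) * ?R I)"
    by (rule has_sum_unique[rotated])
  then show ?thesis by (simp add: sum_distrib_left mult_ac)
qed

end

section \<open>The constant term\<close>

lemma todd_denominator_nth: "fps_nth (1 - fps_const \<rho> * fps_exp (- 1)) 0 = 1 - \<rho>"
  "fps_nth (1 - fps_const \<rho> * fps_exp (- 1)) (Suc 0) = (\<rho> :: complex)"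
  by simp_all

lemma subdegree_todd_denominator:
  "subdegree (1 - fps_const \<rho> * fps_exp (- 1)) = (if \<rho> = (1 :: complex) then 1 else 0)"
proof (cases "\<rho> = 1")
  case True
  then show ?thesis using todd_denominator_nth[of 1] by (auto intro!: subdegreeI)
next
  case False
  then show ?thesis using todd_denominator_nth(1)[of \<rho>] by (auto intro!: subdegreeI)
qed

lemma todd_denominator_nonzero: "1 - fps_const \<rho> * fps_exp (- 1) \<noteq> (0 :: complex fps)"
  using todd_denominator_nth[of \<rho>] by (cases "\<rho> = 1") (metis fps_zero_nth right_minus_eq zero_neq_one)+

text \<open>The coefficients of degree 0 and 1 of the product with the denominator are compared with
  those of \<open>fps_X\<close>. The value 0 for \<rho> \<noteq> 1 is what removes group elements
  outside G_I.\<close>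

lemma todd_fps_nth_0: "fps_nth (todd_fps \<rho>) 0 = (if \<rho> = 1 then 1 else 0)"
proof -
  let ?G = "1 - fps_const \<rho> * fps_exp (- 1) :: complex fps"
  have sub: "subdegree ?G \<le> subdegree (fps_X :: complex fps)"
    by (simp add: subdegree_todd_denominator)
  then have "todd_fps \<rho> * ?G = fps_X"
    unfolding todd_fps_def using todd_denominator_nonzero fps_divide_times_eq by (metis (no_types) dvd_div_mult_self fps_dvd_iff fps_X_neq_zero)
  then have "fps_nth (todd_fps \<rho> * ?G) 0 = 0" "fps_nth (todd_fps \<rho> * ?G) 1 = 1" by simp_all
  then have "fps_nth (todd_fps \<rho>) 0 * (1 - \<rho>) = 0"
    "fps_nth (todd_fps \<rho>) 0 * \<rho> + fps_nth (todd_fps \<rho>) 1 * (1 - \<rho>) = 1"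
    by (simp_all only: fps_mult_nth_0 fps_mult_nth_1 todd_denominator_nth(1)
        todd_denominator_nth(2)[folded One_nat_def])
  then show ?thesis by (cases "\<rho> = 1") auto
qed

text \<open>C fills the singularity at 0, which is removable also for \<rho> = 1. Only arguments
  other than 0 are evaluated later.\<close>

lemma todd_fps_expansion:
  "\<exists>C. (\<lambda>z. if z = 0 then C else z / (1 - \<rho> * exp (- z))) has_fps_expansion todd_fps \<rho>"
proof -
  have "(\<lambda>z. if z = 0 then fps_nth fps_X (subdegree (1 - fps_const \<rho> * fps_exp (- 1))) /
      fps_nth (1 - fps_const \<rho> * fps_exp (- 1)) (subdegree (1 - fps_const \<rho> * fps_exp (- 1)))
      else z / (1 - \<rho> * exp (- z))) has_fps_expansion todd_fps \<rho>"
    unfolding todd_fps_def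
  proof (rule has_fps_expansion_divide)
    show "(\<lambda>z. 1 - \<rho> * exp (- z)) has_fps_expansion 1 - fps_const \<rho> * fps_exp (- 1)"
      by (intro has_fps_expansion_diff has_fps_expansion_1 has_fps_expansion_cmult_left
          has_fps_expansion_exp_neg1)
    show "subdegree (1 - fps_const \<rho> * fps_exp (- 1)) \<le> subdegree (fps_X :: complex fps)"
      by (simp add: subdegree_todd_denominator)
  qed (use todd_denominator_nonzero in \<open>auto intro: has_fps_expansion_fps_X\<close>)
  then show ?thesis by blast
qed

text \<open>Identity theorem with test points tending to 0 along the negative real axis, the side on
  which the cone series converge.\<close>

lemma has_fps_expansion_eqI:
  fixes f g :: "complex \<Rightarrow> complex"
  assumes "f has_fps_expansion F" "g has_fps_expansion G"
    and "\<And>t::real. t > 0 \<Longrightarrow> f (- complex_of_real t) = g (- complex_of_real t)"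
  shows "F = G"
proof (rule ccontr)
  assume "F \<noteq> G"
  have "(\<lambda>z. f z - g z) has_laurent_expansion fps_to_fls (F - G)"
    by (intro has_laurent_expansion_fps has_fps_expansion_diff assms)
  then have "\<forall>\<^sub>F z in at 0. f z - g z \<noteq> 0"
    by (rule has_laurent_expansion_nonzero_imp_eventually_nonzero) (use \<open>F \<noteq> G\<close> in simp)
  moreover have "filterlim (\<lambda>t. - complex_of_real t) (at 0) (at_right 0)"
  proof (rule filterlim_atI)
    have "((\<lambda>t. - complex_of_real t) \<longlongrightarrow> - complex_of_real 0) (at_right 0)" by (intro tendsto_intros)
    then show "((\<lambda>t. - complex_of_real t) \<longlongrightarrow> 0) (at_right 0)" by simp
  qed (auto simp: eventually_at_filter)
  ultimately have "\<forall>\<^sub>F t in at_right (0::real). f (- complex_of_real t) - g (- complex_of_real t) \<noteq> 0"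
    by (rule eventually_compose_filterlim)
  moreover have "\<forall>\<^sub>F t in at_right (0::real). t > 0" by (simp add: eventually_at_filter)
  ultimately have "\<forall>\<^sub>F t in at_right (0::real). False"
    by eventually_elim (use assms(3) in simp)
  then show False by (simp add: trivial_limit_at_right_real)
qed

context lattice_vertices
begin

text \<open>Expansion in s of the restriction of e^{c_1} T(\<Delta>) to the facet I, taken at the
  point s v; \<open>RR_series_eval\<close> makes the identification.\<close>

definition RR_fps :: "nat set \<Rightarrow> complex fps" where
  "RR_fps I = fps_exp (complex_of_real (p I \<bullet> v)) *
     (\<Sum>a\<in>par I. \<Prod>i\<in>I. todd_fps (unit_char (a i)) oo (fps_const (complex_of_real (u I i \<bullet> v)) * fps_X))"

text \<open>
  After multiplication by \<open>s\<^sup>n\<close> both sides of the generating function identity have power series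
  expansions at \<open>s = 0\<close>; they agree for \<open>s = - t < 0\<close>, and the coefficients of \<open>s\<^sup>n\<close> are compared.
\<close>

theorem count_constant_term:
  "(\<Sum>I\<in>Fac. of_int (w I) / (of_nat (card (par I)) * (\<Prod>i\<in>I. complex_of_real (u I i \<bullet> v))) *
      fps_nth (RR_fps I) n) = of_int (\<Sum>q | q \<in> dual_lattice N \<and> count q \<noteq> 0. count q)"
proof -
  obtain C where C: "\<And>\<rho>. (\<lambda>z. if z = 0 then C \<rho> else z / (1 - \<rho> * exp (- z))) has_fps_expansion todd_fps \<rho>"
    using todd_fps_expansion by metis
  define H where "H \<rho> z = (if z = 0 then C \<rho> else z / (1 - \<rho> * exp (- z)))" for \<rho> z
  define \<kappa> where "\<kappa> I = of_int (w I) / (of_nat (card (par I)) * (\<Prod>i\<in>I. complex_of_real (u I i \<bullet> v)))" for I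
  define \<Phi> where "\<Phi> s = (\<Sum>I\<in>Fac. \<kappa> I * (exp (complex_of_real (p I \<bullet> v) * s) *
      (\<Sum>a\<in>par I. \<Prod>i\<in>I. H (unit_char (a i)) (complex_of_real (u I i \<bullet> v) * s))))" for s
  define S where "S = {q \<in> dual_lattice N. count q \<noteq> 0}"
  define \<Psi> where "\<Psi> s = s ^ n * (\<Sum>q\<in>S. of_int (count q) * exp (complex_of_real (q \<bullet> v) * s))" for s
  have "(\<lambda>s. H \<rho> (b * s)) has_fps_expansion (todd_fps \<rho> oo (fps_const b * fps_X))" for \<rho> b
    using has_fps_expansion_compose[OF C[of \<rho>, folded H_def] has_fps_expansion_cmult_left[OF has_fps_expansion_fps_X, of b]]
    by (simp add: comp_def)
  then have \<Phi>: "\<Phi> has_fps_expansion (\<Sum>I\<in>Fac. fps_const (\<kappa> I) * RR_fps I)"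
    unfolding \<Phi>_def RR_fps_def
    by (intro has_fps_expansion_sum has_fps_expansion_cmult_left has_fps_expansion_mult
        has_fps_expansion_exp has_fps_expansion_prod)
  have \<Psi>: "\<Psi> has_fps_expansion (fps_X ^ n * (\<Sum>q\<in>S. fps_const (of_int (count q)) * fps_exp (complex_of_real (q \<bullet> v))))"
    unfolding \<Psi>_def
    by (intro has_fps_expansion_sum has_fps_expansion_cmult_left has_fps_expansion_mult
        has_fps_expansion_exp has_fps_expansion_fps_X_power)
  have "(\<Sum>I\<in>Fac. fps_const (\<kappa> I) * RR_fps I) =
      fps_X ^ n * (\<Sum>q\<in>S. fps_const (of_int (count q)) * fps_exp (complex_of_real (q \<bullet> v)))"
  proof (rule has_fps_expansion_eqI[OF \<Phi> \<Psi>])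
    fix t :: real assume t: "t > 0"
    let ?s = "- complex_of_real t"
    let ?e = "\<lambda>I a i. 1 / (1 - unit_char (a i) * exp (complex_of_real (t * (u I i \<bullet> v))))"
    have "\<Phi> ?s = (\<Sum>I\<in>Fac. ?s ^ n * (of_int (w I) / of_nat (card (par I)) *
        (\<Sum>a\<in>par I. exp (- complex_of_real (t * (p I \<bullet> v))) * (\<Prod>i\<in>I. ?e I a i))))"
      unfolding \<Phi>_def
    proof (rule sum.cong)
      fix I assume I: "I \<in> Fac"
      have exp_eq: "exp (complex_of_real (p I \<bullet> v) * ?s) = exp (- complex_of_real (t * (p I \<bullet> v)))"
        by (simp add: mult.commute)
      have nz: "complex_of_real (u I i \<bullet> v) \<noteq> 0" if "i \<in> I" for i
        using genD(1)[OF gen_v I that] by simp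
      have pnz: "(\<Prod>i\<in>I. complex_of_real (u I i \<bullet> v)) \<noteq> 0" using nz finite_facet[OF I] by simp
      \<comment> \<open>Each of the n Todd factors has numerator (u_i . v) s. The numbers u_i . v
        cancel the denominator of \<kappa>, and the powers of s make up s^n.\<close>
      have "(\<Prod>i\<in>I. H (unit_char (a i)) (complex_of_real (u I i \<bullet> v) * ?s)) =
          (\<Prod>i\<in>I. complex_of_real (u I i \<bullet> v)) * ?s ^ n * (\<Prod>i\<in>I. ?e I a i)" for a
      proof -
        have "(\<Prod>i\<in>I. H (unit_char (a i)) (complex_of_real (u I i \<bullet> v) * ?s)) =
            (\<Prod>i\<in>I. complex_of_real (u I i \<bullet> v) * ?s * ?e I a i)"
          using nz t by (intro prod.cong) (auto simp: H_def mult_ac)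
        also have "\<dots> = (\<Prod>i\<in>I. complex_of_real (u I i \<bullet> v)) * (\<Prod>i\<in>I. ?s) * (\<Prod>i\<in>I. ?e I a i)"
          by (simp only: prod.distrib)
        also have "(\<Prod>i\<in>I. ?s) = ?s ^ n" by (simp add: card_facet[OF I])
        finally show ?thesis .
      qed
      then have "\<kappa> I * (exp (complex_of_real (p I \<bullet> v) * ?s) *
          (\<Sum>a\<in>par I. \<Prod>i\<in>I. H (unit_char (a i)) (complex_of_real (u I i \<bullet> v) * ?s))) =
        \<kappa> I * (\<Prod>i\<in>I. complex_of_real (u I i \<bullet> v)) * ?s ^ n *
          (\<Sum>a\<in>par I. exp (complex_of_real (p I \<bullet> v) * ?s) * (\<Prod>i\<in>I. ?e I a i))"
        by (simp only: sum_distrib_left mult_ac)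
      also have "\<kappa> I * (\<Prod>i\<in>I. complex_of_real (u I i \<bullet> v)) = of_int (w I) / of_nat (card (par I))"
        using pnz by (simp add: \<kappa>_def)
      also have "of_int (w I) / of_nat (card (par I)) * ?s ^ n *
          (\<Sum>a\<in>par I. exp (complex_of_real (p I \<bullet> v) * ?s) * (\<Prod>i\<in>I. ?e I a i)) =
          ?s ^ n * (of_int (w I) / of_nat (card (par I)) *
        (\<Sum>a\<in>par I. exp (- complex_of_real (t * (p I \<bullet> v))) * (\<Prod>i\<in>I. ?e I a i)))"
        unfolding exp_eq by (simp only: mult_ac)
      finally show "\<kappa> I * (exp (complex_of_real (p I \<bullet> v) * ?s) *
          (\<Sum>a\<in>par I. \<Prod>i\<in>I. H (unit_char (a i)) (complex_of_real (u I i \<bullet> v) * ?s))) =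
          ?s ^ n * (of_int (w I) / of_nat (card (par I)) *
        (\<Sum>a\<in>par I. exp (- complex_of_real (t * (p I \<bullet> v))) * (\<Prod>i\<in>I. ?e I a i)))" .
    qed simp
    also have "\<dots> = ?s ^ n * (\<Sum>q\<in>S. of_int (count q) * exp (- complex_of_real (t * (q \<bullet> v))))"
      using generating_function[OF t] by (simp only: S_def sum_distrib_left)
    also have "\<dots> = \<Psi> ?s" by (simp add: \<Psi>_def mult.commute)
    finally show "\<Phi> ?s = \<Psi> ?s" .
  qed
  \<comment> \<open>After the factor s^n, the coefficient of degree n on the right is the sum of the
    constant terms, and each exponential contributes 1.\<close>
  then have "fps_nth (\<Sum>I\<in>Fac. fps_const (\<kappa> I) * RR_fps I) n =
      fps_nth (fps_X ^ n * (\<Sum>q\<in>S. fps_const (of_int (count q)) * fps_exp (complex_of_real (q \<bullet> v)))) n"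
    by simp
  then have "(\<Sum>I\<in>Fac. \<kappa> I * fps_nth (RR_fps I) n) = (\<Sum>q\<in>S. of_int (count q))"
    by (simp add: fps_sum_nth fps_X_power_mult_nth)
  then show ?thesis by (simp add: \<kappa>_def S_def)
qed

end

section \<open>Simplicial cones\<close>

lemma nonneg_hull_iff:
  "x \<in> nonneg_hull S \<longleftrightarrow> (\<exists>c. (\<forall>s\<in>S. 0 \<le> c s) \<and> x = (\<Sum>s\<in>S. c s *\<^sub>R s))"
  by (auto simp: nonneg_hull_def)

lemma nonneg_hull_mem: "finite S \<Longrightarrow> s \<in> S \<Longrightarrow> s \<in> nonneg_hull S"
proof -
  assume S: "finite S" "s \<in> S"
  have "(\<Sum>x\<in>S. (if x = s then 1 else 0) *\<^sub>R x) = (\<Sum>x\<in>S. if x = s then x else 0)"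
    by (intro sum.cong) auto
  then show ?thesis
    unfolding nonneg_hull_iff using S by (intro exI[of _ "\<lambda>x. if x = s then 1 else 0"]) auto
qed

lemma nonneg_hull_scale: "x \<in> nonneg_hull S \<Longrightarrow> 0 \<le> t \<Longrightarrow> t *\<^sub>R x \<in> nonneg_hull S"
  unfolding nonneg_hull_iff
  by (elim exE conjE, rule_tac x = "\<lambda>s. t * c s" in exI) (auto simp: scaleR_sum_right)

lemma nonneg_hull_add: "x \<in> nonneg_hull S \<Longrightarrow> y \<in> nonneg_hull S \<Longrightarrow> x + y \<in> nonneg_hull S"
  unfolding nonneg_hull_iff
  by (elim exE conjE, rule_tac x = "\<lambda>s. c s + ca s" in exI) (auto simp: scaleR_left_distrib sum.distrib)

lemma nonneg_hull_0: "0 \<in> nonneg_hull S"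
  unfolding nonneg_hull_iff by (intro exI[of _ "\<lambda>_. 0"]) auto

lemma nonneg_hull_sum: "(\<And>i. i \<in> A \<Longrightarrow> f i \<in> nonneg_hull S) \<Longrightarrow> sum f A \<in> nonneg_hull S"
  by (induction A rule: infinite_finite_induct) (auto intro: nonneg_hull_add nonneg_hull_0)

lemma nonneg_hull_least:
  assumes "\<And>s. s \<in> S \<Longrightarrow> s \<in> nonneg_hull T" shows "nonneg_hull S \<subseteq> nonneg_hull T"
proof
  fix x assume "x \<in> nonneg_hull S"
  then obtain c where "\<forall>s\<in>S. 0 \<le> c s" "x = (\<Sum>s\<in>S. c s *\<^sub>R s)" by (auto simp: nonneg_hull_iff)
  then show "x \<in> nonneg_hull T" by (simp add: assms nonneg_hull_scale nonneg_hull_sum)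
qed

lemma convex_nonneg_hull: "convex (nonneg_hull S)"
  by (rule convexI) (auto intro: nonneg_hull_add nonneg_hull_scale)

lemma nonneg_hull_subset_span: "nonneg_hull S \<subseteq> span S"
  by (auto simp: nonneg_hull_iff intro!: span_sum span_scale intro: span_base)

lemma span_nonneg_hull: "finite S \<Longrightarrow> span (nonneg_hull S) = span S"
  by (metis nonneg_hull_mem nonneg_hull_subset_span span_mono span_span subset_antisym subsetI)

lemma dim_nonneg_hull: "finite S \<Longrightarrow> dim (nonneg_hull S) = dim S"
  by (metis dim_span span_nonneg_hull)

lemma nonneg_hull_single: "nonneg_hull {b} = {t *\<^sub>R b | t. 0 \<le> t}"
  by (auto simp: nonneg_hull_iff)

lemma nonneg_hull_single_scale:
  assumes "t > 0" shows "nonneg_hull {t *\<^sub>R b} = nonneg_hull {b}"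
proof
  show "nonneg_hull {t *\<^sub>R b} \<subseteq> nonneg_hull {b}"
    using assms by (intro nonneg_hull_least) (auto simp: nonneg_hull_single)
  have "b = (1 / t) *\<^sub>R (t *\<^sub>R b)" using assms by simp
  then have "b \<in> nonneg_hull {t *\<^sub>R b}"
    using assms unfolding nonneg_hull_single by (metis (mono_tags) less_eq_real_def mem_Collect_eq zero_less_divide_1_iff)
  then show "nonneg_hull {b} \<subseteq> nonneg_hull {t *\<^sub>R b}" by (intro nonneg_hull_least) auto
qed

lemma nonneg_hull_single_eq:
  assumes "nonneg_hull {a} = nonneg_hull {b}" "a \<noteq> 0"
  shows "\<exists>t>0. a = t *\<^sub>R b"
proof -
  have "a \<in> nonneg_hull {b}" using assms(1) nonneg_hull_mem[of "{a}" a] by simp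
  then obtain t where "a = t *\<^sub>R b" "0 \<le> t" by (auto simp: nonneg_hull_single)
  then show ?thesis using assms(2) by (intro exI[of _ t]) (auto simp: less_eq_real_def)
qed

lemma independent_if_dual:
  fixes r :: "'i \<Rightarrow> 'a::euclidean_space"
  assumes "finite I" "\<And>i j. i \<in> I \<Longrightarrow> j \<in> I \<Longrightarrow> f i \<bullet> r j = (if i = j then 1 else 0)"
  shows "inj_on r I" "independent (r ` I)"
proof -
  show inj: "inj_on r I"
  proof (rule inj_onI)
    fix i j assume ij: "i \<in> I" "j \<in> I" "r i = r j"
    then show "i = j" using assms(2)[of i i] assms(2)[of i j] by (auto split: if_splits)
  qed
  show "independent (r ` I)"
  proof
    assume "dependent (r ` I)"
    then obtain g x where g: "x \<in> r ` I" "g x \<noteq> 0" "(\<Sum>y\<in>r ` I. g y *\<^sub>R y) = 0"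
      using assms(1) by (auto simp: dependent_finite)
    then obtain i where i: "i \<in> I" "x = r i" by auto
    have "0 = f i \<bullet> (\<Sum>j\<in>I. g (r j) *\<^sub>R r j)" using g(3) by (simp add: sum.reindex[OF inj])
    also have "\<dots> = (\<Sum>j\<in>I. if j = i then g (r j) else 0)"
      unfolding inner_sum_right using assms(2)[OF i(1)] by (intro sum.cong) auto
    finally show False using i g(2) assms(1) by simp
  qed
qed

lemma independent_imp_dual:
  fixes r :: "'i \<Rightarrow> 'a::euclidean_space"
  assumes "inj_on r I" "independent (r ` I)"
  obtains f where "\<And>i. i \<in> I \<Longrightarrow> f i \<in> span (r ` I)"
    "\<And>i j. i \<in> I \<Longrightarrow> j \<in> I \<Longrightarrow> f i \<bullet> r j = (if i = j then 1 else 0)"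
proof -
  obtain f where f: "\<And>b. b \<in> r ` I \<Longrightarrow> f b \<in> span (r ` I)"
    "\<And>b c. b \<in> r ` I \<Longrightarrow> c \<in> r ` I \<Longrightarrow> f b \<bullet> c = (if b = c then 1 else 0)"
    using dual_basis_exists[OF assms(2)] by metis
  show thesis
    by (rule that[of "\<lambda>i. f (r i)"]) (use f assms(1) in \<open>auto simp: inj_on_eq_iff\<close>)
qed

lemma inner_dual_sum:
  fixes r :: "'i \<Rightarrow> 'a::euclidean_space"
  assumes "finite I" "i \<in> I" "\<And>j. j \<in> I \<Longrightarrow> f \<bullet> r j = (if i = j then 1 else 0)"
  shows "f \<bullet> (\<Sum>j\<in>I. c j *\<^sub>R r j) = c i"
proof -
  have "f \<bullet> (\<Sum>j\<in>I. c j *\<^sub>R r j) = (\<Sum>j\<in>I. if j = i then c j else 0)"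
    unfolding inner_sum_right using assms by (intro sum.cong) auto
  then show ?thesis using assms by simp
qed

lemma span_image_sum:
  assumes "finite I" "x \<in> span (r ` I)"
  obtains c where "x = (\<Sum>i\<in>I. c i *\<^sub>R r i)"
proof -
  have "\<exists>c. x = (\<Sum>i\<in>I. c i *\<^sub>R r i)"
    using assms(2)
  proof (induction rule: span_induct_alt)
    case base
    show ?case by (intro exI[of _ "\<lambda>_. 0"]) simp
  next
    case (step a y z)
    then obtain i c where i: "i \<in> I" "y = r i" "z = (\<Sum>i\<in>I. c i *\<^sub>R r i)" by auto
    have "(\<Sum>j\<in>I. (if j = i then a else 0) *\<^sub>R r j) = (\<Sum>j\<in>I. if j = i then a *\<^sub>R r i else 0)"
      by (intro sum.cong) auto
    then have "a *\<^sub>R y + z = (\<Sum>j\<in>I. ((if j = i then a else 0) + c j) *\<^sub>R r j)"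
      using assms(1) i by (simp add: scaleR_left_distrib sum.distrib)
    then show ?case by (rule exI[of _ "\<lambda>j. (if j = i then a else 0) + c j"])
  qed
  then show thesis using that by blast
qed

text \<open>The sum of the dual basis vectors other than that of \<open>b\<close> is nonnegative on
  the cone and vanishes there exactly on the ray of \<open>b\<close>.\<close>

lemma ray_face_of:
  assumes B: "independent B" and b: "b \<in> B"
  shows "nonneg_hull {b} face_of nonneg_hull B"
    and "\<exists>g. (\<forall>x\<in>nonneg_hull B. g \<bullet> x \<ge> 0) \<and> nonneg_hull {b} = {x \<in> nonneg_hull B. g \<bullet> x = 0}"
proof -
  have fin: "finite B" using B by (rule independent_imp_finite)
  obtain f where f: "\<And>b c. b \<in> B \<Longrightarrow> c \<in> B \<Longrightarrow> f b \<bullet> c = (if b = c then 1 else 0)"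
    using dual_basis_exists[OF B] by metis
  define g where "g = sum f (B - {b})"
  have g_sum: "g \<bullet> (\<Sum>x\<in>B. c x *\<^sub>R x) = (\<Sum>x\<in>B - {b}. c x)" for c
    unfolding g_def inner_sum_left
    by (intro sum.cong) (use fin f in \<open>auto intro!: inner_dual_sum[where r = "\<lambda>x. x"]\<close>)
  have ge: "g \<bullet> x \<ge> 0" if "x \<in> nonneg_hull B" for x
    using that by (auto simp: nonneg_hull_iff g_sum intro!: sum_nonneg)
  have eq: "nonneg_hull {b} = {x \<in> nonneg_hull B. g \<bullet> x = 0}"
  proof (intro equalityI subsetI)
    fix x assume "x \<in> nonneg_hull {b}"
    then obtain t where t: "x = t *\<^sub>R b" "0 \<le> t" by (auto simp: nonneg_hull_single)
    have "g \<bullet> b = 0" unfolding g_def inner_sum_left using f b by (intro sum.neutral) auto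
    then show "x \<in> {x \<in> nonneg_hull B. g \<bullet> x = 0}"
      using t nonneg_hull_mem[OF fin b] by (auto intro: nonneg_hull_scale)
  next
    fix x assume x: "x \<in> {x \<in> nonneg_hull B. g \<bullet> x = 0}"
    then obtain c where c: "\<forall>s\<in>B. 0 \<le> c s" "x = (\<Sum>s\<in>B. c s *\<^sub>R s)" by (auto simp: nonneg_hull_iff)
    then have "(\<Sum>s\<in>B - {b}. c s) = 0" using x g_sum by auto
    then have "\<forall>s\<in>B - {b}. c s = 0" using c(1) fin by (subst (asm) sum_nonneg_eq_0_iff) auto
    then have "x = (\<Sum>s\<in>B. if s = b then c b *\<^sub>R b else 0)" unfolding c(2) by (intro sum.cong) auto
    then have "x = c b *\<^sub>R b" using fin b by simp
    then show "x \<in> nonneg_hull {b}" using c(1) b by (auto simp: nonneg_hull_single)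
  qed
  show "\<exists>g. (\<forall>x\<in>nonneg_hull B. g \<bullet> x \<ge> 0) \<and> nonneg_hull {b} = {x \<in> nonneg_hull B. g \<bullet> x = 0}"
    using ge eq by blast
  have "nonneg_hull {b} = nonneg_hull B \<inter> {x. g \<bullet> x = 0}" using eq by blast
  then show "nonneg_hull {b} face_of nonneg_hull B"
    using face_of_Int_supporting_hyperplane_ge[OF convex_nonneg_hull, where a = g and b = 0] ge by auto
qed

text \<open>Rationality passes to rays. Expand \<open>b\<close> in lattice generators of the cone:
  the supporting form of the ray is 0 on \<open>b\<close> and nonnegative on the generators, so
  every generator that contributes lies on the ray.\<close>

lemma ray_is_cone:
  assumes B: "independent B" and b: "b \<in> B" and cone: "is_cone N (nonneg_hull B)"
  shows "is_cone N (nonneg_hull {b})" "\<exists>t>0. t *\<^sub>R b \<in> N"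
proof -
  have fin: "finite B" using B by (rule independent_imp_finite)
  have b0: "b \<noteq> 0" using B b dependent_zero by blast
  obtain S where S: "finite S" "S \<subseteq> N" "nonneg_hull B = nonneg_hull S"
    using cone by (auto simp: is_cone_def)
  obtain g where g: "\<And>x. x \<in> nonneg_hull B \<Longrightarrow> g \<bullet> x \<ge> 0" "nonneg_hull {b} = {x \<in> nonneg_hull B. g \<bullet> x = 0}"
    using ray_face_of(2)[OF B b] by blast
  have "b \<in> nonneg_hull S" using nonneg_hull_mem[OF fin b] S(3) by simp
  then obtain c where c: "\<forall>s\<in>S. 0 \<le> c s" "b = (\<Sum>s\<in>S. c s *\<^sub>R s)" by (auto simp: nonneg_hull_iff)
  have "g \<bullet> b = 0" using g(2) nonneg_hull_mem[of "{b}" b] by auto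
  then have "(\<Sum>s\<in>S. c s * (g \<bullet> s)) = 0" by (subst (asm) c(2)) (simp add: inner_sum_right)
  then have "\<forall>s\<in>S. c s * (g \<bullet> s) = 0"
    using S c(1) g(1) nonneg_hull_mem[OF S(1)] by (subst (asm) sum_nonneg_eq_0_iff) auto
  moreover obtain s where s: "s \<in> S" "c s *\<^sub>R s \<noteq> 0" using b0 unfolding c(2) by (rule sum.not_neutral_contains_not_neutral)
  ultimately have "s \<in> nonneg_hull {b}" using g(2) S nonneg_hull_mem[OF S(1) s(1)] by auto
  then obtain t where t: "s = t *\<^sub>R b" "0 \<le> t" by (auto simp: nonneg_hull_single)
  then have t0: "t > 0" using s(2) by (auto simp: less_eq_real_def)
  then show "\<exists>t>0. t *\<^sub>R b \<in> N" using t s(1) S(2) by blast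
  show "is_cone N (nonneg_hull {b})"
    unfolding is_cone_def
  proof (intro conjI allI impI)
    show "\<exists>S. finite S \<and> S \<subseteq> N \<and> nonneg_hull {b} = nonneg_hull S"
      using nonneg_hull_single_scale[OF t0, of b] t(1) s(1) S(2) by (intro exI[of _ "{s}"]) auto
    fix x assume "x \<in> nonneg_hull {b} \<and> - x \<in> nonneg_hull {b}"
    then have "x \<in> nonneg_hull B \<and> - x \<in> nonneg_hull B" using g(2) by auto
    then show "x = 0" using cone by (auto simp: is_cone_def)
  qed
qed

text \<open>Some \<open>b\<close> has positive coefficient in \<open>a\<close>. Then
  \<open>a\<close> is the midpoint of twice that term and twice the remaining sum, and the face
  property forces \<open>b\<close> onto the ray of \<open>a\<close>.\<close>

lemma face_of_simplicial_ray:
  assumes B: "independent B" and a: "a \<noteq> 0" and face: "nonneg_hull {a} face_of nonneg_hull B"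
  shows "\<exists>b\<in>B. nonneg_hull {a} = nonneg_hull {b}"
proof -
  have fin: "finite B" using B by (rule independent_imp_finite)
  obtain f where f: "\<And>b c. b \<in> B \<Longrightarrow> c \<in> B \<Longrightarrow> f b \<bullet> c = (if b = c then 1 else 0)"
    using dual_basis_exists[OF B] by metis
  have "a \<in> nonneg_hull B" using face nonneg_hull_mem[of "{a}" a] by (auto dest: face_of_imp_subset)
  then obtain c where c: "\<forall>s\<in>B. 0 \<le> c s" "a = (\<Sum>s\<in>B. c s *\<^sub>R s)" by (auto simp: nonneg_hull_iff)
  obtain b where b: "b \<in> B" "c b *\<^sub>R b \<noteq> 0" using a unfolding c(2) by (rule sum.not_neutral_contains_not_neutral)
  have cb: "c b > 0" using b c(1) by (auto simp: less_eq_real_def)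
  define x where "x = (2 * c b) *\<^sub>R b"
  define y where "y = 2 *\<^sub>R (\<Sum>s\<in>B - {b}. c s *\<^sub>R s)"
  have "a = c b *\<^sub>R b + (\<Sum>s\<in>B - {b}. c s *\<^sub>R s)" unfolding c(2) by (rule sum.remove[OF fin b(1)])
  then have mid: "a = midpoint x y" by (simp add: midpoint_def x_def y_def scaleR_right_distrib)
  have xB: "x \<in> nonneg_hull B"
    unfolding x_def using cb by (intro nonneg_hull_scale[OF nonneg_hull_mem[OF fin b(1)]]) simp
  have yB: "y \<in> nonneg_hull B"
    unfolding y_def using c(1)
    by (intro nonneg_hull_scale[OF nonneg_hull_sum]) (auto intro: nonneg_hull_scale[OF nonneg_hull_mem[OF fin]])
  have "f b \<bullet> x = 2 * c b" using f b(1) by (simp add: x_def)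
  moreover have "f b \<bullet> y = 0" using f b(1) by (auto simp: y_def inner_sum_right intro!: sum.neutral split: if_splits)
  ultimately have "x \<noteq> y" using cb by auto
  then have "a \<in> open_segment x y" unfolding mid by simp
  then have "x \<in> nonneg_hull {a}"
    using face xB yB nonneg_hull_mem[of "{a}" a] unfolding face_of_def by blast
  then obtain t where t: "x = t *\<^sub>R a" "0 \<le> t" by (auto simp: nonneg_hull_single)
  have "x \<noteq> 0" using b(2) by (simp add: x_def)
  then have t0: "t > 0" using t by (auto simp: less_eq_real_def)
  have "nonneg_hull {a} = nonneg_hull {x}" using nonneg_hull_single_scale[OF t0, of a] t(1) by simp
  also have "\<dots> = nonneg_hull {b}" unfolding x_def using cb by (intro nonneg_hull_single_scale) simp
  finally show ?thesis using b(1) by blast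
qed

section \<open>Primitive vectors\<close>

text \<open>With m the least positive multiplier such that m b is a lattice point, division with
  remainder shows that the lattice points of the ray are the natural multiples of m b. The only
  indivisible one among them is m b.\<close>

lemma primitive_vector_ex1:
  assumes N: "is_lattice N" and b: "b \<noteq> 0" "t0 > 0" "t0 *\<^sub>R b \<in> N"
  shows "\<exists>!v. v \<in> N \<and> v \<in> nonneg_hull {b} \<and> v \<noteq> 0 \<and>
    (\<forall>(k::nat). \<forall>x\<in>N. v = of_nat k *\<^sub>R x \<longrightarrow> k = 1)"
proof -
  define T where "T = {t. 0 < t \<and> t \<le> t0 \<and> t *\<^sub>R b \<in> N}"
  have "finite T"
  proof (rule inj_on_finite[of "\<lambda>t. t *\<^sub>R b"])
    show "inj_on (\<lambda>t. t *\<^sub>R b) T" using b(1) by (auto simp: inj_on_def)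
    show "(\<lambda>t. t *\<^sub>R b) ` T \<subseteq> {x \<in> N. norm x \<le> t0 * norm b}"
      by (auto simp: T_def intro!: mult_right_mono)
  qed (rule finite_lattice_ball[OF N])
  moreover have "t0 \<in> T" using b by (simp add: T_def)
  ultimately have m: "Min T \<in> T" and least: "\<And>t. t \<in> T \<Longrightarrow> Min T \<le> t" by (auto intro: Min_in)
  define m where "m = Min T"
  have m0: "m > 0" "m *\<^sub>R b \<in> N" and least: "\<And>t. t > 0 \<Longrightarrow> t *\<^sub>R b \<in> N \<Longrightarrow> m \<le> t"
  proof -
    show "m > 0" "m *\<^sub>R b \<in> N" using m by (auto simp: T_def m_def)
    have "m \<le> t0" using m by (auto simp: T_def m_def)
    then show "m \<le> t" if "t > 0" "t *\<^sub>R b \<in> N" for t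
      using least[of t] that by (cases "t \<le> t0") (auto simp: T_def m_def)
  qed
  show ?thesis
  proof (rule ex1I[of _ "m *\<^sub>R b"])
    show "m *\<^sub>R b \<in> N \<and> m *\<^sub>R b \<in> nonneg_hull {b} \<and> m *\<^sub>R b \<noteq> 0 \<and>
      (\<forall>(k::nat). \<forall>x\<in>N. m *\<^sub>R b = of_nat k *\<^sub>R x \<longrightarrow> k = 1)"
    proof (intro conjI allI ballI impI)
      fix k :: nat and x assume x: "x \<in> N" "m *\<^sub>R b = of_nat k *\<^sub>R x"
      then have k: "k > 0" using m0 b(1) by (cases k) auto
      then have "x = (m / k) *\<^sub>R b" using x(2)
        by (metis divide_inverse_commute of_nat_0_less_iff less_numeral_extra(3) of_nat_eq_0_iff scaleR_scaleR scaleR_one left_inverse neq0_conv)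
      then have "m \<le> m / k" using x(1) m0 k by (intro least) auto
      then have "real k \<le> 1" using k m0 by (simp add: field_simps)
      then show "k = 1" using k by simp
    qed (use m0 b(1) in \<open>auto simp: nonneg_hull_single intro: less_imp_le\<close>)
    fix v assume v: "v \<in> N \<and> v \<in> nonneg_hull {b} \<and> v \<noteq> 0 \<and>
      (\<forall>(k::nat). \<forall>x\<in>N. v = of_nat k *\<^sub>R x \<longrightarrow> k = 1)"
    then obtain t where t: "v = t *\<^sub>R b" "0 \<le> t" by (auto simp: nonneg_hull_single)
    define s where "s = t - of_int \<lfloor>t / m\<rfloor> * m"
    have "s *\<^sub>R b = v - of_int \<lfloor>t / m\<rfloor> *\<^sub>R (m *\<^sub>R b)" by (simp add: s_def t scaleR_left_diff_distrib)
    also have "\<dots> \<in> N" using v m0 by (intro lattice_closed[OF N]) auto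
    finally have sN: "s *\<^sub>R b \<in> N" .
    have "of_int \<lfloor>t / m\<rfloor> \<le> t / m" "t / m < of_int \<lfloor>t / m\<rfloor> + 1" by linarith+
    then have "of_int \<lfloor>t / m\<rfloor> * m \<le> t" "t < (of_int \<lfloor>t / m\<rfloor> + 1) * m"
      using pos_le_divide_eq[OF m0(1)] pos_divide_less_eq[OF m0(1)] by blast+
    then have "0 \<le> s" "s < m" by (simp_all add: s_def algebra_simps)
    then have "s = 0" using least[of s] sN by fastforce
    moreover have "0 \<le> \<lfloor>t / m\<rfloor>" using t m0 by simp
    ultimately have "v = of_nat (nat \<lfloor>t / m\<rfloor>) *\<^sub>R (m *\<^sub>R b)" by (simp add: s_def t)
    then have "nat \<lfloor>t / m\<rfloor> = 1" using v m0(2) by blast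
    with \<open>v = of_nat (nat \<lfloor>t / m\<rfloor>) *\<^sub>R (m *\<^sub>R b)\<close> show "v = m *\<^sub>R b" by simp
  qed
qed

section \<open>Rays and facets of a simplicial multi-fan\<close>

context
  fixes \<Delta> :: "('a::euclidean_space, nat set) multi_fan"
  assumes fan: "is_multi_fan \<Delta>" and simplicial: "simplicial_fan \<Delta>"
begin

lemma lat_lattice: "is_lattice (lat \<Delta>)"
  using fan by (simp add: is_multi_fan_def)

lemma finite_faces: "finite (faces \<Delta>)"
  using fan by (simp add: is_multi_fan_def)

lemma cone_is_cone: "I \<in> faces \<Delta> \<Longrightarrow> is_cone (lat \<Delta>) (cone_of \<Delta> I)"
  using fan by (simp add: is_multi_fan_def)

lemma faces_subset: "I \<in> faces \<Delta> \<Longrightarrow> J \<subseteq> I \<Longrightarrow> J \<in> faces \<Delta>"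
  using simplicial unfolding simplicial_fan_def by blast

lemma face_subset_rays: "I \<in> faces \<Delta> \<Longrightarrow> I \<subseteq> {1..nrays \<Delta>}"
  using simplicial unfolding simplicial_fan_def by blast

lemma finite_face: "I \<in> faces \<Delta> \<Longrightarrow> finite I"
  using face_subset_rays finite_subset by blast

lemma faces_dim_1: "faces_dim \<Delta> 1 = (\<lambda>i. {i}) ` {1..nrays \<Delta>}"
  using simplicial by (simp add: simplicial_fan_def)

lemma cone_basis: "I \<in> faces \<Delta> \<Longrightarrow> \<exists>B. independent B \<and> cone_of \<Delta> I = nonneg_hull B"
  using simplicial by (simp add: simplicial_fan_def)

lemma cone_bij: "J \<in> faces \<Delta> \<Longrightarrow> bij_betw (cone_of \<Delta>) {I \<in> faces \<Delta>. I \<le> J}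
    {\<kappa>. is_cone (lat \<Delta>) \<kappa> \<and> \<kappa> face_of cone_of \<Delta> J}"
  using fan by (simp add: is_multi_fan_def)

lemma ray_generator:
  assumes i: "i \<in> {1..nrays \<Delta>}"
  obtains b where "b \<noteq> 0" "cone_of \<Delta> {i} = nonneg_hull {b}" "\<exists>t>0. t *\<^sub>R b \<in> lat \<Delta>"
proof -
  have f: "{i} \<in> faces_dim \<Delta> 1" using faces_dim_1 i by blast
  then have face: "{i} \<in> faces \<Delta>" and dim: "dim (cone_of \<Delta> {i}) = 1" by (auto simp: faces_dim_def)
  obtain B where B: "independent B" "cone_of \<Delta> {i} = nonneg_hull B" using cone_basis[OF face] by blast
  have fin: "finite B" using B(1) by (rule independent_imp_finite)
  have "card B = 1" using dim B dim_nonneg_hull[OF fin] by (simp add: dim_eq_card_independent)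
  then obtain b where b: "B = {b}" by (rule card_1_singletonE)
  show thesis
  proof (rule that[of b])
    show "b \<noteq> 0" using B(1) b by auto
    show "cone_of \<Delta> {i} = nonneg_hull {b}" using B(2) b by simp
    show "\<exists>t>0. t *\<^sub>R b \<in> lat \<Delta>"
      using ray_is_cone(2)[OF B(1), of b "lat \<Delta>"] cone_is_cone[OF face] B(2) b by simp
  qed
qed

lemma ray_vec_facts:
  assumes i: "i \<in> {1..nrays \<Delta>}"
  shows "ray_vec \<Delta> i \<in> lat \<Delta>" "ray_vec \<Delta> i \<noteq> 0" "cone_of \<Delta> {i} = nonneg_hull {ray_vec \<Delta> i}"
proof -
  obtain b t where b: "b \<noteq> 0" "cone_of \<Delta> {i} = nonneg_hull {b}" "t > 0" "t *\<^sub>R b \<in> lat \<Delta>"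
    using ray_generator[OF i] by metis
  have *: "ray_vec \<Delta> i \<in> lat \<Delta> \<and> ray_vec \<Delta> i \<in> nonneg_hull {b} \<and> ray_vec \<Delta> i \<noteq> 0 \<and>
    (\<forall>(k::nat). \<forall>x\<in>lat \<Delta>. ray_vec \<Delta> i = of_nat k *\<^sub>R x \<longrightarrow> k = 1)"
    unfolding ray_vec_def b(2) by (rule theI'[OF primitive_vector_ex1[OF lat_lattice b(1,3,4)]])
  then show "ray_vec \<Delta> i \<in> lat \<Delta>" "ray_vec \<Delta> i \<noteq> 0" by blast+
  obtain s where s: "ray_vec \<Delta> i = s *\<^sub>R b" "0 \<le> s" using * by (auto simp: nonneg_hull_single)
  then have "s > 0" using * by (auto simp: less_eq_real_def)
  then show "cone_of \<Delta> {i} = nonneg_hull {ray_vec \<Delta> i}"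
    using nonneg_hull_single_scale[of s b] s(1) b(2) by simp
qed

text \<open>The generators of a simplicial cone match its vertices. For i in I the ray of i is a
  face, hence spanned by a generator; conversely a generator spans a face of dimension 1, which the
  order isomorphism identifies with some {i}.\<close>

lemma cone_rays:
  assumes I: "I \<in> faces \<Delta>"
  shows "inj_on (ray_vec \<Delta>) I" "independent (ray_vec \<Delta> ` I)"
    "cone_of \<Delta> I = nonneg_hull (ray_vec \<Delta> ` I)"
proof -
  obtain B where B: "independent B" "cone_of \<Delta> I = nonneg_hull B" using cone_basis[OF I] by blast
  have fin: "finite B" using B(1) by (rule independent_imp_finite)
  have sub: "i \<in> {1..nrays \<Delta>}" "{i} \<in> faces \<Delta>" if "i \<in> I" for i
    using face_subset_rays[OF I] faces_subset[OF I] that by auto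
  have "\<exists>b\<in>B. nonneg_hull {ray_vec \<Delta> i} = nonneg_hull {b}" if i: "i \<in> I" for i
  proof (rule face_of_simplicial_ray[OF B(1) ray_vec_facts(2)[OF sub(1)[OF i]]])
    have "cone_of \<Delta> {i} \<in> {\<kappa>. is_cone (lat \<Delta>) \<kappa> \<and> \<kappa> face_of cone_of \<Delta> I}"
      using cone_bij[OF I] sub(2)[OF i] i by (auto simp: bij_betw_def)
    then show "nonneg_hull {ray_vec \<Delta> i} face_of nonneg_hull B"
      using ray_vec_facts(3)[OF sub(1)[OF i]] B(2) by simp
  qed
  then obtain \<beta> where \<beta>: "\<And>i. i \<in> I \<Longrightarrow> \<beta> i \<in> B"
    "\<And>i. i \<in> I \<Longrightarrow> nonneg_hull {ray_vec \<Delta> i} = nonneg_hull {\<beta> i}" by metis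
  have "\<exists>t>0. ray_vec \<Delta> i = t *\<^sub>R \<beta> i" if "i \<in> I" for i
    by (rule nonneg_hull_single_eq[OF \<beta>(2)[OF that] ray_vec_facts(2)[OF sub(1)[OF that]]])
  then obtain \<tau> where \<tau>: "\<And>i. i \<in> I \<Longrightarrow> \<tau> i > 0" "\<And>i. i \<in> I \<Longrightarrow> ray_vec \<Delta> i = \<tau> i *\<^sub>R \<beta> i" by metis
  have inj: "inj_on \<beta> I"
  proof (rule inj_onI)
    fix i j assume ij: "i \<in> I" "j \<in> I" "\<beta> i = \<beta> j"
    then have "cone_of \<Delta> {i} = cone_of \<Delta> {j}" using \<beta>(2) ray_vec_facts(3) sub by metis
    then have "{i} = {j}"
      by (rule inj_onD[OF bij_betw_imp_inj_on[OF cone_bij[OF I]]]) (use ij sub in auto)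
    then show "i = j" by simp
  qed
  have onto: "\<exists>i\<in>I. \<beta> i = b" if b: "b \<in> B" for b
  proof -
    have "nonneg_hull {b} \<in> {\<kappa>. is_cone (lat \<Delta>) \<kappa> \<and> \<kappa> face_of cone_of \<Delta> I}"
      using ray_face_of(1)[OF B(1) b] ray_is_cone(1)[OF B(1) b] cone_is_cone[OF I] B(2) by simp
    then obtain J where J: "J \<in> faces \<Delta>" "J \<subseteq> I" "cone_of \<Delta> J = nonneg_hull {b}"
      using cone_bij[OF I] unfolding bij_betw_def by (auto simp: image_iff set_eq_iff) metis
    have "b \<noteq> 0" using B(1) b dependent_zero by blast
    then have "dim (cone_of \<Delta> J) = 1" unfolding J(3) by (simp add: dim_nonneg_hull)
    then have "J \<in> faces_dim \<Delta> 1" using J(1) by (simp add: faces_dim_def)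
    then obtain i where i: "J = {i}" unfolding faces_dim_1 by auto
    then have iI: "i \<in> I" using J(2) by auto
    have "nonneg_hull {b} = nonneg_hull {\<beta> i}"
      using J(3) i \<beta>(2)[OF iI] ray_vec_facts(3)[OF sub(1)[OF iI]] by simp
    then obtain t where t: "t > 0" "b = t *\<^sub>R \<beta> i" using nonneg_hull_single_eq \<open>b \<noteq> 0\<close> by blast
    obtain f where f: "\<And>b c. b \<in> B \<Longrightarrow> c \<in> B \<Longrightarrow> f b \<bullet> c = (if b = c then 1 else 0)"
      using dual_basis_exists[OF B(1)] by metis
    have "f b \<bullet> b = t * (f b \<bullet> \<beta> i)" by (subst (2) t(2)) simp
    then have "\<beta> i = b" using f[OF b b] f[OF b \<beta>(1)[OF iI]] by (auto split: if_splits)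
    then show ?thesis using iI by blast
  qed
  obtain f where f: "\<And>b c. b \<in> B \<Longrightarrow> c \<in> B \<Longrightarrow> f b \<bullet> c = (if b = c then 1 else 0)"
    using dual_basis_exists[OF B(1)] by metis
  have "((1 / \<tau> i) *\<^sub>R f (\<beta> i)) \<bullet> ray_vec \<Delta> j = (if i = j then 1 else 0)" if "i \<in> I" "j \<in> I" for i j
    using that \<tau>(1)[of i] \<tau>(2)[of j] f[OF \<beta>(1) \<beta>(1)] inj by (auto simp: inj_on_eq_iff)
  from independent_if_dual[OF finite_face[OF I] this]
  show "inj_on (ray_vec \<Delta>) I" "independent (ray_vec \<Delta> ` I)" by blast+
  have "nonneg_hull (ray_vec \<Delta> ` I) = nonneg_hull B"
  proof
    show "nonneg_hull (ray_vec \<Delta> ` I) \<subseteq> nonneg_hull B"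
    proof (rule nonneg_hull_least)
      fix x assume "x \<in> ray_vec \<Delta> ` I"
      then obtain i where i: "i \<in> I" "x = \<tau> i *\<^sub>R \<beta> i" using \<tau>(2) by auto
      show "x \<in> nonneg_hull B"
        unfolding i(2) using \<tau>(1)[OF i(1)]
        by (intro nonneg_hull_scale[OF nonneg_hull_mem[OF fin \<beta>(1)[OF i(1)]]]) simp
    qed
    show "nonneg_hull B \<subseteq> nonneg_hull (ray_vec \<Delta> ` I)"
    proof (rule nonneg_hull_least)
      fix b assume "b \<in> B"
      then obtain i where i: "i \<in> I" "\<beta> i = b" using onto by blast
      have "b = (1 / \<tau> i) *\<^sub>R ray_vec \<Delta> i" using \<tau>[OF i(1)] i(2) by simp
      then show "b \<in> nonneg_hull (ray_vec \<Delta> ` I)"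
        using \<tau>(1)[OF i(1)] nonneg_hull_mem[of "ray_vec \<Delta> ` I" "ray_vec \<Delta> i"] finite_face[OF I] i(1)
        by (metis finite_imageI imageI less_imp_le nonneg_hull_scale zero_less_divide_1_iff)
    qed
  qed
  then show "cone_of \<Delta> I = nonneg_hull (ray_vec \<Delta> ` I)" using B(2) by simp
qed

lemma ray_mem_lat: "I \<in> faces \<Delta> \<Longrightarrow> i \<in> I \<Longrightarrow> ray_vec \<Delta> i \<in> lat \<Delta>"
  using ray_vec_facts(1) face_subset_rays by blast

lemma span_cone: "I \<in> faces \<Delta> \<Longrightarrow> span (cone_of \<Delta> I) = span (ray_vec \<Delta> ` I)"
  using cone_rays(3) span_nonneg_hull finite_face by (metis finite_imageI)

lemma dim_cone: "I \<in> faces \<Delta> \<Longrightarrow> dim (cone_of \<Delta> I) = card I"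
  by (metis card_image cone_rays(1,2) dim_eq_card_independent dim_span span_cone)

lemma facets_iff: "I \<in> facets \<Delta> \<longleftrightarrow> I \<in> faces \<Delta> \<and> card I = fan_dim \<Delta>"
  using dim_cone by (auto simp: faces_dim_def)

lemma rays_subset_span: "I \<in> faces \<Delta> \<Longrightarrow> ray_vec \<Delta> ` I \<subseteq> span (lat \<Delta>)"
  using ray_mem_lat span_base by blast

lemma span_facet:
  assumes "I \<in> facets \<Delta>" shows "span (ray_vec \<Delta> ` I) = span (lat \<Delta>)"
proof
  have I: "I \<in> faces \<Delta>" "card I = fan_dim \<Delta>" using assms facets_iff by auto
  show "span (ray_vec \<Delta> ` I) \<subseteq> span (lat \<Delta>)"
    using rays_subset_span[OF I(1)] span_minimal subspace_span by blast
  show "span (lat \<Delta>) \<subseteq> span (ray_vec \<Delta> ` I)"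
    using card_ge_dim_independent[OF rays_subset_span[OF I(1)] cone_rays(2)[OF I(1)]] I
    by (simp add: fan_dim_def card_image[OF cone_rays(1)[OF I(1)]])
qed

lemma card_face_le: "I \<in> faces \<Delta> \<Longrightarrow> card I \<le> fan_dim \<Delta>"
  using independent_card_le_dim[OF rays_subset_span cone_rays(2)] card_image[OF cone_rays(1)]
  by (metis fan_dim_def)

lemma dual_vec_facts:
  assumes I: "I \<in> facets \<Delta>" and i: "i \<in> I"
  shows "dual_vec \<Delta> I i \<in> span (lat \<Delta>)"
    "\<And>j. j \<in> I \<Longrightarrow> dual_vec \<Delta> I i \<bullet> ray_vec \<Delta> j = (if i = j then 1 else 0)"
proof -
  have face: "I \<in> faces \<Delta>" using I facets_iff by blast
  obtain f where f: "\<And>i. i \<in> I \<Longrightarrow> f i \<in> span (ray_vec \<Delta> ` I)"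
    "\<And>i j. i \<in> I \<Longrightarrow> j \<in> I \<Longrightarrow> f i \<bullet> ray_vec \<Delta> j = (if i = j then 1 else 0)"
    using independent_imp_dual[OF cone_rays(1,2)[OF face]] by metis
  have "\<exists>!u. u \<in> span (lat \<Delta>) \<and> (\<forall>j\<in>I. u \<bullet> ray_vec \<Delta> j = (if j = i then 1 else 0))"
  proof (rule ex1I[of _ "f i"])
    show "f i \<in> span (lat \<Delta>) \<and> (\<forall>j\<in>I. f i \<bullet> ray_vec \<Delta> j = (if j = i then 1 else 0))"
      using f i span_facet[OF I] by auto
    fix u assume u: "u \<in> span (lat \<Delta>) \<and> (\<forall>j\<in>I. u \<bullet> ray_vec \<Delta> j = (if j = i then 1 else 0))"
    have "orthogonal (u - f i) x" if "x \<in> ray_vec \<Delta> ` I" for x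
      using that u f(2)[OF i] by (auto simp: orthogonal_def inner_diff_left)
    moreover have "u - f i \<in> span (ray_vec \<Delta> ` I)"
      using u f(1)[OF i] span_facet[OF I] by (simp add: span_diff)
    ultimately have "orthogonal (u - f i) (u - f i)" using orthogonal_to_span by blast
    then show "u = f i" by (simp add: orthogonal_def)
  qed
  from theI'[OF this, folded dual_vec_def] show "dual_vec \<Delta> I i \<in> span (lat \<Delta>)"
    "\<And>j. j \<in> I \<Longrightarrow> dual_vec \<Delta> I i \<bullet> ray_vec \<Delta> j = (if i = j then 1 else 0)" by auto
qed

lemma facet_bases_fan:
  "facet_bases (lat \<Delta>) (ray_vec \<Delta>) (facets \<Delta>) (dual_vec \<Delta>) (fan_dim \<Delta>)"
proof
  show "finite (facets \<Delta>)" using finite_faces by (simp add: faces_dim_def)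
  fix I assume I: "I \<in> facets \<Delta>"
  then have face: "I \<in> faces \<Delta>" and "card I = fan_dim \<Delta>" using facets_iff by auto
  then show "finite I" "card I = fan_dim \<Delta>" using finite_face by auto
  show "ray_vec \<Delta> i \<in> lat \<Delta>" if "i \<in> I" for i using ray_mem_lat[OF face that] .
  show "dual_vec \<Delta> I i \<in> span (lat \<Delta>)" if "i \<in> I" for i using dual_vec_facts(1)[OF I that] .
  show "dual_vec \<Delta> I i \<bullet> ray_vec \<Delta> j = (if i = j then 1 else 0)" if "i \<in> I" "j \<in> I" for i j
    using dual_vec_facts(2)[OF I that] .
  show "x = (\<Sum>i\<in>I. (dual_vec \<Delta> I i \<bullet> x) *\<^sub>R ray_vec \<Delta> i)" if x: "x \<in> span (lat \<Delta>)" for x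
  proof -
    obtain c where c: "x = (\<Sum>i\<in>I. c i *\<^sub>R ray_vec \<Delta> i)"
      by (rule span_image_sum[of I x "ray_vec \<Delta>"]) (use finite_face[OF face] x span_facet[OF I] in auto)
    have "dual_vec \<Delta> I i \<bullet> x = c i" if "i \<in> I" for i
      unfolding c using dual_vec_facts(2)[OF I that] that
      by (intro inner_dual_sum[OF finite_face[OF face]]) auto
    then show ?thesis using c by simp
  qed
qed (rule lat_lattice)

end

section \<open>Balancing around a wall\<close>

lemma quot_map_eq:
  fixes U :: "'a::euclidean_space set"
  assumes "subspace U" "y \<in> orthogonal_comp U" "x - y \<in> U"
  shows "quot_map U x = y"
  unfolding quot_map_def
proof (rule the_equality)
  fix z assume z: "z \<in> orthogonal_comp U \<and> x - z \<in> U"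
  have "z - y \<in> orthogonal_comp U"
    using z assms(2) subspace_orthogonal_comp subspace_diff by blast
  moreover have "z - y \<in> U"
    using subspace_diff[OF assms(1,3)] z by (metis diff_diff_eq2 diff_add_cancel add.commute add_diff_cancel_left')
  ultimately have "orthogonal (z - y) (z - y)" by (auto simp: orthogonal_comp_def)
  then show "z = y" by (simp add: orthogonal_def)
qed (use assms in auto)

context
  fixes \<Delta> :: "('a::euclidean_space, nat set) multi_fan"
  assumes complete: "complete_fan \<Delta>" and simplicial: "simplicial_fan \<Delta>"
begin

lemma multi_fan: "is_multi_fan \<Delta>"
  using complete by (simp add: complete_fan_def)

interpretation bases: facet_bases "lat \<Delta>" "ray_vec \<Delta>" "facets \<Delta>" "dual_vec \<Delta>" "fan_dim \<Delta>"
  by (rule facet_bases_fan[OF multi_fan simplicial])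

text \<open>The projected multi-fan at the wall K lives on the line spanned by \<nu>, and its facets
  are half-lines on the side given by the sign of \<phi> . r j. Its degrees at \<nu> and - \<nu> are
  the total weights of the two sides, and their difference is the signed sum.\<close>

lemma wall_weights:
  assumes I: "I \<in> facets \<Delta>" and i: "i \<in> I"
  defines "K \<equiv> I - {i}"
  shows "(\<Sum>j\<in>wall_ext (facets \<Delta>) K. of_int (weight \<Delta> (insert j K)) *
    sgn (dual_vec \<Delta> I i \<bullet> ray_vec \<Delta> j)) = (0::real)"
proof -
  note facts = multi_fan simplicial
  let ?r = "ray_vec \<Delta>" and ?N = "lat \<Delta>"
  define \<phi> where "\<phi> = dual_vec \<Delta> I i"
  define W where "W = span (cone_of \<Delta> K)"
  have Iface: "I \<in> faces \<Delta>" "card I = fan_dim \<Delta>" using facets_iff[OF facts] I by auto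
  have Kface: "K \<in> faces \<Delta>" using faces_subset[OF facts Iface(1)] by (simp add: K_def)
  have finK: "finite K" using finite_face[OF facts Kface] .
  have W: "W = span (?r ` K)" unfolding W_def by (rule span_cone[OF facts Kface])
  have subW: "subspace W" unfolding W_def by simp
  have WV: "W \<subseteq> span ?N"
    unfolding W using rays_subset_span[OF facts Kface] span_minimal subspace_span by blast
  have \<phi>W: "\<phi> \<bullet> x = 0" if "x \<in> W" for x
  proof -
    have "orthogonal \<phi> y" if "y \<in> ?r ` K" for y
      using that bases.dual[OF I i] by (auto simp: orthogonal_def \<phi>_def K_def split: if_splits)
    then show ?thesis using orthogonal_to_span[of x "?r ` K" \<phi>] that by (simp add: W orthogonal_def)
  qed
  \<comment> \<open>\<nu> is the component of the ray i orthogonal to the wall. Since \<phi> . \<nu>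
    = 1, the quotient map becomes x -> (\<phi> . x) \<nu>.\<close>
  obtain p \<nu> where p: "p \<in> span W" "\<And>w. w \<in> span W \<Longrightarrow> orthogonal \<nu> w" "?r i = p + \<nu>"
    using orthogonal_subspace_decomp_exists[of W "?r i"] by metis
  have spW: "span W = W" unfolding W_def by (rule span_span)
  have pW: "p \<in> W" using p(1) spW by simp
  have \<phi>\<nu>: "\<phi> \<bullet> \<nu> = 1"
  proof -
    have "\<phi> \<bullet> ?r i = 1" unfolding \<phi>_def using bases.dual[OF I i i] by simp
    then show ?thesis using \<phi>W p spW by (simp add: inner_add_right)
  qed
  then have \<nu>0: "\<nu> \<noteq> 0" by auto
  have \<nu>orth: "\<nu> \<in> orthogonal_comp W"
    using p(2) spW by (auto simp: orthogonal_comp_def orthogonal_commute)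
  have q: "quot_map W x = (\<phi> \<bullet> x) *\<^sub>R \<nu>" if x: "x \<in> span ?N" for x
  proof (rule quot_map_eq[OF subW])
    show "(\<phi> \<bullet> x) *\<^sub>R \<nu> \<in> orthogonal_comp W"
      using \<nu>orth subspace_orthogonal_comp subspace_scale by blast
    have "x = (\<phi> \<bullet> x) *\<^sub>R ?r i + (\<Sum>k\<in>K. (dual_vec \<Delta> I k \<bullet> x) *\<^sub>R ?r k)"
      unfolding \<phi>_def K_def
      using bases.expand[OF I x] sum.remove[OF bases.finite_facet[OF I] i] by metis
    then have "x - (\<phi> \<bullet> x) *\<^sub>R \<nu> = (\<phi> \<bullet> x) *\<^sub>R p + (\<Sum>k\<in>K. (dual_vec \<Delta> I k \<bullet> x) *\<^sub>R ?r k)"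
      using p(3) by (simp add: algebra_simps)
    also have "\<dots> \<in> W"
      using pW unfolding W by (intro span_add span_scale span_sum) (auto intro: span_base)
    finally show "x - (\<phi> \<bullet> x) *\<^sub>R \<nu> \<in> W" .
  qed
  let ?P = "projected \<Delta> K"
  have latP: "lat ?P = (\<lambda>x. (\<phi> \<bullet> x) *\<^sub>R \<nu>) ` ?N"
    unfolding projected_def using q span_base by (auto simp: W_def[symmetric] intro!: image_cong)
  have coneP: "cone_of ?P J = (\<lambda>x. (\<phi> \<bullet> x) *\<^sub>R \<nu>) ` nonneg_hull (?r ` J)" if J: "J \<in> faces \<Delta>" for J
  proof -
    have "nonneg_hull (?r ` J) \<subseteq> span ?N"
      using nonneg_hull_subset_span rays_subset_span[OF facts J] span_minimal[OF _ subspace_span] by blast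
    then show ?thesis
      unfolding projected_def using q cone_rays(3)[OF facts J]
      by (auto simp: W_def[symmetric] intro!: image_cong)
  qed
  have \<nu>lat: "\<nu> \<in> lat ?P"
    unfolding latP using bases.ray_mem[OF I i] bases.dual[OF I i i]
    by (intro image_eqI[of _ _ "?r i"]) (auto simp: \<phi>_def)
  have spanP: "span (lat ?P) = span {\<nu>}"
  proof
    show "span (lat ?P) \<subseteq> span {\<nu>}"
      by (rule span_minimal) (auto simp: latP intro: span_scale span_base)
    show "span {\<nu>} \<subseteq> span (lat ?P)" using \<nu>lat by (intro span_mono) auto
  qed
  have dimP: "fan_dim ?P = 1"
    unfolding fan_dim_def spanP using \<nu>0 by (simp add: dim_span)
  have cone_ext: "cone_of ?P (insert j K) = {(c * (\<phi> \<bullet> ?r j)) *\<^sub>R \<nu> | c. 0 \<le> c}"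
    if j: "j \<notin> K" "insert j K \<in> faces \<Delta>" for j
  proof -
    have inj: "inj_on ?r (insert j K)" by (rule cone_rays(1)[OF facts j(2)])
    have val: "\<phi> \<bullet> (\<Sum>s\<in>?r ` insert j K. c s *\<^sub>R s) = c (?r j) * (\<phi> \<bullet> ?r j)" for c
    proof -
      have "(\<Sum>s\<in>?r ` insert j K. c s *\<^sub>R s) = c (?r j) *\<^sub>R ?r j + (\<Sum>k\<in>K. c (?r k) *\<^sub>R ?r k)"
        unfolding sum.reindex[OF inj] using j(1) finK by simp
      moreover have "\<phi> \<bullet> (\<Sum>k\<in>K. c (?r k) *\<^sub>R ?r k) = 0"
        by (intro \<phi>W) (auto simp: W intro!: span_sum span_scale intro: span_base)
      ultimately show ?thesis by (simp add: inner_add_right)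
    qed
    show ?thesis
      unfolding coneP[OF j(2)]
    proof (intro equalityI subsetI)
      fix x assume "x \<in> (\<lambda>x. (\<phi> \<bullet> x) *\<^sub>R \<nu>) ` nonneg_hull (?r ` insert j K)"
      then obtain c where "\<forall>s\<in>?r ` insert j K. 0 \<le> c s"
        "x = (\<phi> \<bullet> (\<Sum>s\<in>?r ` insert j K. c s *\<^sub>R s)) *\<^sub>R \<nu>" by (auto simp: nonneg_hull_iff)
      then show "x \<in> {(c * (\<phi> \<bullet> ?r j)) *\<^sub>R \<nu> | c. 0 \<le> c}" unfolding val by auto
    next
      fix x assume "x \<in> {(c * (\<phi> \<bullet> ?r j)) *\<^sub>R \<nu> | c. 0 \<le> c}"
      then obtain c where c: "0 \<le> c" "x = (c * (\<phi> \<bullet> ?r j)) *\<^sub>R \<nu>" by auto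
      have "c *\<^sub>R ?r j \<in> nonneg_hull (?r ` insert j K)"
        using c(1) finK by (intro nonneg_hull_scale nonneg_hull_mem) auto
      then show "x \<in> (\<lambda>x. (\<phi> \<bullet> x) *\<^sub>R \<nu>) ` nonneg_hull (?r ` insert j K)"
        by (rule image_eqI[rotated]) (simp add: c)
    qed
  qed
  have \<phi>r: "\<phi> \<bullet> ?r j \<noteq> 0" if j: "j \<notin> K" "insert j K \<in> facets \<Delta>" for j
  proof -
    have "insert j K - {j} = I - {i}" using j(1) by (auto simp: K_def)
    then show ?thesis
      unfolding \<phi>_def
      using bases.wall_proportional(2)[OF I i j(2) _ _ span_zero, of j] by simp
  qed
  have facesP: "faces ?P = {J \<in> faces \<Delta>. K \<subseteq> J}" by (simp add: projected_def)
  have coneK: "cone_of ?P K \<subseteq> {0}"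
    unfolding coneP[OF Kface] using \<phi>W nonneg_hull_subset_span[of "?r ` K"] by (auto simp: W)
  have cardK: "Suc (card K) = fan_dim \<Delta>"
    unfolding K_def using card_Suc_Diff1[OF finite_face[OF facts Iface(1)] i] Iface(2) by (rule trans)
  \<comment> \<open>K has n - 1 vertices and no face has more than n, so there is room for one
    further vertex only.\<close>
  have supersets: "J = K \<or> (\<exists>j\<in>wall_ext (facets \<Delta>) K. J = insert j K)" if J: "J \<in> faces \<Delta>" "K \<subseteq> J" for J
  proof (cases "J = K")
    case False
    then obtain j where j: "j \<in> J" "j \<notin> K" using J(2) by blast
    have "card (insert j K) = fan_dim \<Delta>" using j(2) finK cardK by simp
    moreover have "insert j K \<subseteq> J" "card J \<le> fan_dim \<Delta>" "finite J"
      using j J card_face_le[OF facts J(1)] finite_face[OF facts J(1)] by auto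
    ultimately have "J = insert j K" by (metis card_seteq)
    then show ?thesis using j J(1) \<open>card (insert j K) = fan_dim \<Delta>\<close>
      by (auto simp: wall_ext_def facets_iff[OF facts])
  qed simp
  have dim_ext: "dim (cone_of ?P (insert j K)) = 1" if j: "j \<in> wall_ext (facets \<Delta>) K" for j
  proof -
    have j': "j \<notin> K" "insert j K \<in> faces \<Delta>" "insert j K \<in> facets \<Delta>"
      using j facets_iff[OF facts] by (auto simp: wall_ext_def)
    have "span (cone_of ?P (insert j K)) = span {\<nu>}"
    proof
      show "span (cone_of ?P (insert j K)) \<subseteq> span {\<nu>}"
        by (rule span_minimal) (auto simp: cone_ext[OF j'(1,2)] intro: span_scale span_base)
      have "(1 * (\<phi> \<bullet> ?r j)) *\<^sub>R \<nu> \<in> cone_of ?P (insert j K)"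
        unfolding cone_ext[OF j'(1,2)] by (intro CollectI exI[of _ 1]) simp
      then have "(1 / (\<phi> \<bullet> ?r j)) *\<^sub>R (1 * (\<phi> \<bullet> ?r j)) *\<^sub>R \<nu> \<in> span (cone_of ?P (insert j K))"
        by (intro span_scale span_base)
      then have "\<nu> \<in> span (cone_of ?P (insert j K))" using \<phi>r[OF j'(1,3)] by simp
      then show "span {\<nu>} \<subseteq> span (cone_of ?P (insert j K))" by (intro span_minimal) auto
    qed
    then have "dim (cone_of ?P (insert j K)) = dim {\<nu>}" by (metis dim_span)
    then show ?thesis using \<nu>0 by simp
  qed
  have dimK: "dim (cone_of ?P K) = 0" using coneK by (simp add: dim_eq_0)
  have facetsP: "facets ?P = (\<lambda>j. insert j K) ` wall_ext (facets \<Delta>) K"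
  proof (intro equalityI subsetI)
    fix J assume "J \<in> facets ?P"
    then have J: "J \<in> faces \<Delta>" "K \<subseteq> J" "dim (cone_of ?P J) = 1"
      by (auto simp: faces_dim_def facesP dimP)
    have "J \<noteq> K"
    proof
      assume "J = K"
      then have "dim (cone_of ?P K) = 1" using J(3) by (simp only:)
      then show False using dimK by linarith
    qed
    then show "J \<in> (\<lambda>j. insert j K) ` wall_ext (facets \<Delta>) K" using supersets[OF J(1,2)] by auto
  next
    fix J assume "J \<in> (\<lambda>j. insert j K) ` wall_ext (facets \<Delta>) K"
    then obtain j where j: "j \<in> wall_ext (facets \<Delta>) K" "J = insert j K" by blast
    then show "J \<in> facets ?P"
      using dim_ext[OF j(1)] facets_iff[OF facts] by (auto simp: faces_dim_def facesP dimP wall_ext_def)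
  qed
  have gen: "generic ?P (s *\<^sub>R \<nu>)" if "s \<noteq> 0" for s
    unfolding generic_def dimP
  proof (intro conjI ballI impI)
    show "s *\<^sub>R \<nu> \<in> span (lat ?P)" using \<nu>lat by (intro span_scale span_base)
    fix J assume J: "J \<in> faces ?P" "dim (cone_of ?P J) < 1"
    then have "cone_of ?P J \<subseteq> {0}" by (simp add: dim_eq_0)
    then have "span (cone_of ?P J) \<subseteq> {0}" by (metis span_0 span_mono span_empty span_insert_0)
    then show "s *\<^sub>R \<nu> \<notin> span (cone_of ?P J)" using that \<nu>0 by auto
  qed
  have deg: "deg_at ?P (s *\<^sub>R \<nu>) = (\<Sum>j\<in>wall_ext (facets \<Delta>) K. if s * (\<phi> \<bullet> ?r j) > 0 then weight \<Delta> (insert j K) else 0)"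
    if s: "s \<noteq> 0" for s
  proof -
    have inj: "inj_on (\<lambda>j. insert j K) (wall_ext (facets \<Delta>) K)"
      by (auto simp: inj_on_def wall_ext_def)
    then have fin: "finite (wall_ext (facets \<Delta>) K)"
    proof (rule inj_on_finite)
      show "(\<lambda>j. insert j K) ` wall_ext (facets \<Delta>) K \<subseteq> facets \<Delta>" by (auto simp: wall_ext_def)
    qed (rule bases.finite_Fac)
    have w: "weight ?P = weight \<Delta>" by (simp add: weight_def projected_def fun_eq_iff)
    have mem: "s *\<^sub>R \<nu> \<in> cone_of ?P (insert j K) \<longleftrightarrow> s * (\<phi> \<bullet> ?r j) > 0"
      if j: "j \<in> wall_ext (facets \<Delta>) K" for j
    proof -
      have j': "j \<notin> K" "insert j K \<in> faces \<Delta>" "insert j K \<in> facets \<Delta>"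
        using j facets_iff[OF facts] by (auto simp: wall_ext_def)
      have "s *\<^sub>R \<nu> \<in> cone_of ?P (insert j K) \<longleftrightarrow> (\<exists>c\<ge>0. s = c * (\<phi> \<bullet> ?r j))"
        unfolding cone_ext[OF j'(1,2)] using \<nu>0 by auto
      also have "\<dots> \<longleftrightarrow> s * (\<phi> \<bullet> ?r j) > 0"
      proof
        assume "\<exists>c\<ge>0. s = c * (\<phi> \<bullet> ?r j)"
        then obtain c where c: "c \<ge> 0" "s = c * (\<phi> \<bullet> ?r j)" by blast
        then have "c > 0" using s by (auto simp: less_eq_real_def)
        moreover have "0 < (\<phi> \<bullet> ?r j) * (\<phi> \<bullet> ?r j)"
          using \<phi>r[OF j'(1,3)] not_real_square_gt_zero by blast
        ultimately show "s * (\<phi> \<bullet> ?r j) > 0" unfolding c(2) mult.assoc by (rule mult_pos_pos)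
      next
        assume pos: "s * (\<phi> \<bullet> ?r j) > 0"
        then have "s / (\<phi> \<bullet> ?r j) \<ge> 0" by (auto simp: zero_less_mult_iff zero_le_divide_iff)
        then show "\<exists>c\<ge>0. s = c * (\<phi> \<bullet> ?r j)"
          using \<phi>r[OF j'(1,3)] by (intro exI[of _ "s / (\<phi> \<bullet> ?r j)"]) auto
      qed
      finally show ?thesis .
    qed
    have "{J. J \<in> facets ?P \<and> s *\<^sub>R \<nu> \<in> cone_of ?P J} =
        (\<lambda>j. insert j K) ` {j \<in> wall_ext (facets \<Delta>) K. s * (\<phi> \<bullet> ?r j) > 0}"
      unfolding facetsP using mem by auto
    then have "deg_at ?P (s *\<^sub>R \<nu>) =
        (\<Sum>j\<in>{j \<in> wall_ext (facets \<Delta>) K. s * (\<phi> \<bullet> ?r j) > 0}. weight \<Delta> (insert j K))"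
      unfolding deg_at_def w by (simp add: sum.reindex inj_on_subset[OF inj])
    also have "\<dots> = (\<Sum>j\<in>wall_ext (facets \<Delta>) K. if s * (\<phi> \<bullet> ?r j) > 0 then weight \<Delta> (insert j K) else 0)"
      using fin by (rule sum.inter_filter)
    finally show ?thesis .
  qed
  have neg: "- 1 \<noteq> (0 :: real)" by simp
  have "pre_complete ?P" using complete Kface by (simp add: complete_fan_def)
  then have "deg_at ?P (1 *\<^sub>R \<nu>) = deg_at ?P ((- 1) *\<^sub>R \<nu>)"
    using gen[of 1, OF one_neq_zero] gen[of "- 1", OF neg] unfolding pre_complete_def by blast
  then have "0 = real_of_int (deg_at ?P (1 *\<^sub>R \<nu>) - deg_at ?P ((- 1) *\<^sub>R \<nu>))" by simp
  also have "\<dots> = (\<Sum>j\<in>wall_ext (facets \<Delta>) K. of_int (weight \<Delta> (insert j K)) * sgn (\<phi> \<bullet> ?r j))"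
    unfolding deg[of 1, OF one_neq_zero] deg[of "- 1", OF neg] sum_subtractf[symmetric] of_int_sum
    by (intro sum.cong) (auto simp: sgn_real_def)
  finally show ?thesis by (simp add: \<phi>_def)
qed

text \<open>All forms around the wall are multiples of \<open>dual_vec \<Delta> I i\<close>. The
  sign at z is therefore the sign of this form at \<open>ray_vec \<Delta> j\<close> times its sign
  at z, and the latter is a common factor of the sum.\<close>

lemma balanced_fan_fan:
  "balanced_fan (lat \<Delta>) (ray_vec \<Delta>) (facets \<Delta>) (dual_vec \<Delta>) (fan_dim \<Delta>) (weight \<Delta>)"
proof unfold_locales
  fix I i z assume I: "I \<in> facets \<Delta>" "i \<in> I" and z: "z \<in> span (lat \<Delta>)"
  let ?K = "I - {i}"
  have "sgn (dual_vec \<Delta> (insert j ?K) j \<bullet> z) =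
      sgn (dual_vec \<Delta> I i \<bullet> ray_vec \<Delta> j) * sgn (dual_vec \<Delta> I i \<bullet> z)"
    if j: "j \<in> wall_ext (facets \<Delta>) ?K" for j
  proof -
    have j': "insert j ?K \<in> facets \<Delta>" "?K = insert j ?K - {j}" using j by (auto simp: wall_ext_def)
    note proportional = bases.wall_proportional[OF I j'(1) insertI1 j'(2) z]
    show ?thesis
      unfolding proportional(1) sgn_mult using proportional(2) by (simp add: sgn_real_def)
  qed
  then have "(\<Sum>j\<in>wall_ext (facets \<Delta>) ?K. of_int (weight \<Delta> (insert j ?K)) *
        sgn (dual_vec \<Delta> (insert j ?K) j \<bullet> z)) =
      (\<Sum>j\<in>wall_ext (facets \<Delta>) ?K. of_int (weight \<Delta> (insert j ?K)) *
        sgn (dual_vec \<Delta> I i \<bullet> ray_vec \<Delta> j)) * sgn (dual_vec \<Delta> I i \<bullet> z)"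
    unfolding sum_distrib_right by (intro sum.cong) (auto simp: mult_ac)
  then show "(\<Sum>j\<in>wall_ext (facets \<Delta>) ?K. of_int (weight \<Delta> (insert j ?K)) *
        sgn (dual_vec \<Delta> (insert j ?K) j \<bullet> z)) = 0"
    using wall_weights[OF I] by simp
qed

end

section \<open>Vertices\<close>

context
  fixes \<Delta> :: "('a::euclidean_space, nat set) multi_fan" and F :: "nat set \<Rightarrow> 'a set" and v :: 'a
  assumes polytope: "simple_multi_polytope \<Delta> F" and lattice_polytope: "lattice_multi_polytope \<Delta> F"
    and generic_v: "generic \<Delta> v"
begin

lemma fan_facts: "complete_fan \<Delta>" "simplicial_fan \<Delta>" "is_multi_fan \<Delta>"
  using polytope by (auto simp: simple_multi_polytope_def multi_polytope_def complete_fan_def)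

interpretation balanced_fan "lat \<Delta>" "ray_vec \<Delta>" "facets \<Delta>" "dual_vec \<Delta>" "fan_dim \<Delta>" "weight \<Delta>"
  by (rule balanced_fan_fan[OF fan_facts(1,2)])

text \<open>Moving inside the hyperplane by x, the component of the ray vector orthogonal to the
  normal a, must not change the pairing with the ray vector. So x . x = 0 and the ray vector is a
  multiple of a.\<close>

lemma hyperplane_offset:
  assumes i: "i \<in> {1..nrays \<Delta>}"
  shows "F {i} = {u \<in> span (lat \<Delta>). u \<bullet> ray_vec \<Delta> i = offset \<Delta> F i}"
proof -
  let ?r = "ray_vec \<Delta> i" and ?V = "span (lat \<Delta>)"
  note ray = ray_vec_facts[OF fan_facts(3,2) i]
  have rV: "?r \<in> ?V" using ray(1) span_base by blast
  have mem: "{i} \<in> faces_dim \<Delta> 1" using faces_dim_1[OF fan_facts(3,2)] i by blast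
  then obtain a c where a: "a \<in> ?V" "a \<noteq> 0" "F {i} = {u \<in> ?V. u \<bullet> a = c}"
    using polytope unfolding simple_multi_polytope_def multi_polytope_def affine_hyperplane_def by blast
  have "?r \<in> cone_of \<Delta> {i}" unfolding ray(3) by (intro nonneg_hull_mem) auto
  then obtain e where e: "\<And>u. u \<in> F {i} \<Longrightarrow> u \<bullet> ?r = e"
    using polytope mem unfolding simple_multi_polytope_def multi_polytope_def by blast
  define u0 where "u0 = (c / (a \<bullet> a)) *\<^sub>R a"
  have u0: "u0 \<in> F {i}" using a by (simp add: u0_def span_scale)
  define \<mu> where "\<mu> = (?r \<bullet> a) / (a \<bullet> a)"
  define x where "x = ?r - \<mu> *\<^sub>R a"
  have xa: "x \<bullet> a = 0" using a(2) by (simp add: x_def \<mu>_def inner_diff_left)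
  have xV: "x \<in> ?V" using rV a(1) by (simp add: x_def span_diff span_scale)
  have "u0 + x \<in> F {i}" using u0 xa xV a(3) by (simp add: inner_add_left span_add)
  then have "x \<bullet> ?r = 0" using e[of "u0 + x"] e[OF u0] by (simp add: inner_add_left)
  then have "x \<bullet> x = 0" using xa by (simp add: x_def inner_diff_right)
  then have r: "?r = \<mu> *\<^sub>R a" by (simp add: x_def)
  then have \<mu>0: "\<mu> \<noteq> 0" using ray(2) by auto
  have eq: "F {i} = {u \<in> ?V. u \<bullet> ?r = \<mu> * c}" unfolding a(3) using \<mu>0 by (auto simp: r)
  show ?thesis
    unfolding offset_def
  proof (rule theI)
    show "F {i} = {u \<in> ?V. u \<bullet> ?r = \<mu> * c}" by (rule eq)
    fix b assume b: "F {i} = {u \<in> ?V. u \<bullet> ?r = b}"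
    have "u0 \<bullet> ?r = \<mu> * c" using u0 eq by blast
    moreover have "u0 \<bullet> ?r = b" using u0 b by blast
    ultimately show "b = \<mu> * c" by simp
  qed
qed

lemma facet_rays: "I \<in> facets \<Delta> \<Longrightarrow> i \<in> I \<Longrightarrow> i \<in> {1..nrays \<Delta>}"
  using facets_iff[OF fan_facts(3,2)] face_subset_rays[OF fan_facts(3,2)] by blast

text \<open>Uniqueness is stated for arbitrary hyperplanes \<open>G\<close> with these normals
  because it serves the given polytope and the shifted one.\<close>

lemma vertex_facts:
  assumes I: "I \<in> facets \<Delta>"
  shows "vertex \<Delta> F I \<in> span (lat \<Delta>)" "\<And>i. i \<in> I \<Longrightarrow> vertex \<Delta> F I \<bullet> ray_vec \<Delta> i = offset \<Delta> F i"
    and "\<And>G c x. (\<And>i. i \<in> I \<Longrightarrow> G {i} = {u \<in> span (lat \<Delta>). u \<bullet> ray_vec \<Delta> i = c i}) \<Longrightarrow>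
      x \<in> span (lat \<Delta>) \<Longrightarrow> (\<And>i. i \<in> I \<Longrightarrow> x \<bullet> ray_vec \<Delta> i = c i) \<Longrightarrow> vertex \<Delta> G I = x"
proof -
  show unique: "vertex \<Delta> G I = x"
    if "\<And>i. i \<in> I \<Longrightarrow> G {i} = {u \<in> span (lat \<Delta>). u \<bullet> ray_vec \<Delta> i = c i}"
      "x \<in> span (lat \<Delta>)" "\<And>i. i \<in> I \<Longrightarrow> x \<bullet> ray_vec \<Delta> i = c i" for G c x
    unfolding vertex_def
  proof (rule the_equality)
    fix y assume "y \<in> span (lat \<Delta>) \<and> (\<forall>i\<in>I. y \<in> G {i})"
    then show "y = x" using that by (intro span_inner_eqI[OF I]) auto
  qed (use that in auto)
  define x where "x = (\<Sum>i\<in>I. offset \<Delta> F i *\<^sub>R dual_vec \<Delta> I i)"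
  have xr: "x \<bullet> ray_vec \<Delta> i = offset \<Delta> F i" if "i \<in> I" for i
  proof -
    have "x \<bullet> ray_vec \<Delta> i = (\<Sum>j\<in>I. if j = i then offset \<Delta> F i else 0)"
      unfolding x_def inner_sum_left using dual[OF I _ that] by (intro sum.cong) auto
    then show ?thesis using that finite_facet[OF I] by simp
  qed
  have xV: "x \<in> span (lat \<Delta>)" unfolding x_def by (intro span_sum span_scale dual_mem[OF I])
  have "vertex \<Delta> F I = x" by (rule unique[OF hyperplane_offset[OF facet_rays[OF I]] xV xr])
  then show "vertex \<Delta> F I \<in> span (lat \<Delta>)"
    "\<And>i. i \<in> I \<Longrightarrow> vertex \<Delta> F I \<bullet> ray_vec \<Delta> i = offset \<Delta> F i"
    using xr xV by auto
qed

text \<open>A vanishing coordinate would put v into the span of the wall I - {i}, a cone of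
  dimension less than n.\<close>

lemma generic_gen: "gen v"
proof -
  note facts = fan_facts(3,2)
  have "dual_vec \<Delta> I i \<bullet> v \<noteq> 0" if I: "I \<in> facets \<Delta>" "i \<in> I" for I i
  proof
    assume 0: "dual_vec \<Delta> I i \<bullet> v = 0"
    let ?K = "I - {i}"
    have I': "I \<in> faces \<Delta>" "card I = fan_dim \<Delta>" using facets_iff[OF facts] I by auto
    have K: "?K \<in> faces \<Delta>" using faces_subset[OF facts I'(1)] by simp
    have "card ?K < fan_dim \<Delta>" using I' I(2) finite_facet[OF I(1)] by (metis card_Diff1_less)
    then have "v \<notin> span (cone_of \<Delta> ?K)"
      using generic_v K dim_cone[OF facts K] by (auto simp: generic_def)
    moreover have "v = (\<Sum>k\<in>I. (dual_vec \<Delta> I k \<bullet> v) *\<^sub>R ray_vec \<Delta> k)"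
      using generic_v by (intro expand[OF I(1)]) (auto simp: generic_def)
    then have "v = (\<Sum>k\<in>?K. (dual_vec \<Delta> I k \<bullet> v) *\<^sub>R ray_vec \<Delta> k)"
      using 0 by (simp add: sum.remove[OF finite_facet[OF I(1)] I(2)])
    then have "v \<in> span (ray_vec \<Delta> ` ?K)"
      by (metis (no_types, lifting) imageI span_base span_scale span_sum)
    ultimately show False using span_cone[OF facts K] by simp
  qed
  then show ?thesis using generic_v by (auto simp: gen_def forms_def generic_def)
qed

lemma lattice_vertices_fan:
  "lattice_vertices (lat \<Delta>) (ray_vec \<Delta>) (facets \<Delta>) (dual_vec \<Delta>) (fan_dim \<Delta>) (weight \<Delta>)
    (offset \<Delta> F) (vertex \<Delta> F) v"
  by unfold_locales
    (use lattice_polytope vertex_facts generic_gen in \<open>auto simp: lattice_multi_polytope_def\<close>)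

interpretation lattice_vertices "lat \<Delta>" "ray_vec \<Delta>" "facets \<Delta>" "dual_vec \<Delta>" "fan_dim \<Delta>"
    "weight \<Delta>" "offset \<Delta> F" "vertex \<Delta> F" v
  by (rule lattice_vertices_fan)

text \<open>In the dual basis, membership in the flipped cone is one sign condition per i. As q . r
  i and the offset are integers, any \<epsilon> strictly between 0 and 1 leads to the inequalities
  of \<open>in_cone\<close>.\<close>

lemma DH_shifted:
  assumes q: "q \<in> dual_lattice (lat \<Delta>)" and \<epsilon>: "0 < \<epsilon>" "\<epsilon> < 1"
  shows "DH \<Delta> (shifted \<Delta> F \<epsilon>) v q = count q"
proof -
  have qV: "q \<in> span (lat \<Delta>)" using q by (simp add: dual_lattice_def)
  have "indicator ((\<lambda>x. vertex \<Delta> (shifted \<Delta> F \<epsilon>) I + x) ` nonneg_hull (dual_vec_plus \<Delta> v I ` I)) q =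
      (of_bool (in_cone I q) :: int)" if I: "I \<in> facets \<Delta>" for I
  proof -
    let ?r = "ray_vec \<Delta>" and ?u = "dual_vec \<Delta> I" and ?p = "vertex \<Delta> (shifted \<Delta> F \<epsilon>) I"
    define \<sigma> where "\<sigma> i = (if i \<in> pos I then 1 else - 1 :: real)" for i
    have plus: "dual_vec_plus \<Delta> v I i = \<sigma> i *\<^sub>R ?u i" if "i \<in> I" for i
      using that by (simp add: dual_vec_plus_def \<sigma>_def pos_def)
    define x where "x = (\<Sum>i\<in>I. (offset \<Delta> F i + \<epsilon>) *\<^sub>R ?u i)"
    have sum_r: "(\<Sum>j\<in>I. c j *\<^sub>R ?u j) \<bullet> ?r i = c i" if "i \<in> I" for c i
    proof -
      have "(\<Sum>j\<in>I. c j *\<^sub>R ?u j) \<bullet> ?r i = (\<Sum>j\<in>I. if j = i then c i else 0)"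
        unfolding inner_sum_left using dual[OF I _ that] by (intro sum.cong) auto
      then show ?thesis using that finite_facet[OF I] by simp
    qed
    have sumV: "(\<Sum>j\<in>I. c j *\<^sub>R ?u j) \<in> span (lat \<Delta>)" for c
      by (intro span_sum span_scale dual_mem[OF I])
    have "?p = x"
      by (rule vertex_facts(3)[OF I, where c = "\<lambda>i. offset \<Delta> F i + \<epsilon>"])
        (auto simp: shifted_def x_def sum_r sumV)
    then have p: "?p \<in> span (lat \<Delta>)" "\<And>i. i \<in> I \<Longrightarrow> ?p \<bullet> ?r i = offset \<Delta> F i + \<epsilon>"
      by (auto simp: x_def sum_r sumV)
    have inj: "inj_on (dual_vec_plus \<Delta> v I) I"
    proof (rule inj_onI)
      fix i j assume ij: "i \<in> I" "j \<in> I" "dual_vec_plus \<Delta> v I i = dual_vec_plus \<Delta> v I j"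
      then have "(\<sigma> i *\<^sub>R ?u i) \<bullet> ?r i = (\<sigma> j *\<^sub>R ?u j) \<bullet> ?r i" by (simp add: plus)
      then show "i = j" using dual[OF I ij(1) ij(1)] dual[OF I ij(2) ij(1)]
        by (auto simp: \<sigma>_def split: if_splits)
    qed
    have hull: "y \<in> nonneg_hull (dual_vec_plus \<Delta> v I ` I) \<longleftrightarrow> (\<forall>i\<in>I. 0 \<le> \<sigma> i * (y \<bullet> ?r i))"
      if y: "y \<in> span (lat \<Delta>)" for y
    proof
      assume "y \<in> nonneg_hull (dual_vec_plus \<Delta> v I ` I)"
      then obtain c where c: "\<forall>s\<in>dual_vec_plus \<Delta> v I ` I. 0 \<le> c s"
        "y = (\<Sum>s\<in>dual_vec_plus \<Delta> v I ` I. c s *\<^sub>R s)" by (auto simp: nonneg_hull_iff)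
      have "y = (\<Sum>i\<in>I. (c (dual_vec_plus \<Delta> v I i) * \<sigma> i) *\<^sub>R ?u i)"
        unfolding c(2) sum.reindex[OF inj] by (intro sum.cong) (auto simp: plus)
      then have "y \<bullet> ?r i = c (dual_vec_plus \<Delta> v I i) * \<sigma> i" if "i \<in> I" for i
        using sum_r[OF that] by simp
      then show "\<forall>i\<in>I. 0 \<le> \<sigma> i * (y \<bullet> ?r i)" using c(1) by (auto simp: \<sigma>_def)
    next
      assume nn: "\<forall>i\<in>I. 0 \<le> \<sigma> i * (y \<bullet> ?r i)"
      have "y = (\<Sum>i\<in>I. (y \<bullet> ?r i) *\<^sub>R ?u i)"
        by (rule span_inner_eqI[OF I y sumV]) (simp add: sum_r)
      also have "\<dots> = (\<Sum>i\<in>I. (\<sigma> i * (y \<bullet> ?r i)) *\<^sub>R dual_vec_plus \<Delta> v I i)"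
        by (intro sum.cong) (auto simp: plus \<sigma>_def)
      also have "\<dots> \<in> nonneg_hull (dual_vec_plus \<Delta> v I ` I)"
        using nn finite_facet[OF I]
        by (intro nonneg_hull_sum nonneg_hull_scale[OF nonneg_hull_mem]) auto
      finally show "y \<in> nonneg_hull (dual_vec_plus \<Delta> v I ` I)" .
    qed
    have "q \<in> (\<lambda>x. ?p + x) ` nonneg_hull (dual_vec_plus \<Delta> v I ` I) \<longleftrightarrow>
        q - ?p \<in> nonneg_hull (dual_vec_plus \<Delta> v I ` I)"
      by (auto simp: image_iff intro: bexI[of _ "q - ?p"])
    also have "\<dots> \<longleftrightarrow> (\<forall>i\<in>I. 0 \<le> \<sigma> i * (q \<bullet> ?r i - offset \<Delta> F i - \<epsilon>))"
      by (subst hull) (auto simp: span_diff qV p inner_diff_left diff_diff_eq)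
    also have "\<dots> \<longleftrightarrow> in_cone I q"
      unfolding in_cone_def
    proof (rule ball_cong[OF refl])
      fix i assume i: "i \<in> I"
      obtain a b where ab: "q \<bullet> ?r i = of_int a" "offset \<Delta> F i = of_int b"
        using inner_ray_Ints[OF I i q] c_Ints[OF I i] by (auto elim!: Ints_cases)
      have "a \<le> b \<or> b + 1 \<le> a" by linarith
      then have "q \<bullet> ?r i \<le> offset \<Delta> F i \<or> offset \<Delta> F i + 1 \<le> q \<bullet> ?r i"
        unfolding ab by (metis of_int_1 of_int_add of_int_le_iff)
      then show "(0 \<le> \<sigma> i * (q \<bullet> ?r i - offset \<Delta> F i - \<epsilon>)) =
          (if i \<in> pos I then offset \<Delta> F i + 1 \<le> q \<bullet> ?r i else q \<bullet> ?r i \<le> offset \<Delta> F i)"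
        using \<epsilon> by (auto simp: \<sigma>_def)
    qed
    finally show ?thesis by (simp add: indicator_def)
  qed
  then show ?thesis unfolding DH_def count_def by (intro sum.cong) (auto simp: pos_def)
qed

lemma sharp_count:
  "sharp \<Delta> F v = (\<Sum>q | q \<in> dual_lattice (lat \<Delta>) \<and> count q \<noteq> 0. count q)"
proof -
  let ?S = "{q \<in> dual_lattice (lat \<Delta>). count q \<noteq> 0}"
  have eq: "(\<Sum>\<^sub>\<infinity>q\<in>dual_lattice (lat \<Delta>). DH \<Delta> (shifted \<Delta> F \<epsilon>) v q) = (\<Sum>q\<in>?S. count q)"
    if "0 < \<epsilon>" "\<epsilon> < 1" for \<epsilon>
  proof -
    have "(\<Sum>\<^sub>\<infinity>q\<in>dual_lattice (lat \<Delta>). DH \<Delta> (shifted \<Delta> F \<epsilon>) v q) = (\<Sum>\<^sub>\<infinity>q\<in>?S. count q)"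
      by (rule infsum_cong_neutral) (auto simp: DH_shifted[OF _ that])
    then show ?thesis using finite_support by simp
  qed
  have ev: "\<forall>\<^sub>F \<epsilon> in at_right (0::real). 0 < \<epsilon> \<and> \<epsilon> < 1"
    using eventually_at_right_real[OF zero_less_one] by eventually_elim auto
  show ?thesis
    unfolding sharp_def
  proof (rule the_equality)
    show "\<forall>\<^sub>F \<epsilon> in at_right 0. (\<Sum>q\<in>?S. count q) =
        (\<Sum>\<^sub>\<infinity>q\<in>dual_lattice (lat \<Delta>). DH \<Delta> (shifted \<Delta> F \<epsilon>) v q)"
      using ev by eventually_elim (use eq in auto)
    fix m assume "\<forall>\<^sub>F \<epsilon> in at_right 0. m = (\<Sum>\<^sub>\<infinity>q\<in>dual_lattice (lat \<Delta>). DH \<Delta> (shifted \<Delta> F \<epsilon>) v q)"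
    with ev have "\<forall>\<^sub>F \<epsilon> in at_right (0::real). m = (\<Sum>q\<in>?S. count q)"
      by eventually_elim (use eq in auto)
    then show "m = (\<Sum>q\<in>?S. count q)" by (simp add: trivial_limit_at_right_real)
  qed
qed

end

section \<open>The index map\<close>

text \<open>Elements all of whose multiples are killed by an additive map form an ideal, so such a
  map vanishes on a generated ideal once it kills the multiples of the generators. Applied to
  evaluation on \<open>SR_ideal \<Delta>\<close> and to the index at the origin on
  \<open>lin_ideal \<Delta>\<close>.\<close>

lemma (in cring) annihilator_ideal:
  fixes \<phi> :: "'a \<Rightarrow> 'c::ab_group_add"
  assumes add: "\<And>a b. a \<in> carrier R \<Longrightarrow> b \<in> carrier R \<Longrightarrow> \<phi> (a \<oplus> b) = \<phi> a + \<phi> b"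
  shows "ideal {a \<in> carrier R. \<forall>b\<in>carrier R. \<phi> (a \<otimes> b) = 0} R"
proof (rule idealI)
  have \<phi>0: "\<phi> \<zero> = 0" using add[of \<zero> \<zero>] by simp
  have \<phi>neg: "\<phi> (\<ominus> a) = - \<phi> a" if "a \<in> carrier R" for a
    using add[of a "\<ominus> a"] that \<phi>0 by (simp add: r_neg add_eq_0_iff)
  show "ring R" by (rule ring_axioms)
  show "subgroup {a \<in> carrier R. \<forall>b\<in>carrier R. \<phi> (a \<otimes> b) = 0} (add_monoid R)"
  proof (rule group.subgroupI)
    show "Group.group (add_monoid R)" by (rule a_group)
    show "{a \<in> carrier R. \<forall>b\<in>carrier R. \<phi> (a \<otimes> b) = 0} \<noteq> {}" using \<phi>0 by (auto intro!: exI[of _ \<zero>])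
    fix a b assume a: "a \<in> {a \<in> carrier R. \<forall>b\<in>carrier R. \<phi> (a \<otimes> b) = 0}"
    then have "\<ominus> a \<in> {a \<in> carrier R. \<forall>b\<in>carrier R. \<phi> (a \<otimes> b) = 0}"
      by (auto simp: l_minus \<phi>neg)
    then show "inv\<^bsub>add_monoid R\<^esub> a \<in> {a \<in> carrier R. \<forall>b\<in>carrier R. \<phi> (a \<otimes> b) = 0}"
      by (simp add: a_inv_def)
    assume "b \<in> {a \<in> carrier R. \<forall>b\<in>carrier R. \<phi> (a \<otimes> b) = 0}"
    with a show "a \<otimes>\<^bsub>add_monoid R\<^esub> b \<in> {a \<in> carrier R. \<forall>b\<in>carrier R. \<phi> (a \<otimes> b) = 0}"
      by (auto simp: l_distr add)
  qed auto
  fix a x assume "a \<in> {a \<in> carrier R. \<forall>b\<in>carrier R. \<phi> (a \<otimes> b) = 0}" and x: "x \<in> carrier R"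
  then have a: "a \<in> carrier R" "\<And>b. b \<in> carrier R \<Longrightarrow> \<phi> (a \<otimes> b) = 0" by auto
  then show "a \<otimes> x \<in> {a \<in> carrier R. \<forall>b\<in>carrier R. \<phi> (a \<otimes> b) = 0}"
    using x by (auto simp: m_assoc)
  then show "x \<otimes> a \<in> {a \<in> carrier R. \<forall>b\<in>carrier R. \<phi> (a \<otimes> b) = 0}"
    using x a by (simp add: m_comm)
qed

context
  fixes \<Delta> :: "('a::euclidean_space, nat set) multi_fan" and F :: "nat set \<Rightarrow> 'a set" and v :: 'a
  assumes polytope: "simple_multi_polytope \<Delta> F" and lattice_polytope: "lattice_multi_polytope \<Delta> F"
    and generic_v: "generic \<Delta> v"
begin

interpretation lattice_vertices "lat \<Delta>" "ray_vec \<Delta>" "facets \<Delta>" "dual_vec \<Delta>" "fan_dim \<Delta>"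
    "weight \<Delta>" "offset \<Delta> F" "vertex \<Delta> F" v
  by (rule lattice_vertices_fan[OF polytope lattice_polytope generic_v])

interpretation HT: cring "HT \<Delta>" by (rule cring_HT)

section \<open>Well-definedness of the index map and of the integral\<close>

definition yc :: "nat set \<Rightarrow> 'a \<Rightarrow> nat \<Rightarrow> complex" where
  "yc I x = (\<lambda>i. complex_of_real (y I x i))"

lemma facet_sub: "I \<in> facets \<Delta> \<Longrightarrow> I \<subseteq> {1..nrays \<Delta>}"
  using facet_rays[OF polytope lattice_polytope generic_v] by blast

text \<open>A non-face J is not contained in the face I, so the monomial x_J contains a variable
  that is sent to 0.\<close>

lemma SR_ideal_eval:
  assumes s: "s \<in> SR_ideal \<Delta>" and I: "I \<in> facets \<Delta>"
  shows "mpoly_eval (yc I x) s = 0"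
proof -
  let ?R = "poly_ring (nrays \<Delta>)"
  interpret R: cring ?R by (rule cring_poly_ring)
  let ?A = "{a \<in> carrier ?R. \<forall>b\<in>carrier ?R. mpoly_eval (yc I x) (a \<otimes>\<^bsub>?R\<^esub> b) = 0}"
  have ideal: "ideal ?A ?R" by (rule R.annihilator_ideal) (simp add: mpoly_eval_add)
  have "{\<Prod>i\<in>J. mvar i | J. J \<subseteq> {1..nrays \<Delta>} \<and> J \<notin> faces \<Delta>} \<subseteq> ?A"
  proof safe
    fix J assume J: "J \<subseteq> {1..nrays \<Delta>}" "J \<notin> faces \<Delta>"
    show "(\<Prod>i\<in>J. mvar i) \<in> carrier ?R" using J(1) by (intro carrier_poly_ring_prod carrier_poly_ring_var) auto
    have "I \<in> faces \<Delta>" using I by (simp add: faces_dim_def)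
    then have "\<not> J \<subseteq> I" using J(2) faces_subset[OF fan_facts(3,2)[OF polytope lattice_polytope generic_v]] by blast
    then obtain i where "i \<in> J" "i \<notin> I" by blast
    then have "(\<Prod>i\<in>J. yc I x i) = 0"
      using finite_subset[OF J(1)] by (intro prod_zero) (auto simp: yc_def y_def)
    then show "mpoly_eval (yc I x) ((\<Prod>i\<in>J. mvar i) \<otimes>\<^bsub>?R\<^esub> b) = 0" for b
      by (simp add: mpoly_eval_mult mpoly_eval_prod)
  qed
  then have "SR_ideal \<Delta> \<subseteq> ?A"
    unfolding SR_ideal_def by (rule R.genideal_minimal[OF ideal])
  then have "mpoly_eval (yc I x) (s \<otimes>\<^bsub>?R\<^esub> \<one>\<^bsub>?R\<^esub>) = 0" using s R.one_closed by blast
  then show ?thesis by simp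
qed

lemma iota_class:
  assumes "I \<in> facets \<Delta>"
  shows "iota \<Delta> I (HT_class \<Delta> q) x = mpoly_eval (yc I x) q"
proof -
  have eq: "(\<lambda>i. if i \<in> I then complex_of_real (dual_vec \<Delta> I i \<bullet> x) else 0) = yc I x"
    by (auto simp: yc_def y_def)
  have "0 \<in> SR_ideal \<Delta>"
    using additive_subgroup.zero_closed[OF ideal.axioms(1)[OF ideal_SR[of \<Delta>]]] by simp
  then have "mpoly_eval (yc I x) ` HT_class \<Delta> q = {mpoly_eval (yc I x) q}"
    using SR_ideal_eval[OF _ assms]
    by (auto simp: HT_class_def a_r_coset_def' mpoly_eval_add image_iff intro!: exI[of _ q] bexI[of _ 0])
  then show ?thesis by (simp add: iota_def eq)
qed

text \<open>The rational function behind \<open>index_map\<close> on a representative, with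
  \<open>par I\<close> in place of \<open>GI \<Delta> I\<close>.\<close>

definition index_sum :: "mpoly \<Rightarrow> 'a \<Rightarrow> complex" where
  "index_sum q x = (\<Sum>I\<in>facets \<Delta>. of_int (weight \<Delta> I) * mpoly_eval (yc I x) q /
     (of_nat (card (par I)) * (\<Prod>i\<in>I. complex_of_real (dual_vec \<Delta> I i \<bullet> x))))"

lemma torus_class_mem: "a \<in> real_space d \<Longrightarrow> a \<in> torus_class d a"
  by (simp add: torus_class_def)

lemma torus_class_eqI:
  assumes "\<And>i. a i - b i \<in> \<int>" shows "torus_class d a = torus_class d b"
proof -
  have "c i - a i \<in> \<int> \<longleftrightarrow> c i - b i \<in> \<int>" for c i
    using assms[of i] Ints_add[of "c i - a i" "a i - b i"] Ints_diff[of "c i - b i" "a i - b i"] by auto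
  then show ?thesis by (auto simp: torus_class_def)
qed

lemma par_real_space: "I \<in> facets \<Delta> \<Longrightarrow> a \<in> par I \<Longrightarrow> a \<in> real_space (nrays \<Delta>)"
  using facet_sub[of I] unfolding par_def real_space_def by blast

lemma par_eqI:
  assumes "a \<in> par I" "b \<in> par J" "\<And>i. a i - b i \<in> \<int>"
  shows "a = b"
proof
  fix i
  have range: "0 \<le> c j \<and> c j < 1" if "c \<in> par J" for c J j
    using that unfolding par_def by (cases "j \<in> J") auto
  have "0 \<le> a i" "a i < 1" "0 \<le> b i" "b i < 1" using range assms(1,2) by blast+
  moreover obtain k where k: "a i - b i = of_int k" using assms(3)[of i] by (auto elim: Ints_cases)
  ultimately have "- 1 < real_of_int k" "real_of_int k < 1" by linarith+
  then have "k = 0" by linarith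
  then show "a i = b i" using k by simp
qed

lemma torus_class_inj:
  assumes "I \<in> facets \<Delta>" "J \<in> facets \<Delta>" "a \<in> par I" "b \<in> par J"
    "torus_class (nrays \<Delta>) a = torus_class (nrays \<Delta>) b"
  shows "a = b"
proof (rule par_eqI[OF assms(3,4)])
  have "a \<in> torus_class (nrays \<Delta>) b"
    using torus_class_mem[OF par_real_space[OF assms(1,3)]] assms(5) by simp
  then show "a i - b i \<in> \<int>" for i by (simp add: torus_class_def)
qed

lemma eta_eq: "I \<subseteq> {1..nrays \<Delta>} \<Longrightarrow> (\<And>i. i \<notin> I \<Longrightarrow> a i = 0) \<Longrightarrow> eta \<Delta> a = (\<Sum>i\<in>I. a i *\<^sub>R ray_vec \<Delta> i)"
  unfolding eta_def by (rule sum.mono_neutral_right) auto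

lemma GI_par:
  assumes I: "I \<in> facets \<Delta>"
  shows "GI \<Delta> I = torus_class (nrays \<Delta>) ` par I"
proof (intro equalityI subsetI)
  fix g assume "g \<in> GI \<Delta> I"
  then obtain a where a: "g = torus_class (nrays \<Delta>) a" "eta \<Delta> a \<in> lat \<Delta>" "\<And>j. j \<notin> I \<Longrightarrow> a j = 0"
    by (auto simp: GI_def)
  let ?b = "\<lambda>i. if i \<in> I then frac (a i) else 0"
  have "(\<Sum>i\<in>I. a i *\<^sub>R ray_vec \<Delta> i) \<in> lat \<Delta>" using a(2) eta_eq[OF facet_sub[OF I] a(3)] by simp
  then have "?b \<in> par I" by (rule par_reduce[OF I])
  moreover have "torus_class (nrays \<Delta>) a = torus_class (nrays \<Delta>) ?b"
    by (rule torus_class_eqI) (auto simp: frac_def a(3))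
  ultimately show "g \<in> torus_class (nrays \<Delta>) ` par I" using a(1) by blast
next
  fix g assume "g \<in> torus_class (nrays \<Delta>) ` par I"
  then obtain a where a: "g = torus_class (nrays \<Delta>) a" "a \<in> par I" by blast
  then have "\<And>j. j \<notin> I \<Longrightarrow> a j = 0" "(\<Sum>i\<in>I. a i *\<^sub>R ray_vec \<Delta> i) \<in> lat \<Delta>" by (auto simp: par_def)
  then show "g \<in> GI \<Delta> I"
    using eta_eq[OF facet_sub[OF I], of a] par_real_space[OF I a(2)] a(1) by (auto simp: GI_def)
qed

lemma card_GI:
  assumes I: "I \<in> facets \<Delta>" shows "card (GI \<Delta> I) = card (par I)"
  unfolding GI_par[OF I] by (intro card_image inj_onI) (rule torus_class_inj[OF I I])

lemma polynomial_function_eval: "polynomial_function (\<lambda>x. mpoly_eval (yc I x) q)"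
proof -
  have "polynomial_function (\<lambda>x. yc I x i)" for i
    by (cases "i \<in> I") (simp_all add: yc_def y_def polynomial_function_inner_complex)
  then show ?thesis
    unfolding mpoly_eval_def
    by (intro polynomial_function_csum polynomial_function_cmult polynomial_function_cprod
        polynomial_function_cpower polynomial_function_const)
qed

lemma polynomial_eq_of_gen:
  assumes "polynomial_function p" "polynomial_function q" "\<And>x. gen x \<Longrightarrow> p x = q x" "x \<in> span (lat \<Delta>)"
  shows "p x = (q x :: complex)"
proof (rule continuous_eq_on_dense[where f = p and g = q])
  show "isCont p x" "isCont q x" using assms(1,2) by (auto intro: isCont_polynomial_function)
  show "\<exists>y. dist y x < e \<and> p y = q y" if "e > 0" for e :: real
    using gen_dense[OF assms(4) that] assms(3) by blast
qed

text \<open>Existence in the definite description of \<open>index_map\<close> is the absence of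
  poles, uniqueness is the density of generic points.\<close>

lemma index_map_class:
  assumes q: "q \<in> carrier (poly_ring (nrays \<Delta>))"
  obtains p where "polynomial_function p" "\<And>x. gen x \<Longrightarrow> p x = index_sum q x"
    "\<And>x. x \<in> span (lat \<Delta>) \<Longrightarrow> index_map \<Delta> (HT_class \<Delta> q) x = p x"
proof -
  obtain p where p: "polynomial_function p" "\<And>x. gen x \<Longrightarrow> index_sum q x = p x"
    using index_sum_polynomial[of "\<lambda>c. mpoly_eval c q"] polynomial_function_eval[of _ q]
    unfolding index_sum_def yc_def by blast
  have gen_iff: "gen x \<longleftrightarrow> x \<in> span (lat \<Delta>) \<and> (\<forall>I\<in>facets \<Delta>. \<forall>i\<in>I. dual_vec \<Delta> I i \<bullet> x \<noteq> 0)" for x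
    by (auto simp: gen_def forms_def)
  have rhs: "(\<Sum>I\<in>facets \<Delta>. of_int (weight \<Delta> I) * iota \<Delta> I (HT_class \<Delta> q) x /
      (of_nat (card (GI \<Delta> I)) * (\<Prod>i\<in>I. complex_of_real (dual_vec \<Delta> I i \<bullet> x)))) = index_sum q x" for x
    unfolding index_sum_def by (intro sum.cong) (simp_all add: iota_class card_GI)
  have "index_map \<Delta> (HT_class \<Delta> q) = restrict p (span (lat \<Delta>))"
    unfolding index_map_def rhs
  proof (rule the_equality)
    show "restrict p (span (lat \<Delta>)) \<in> HBT (lat \<Delta>) \<and> (\<forall>x\<in>span (lat \<Delta>).
        (\<forall>I\<in>facets \<Delta>. \<forall>i\<in>I. dual_vec \<Delta> I i \<bullet> x \<noteq> 0) \<longrightarrow> restrict p (span (lat \<Delta>)) x = index_sum q x)"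
      using p by (auto simp: HBT_def gen_iff)
    fix f assume f: "f \<in> HBT (lat \<Delta>) \<and> (\<forall>x\<in>span (lat \<Delta>).
        (\<forall>I\<in>facets \<Delta>. \<forall>i\<in>I. dual_vec \<Delta> I i \<bullet> x \<noteq> 0) \<longrightarrow> f x = index_sum q x)"
    then obtain p' where p': "f = restrict p' (span (lat \<Delta>))" "polynomial_function p'" by (auto simp: HBT_def)
    then have "p' x = p x" if "gen x" for x using f p(2) that by (auto simp: gen_iff)
    then have "p' x = p x" if "x \<in> span (lat \<Delta>)" for x
      using polynomial_eq_of_gen[OF p'(2) p(1) _ that] by blast
    then show "f = restrict p (span (lat \<Delta>))" unfolding p'(1) by (auto simp: restrict_def)
  qed
  then show thesis using that[OF p(1)] p(2) by simp
qed

definition index_at_0 :: "mpoly set \<Rightarrow> complex" where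
  "index_at_0 X = index_map \<Delta> X 0"

lemma index_at_0_eqI:
  assumes "q \<in> carrier (poly_ring (nrays \<Delta>))" "polynomial_function p" "\<And>x. gen x \<Longrightarrow> index_sum q x = p x"
  shows "index_at_0 (HT_class \<Delta> q) = p 0"
proof -
  obtain p' where p': "polynomial_function p'" "\<And>x. gen x \<Longrightarrow> p' x = index_sum q x"
    "\<And>x. x \<in> span (lat \<Delta>) \<Longrightarrow> index_map \<Delta> (HT_class \<Delta> q) x = p' x"
    using index_map_class[OF assms(1)] by metis
  have "p' 0 = p 0" by (rule polynomial_eq_of_gen[OF p'(1) assms(2)]) (use p' assms(3) span_zero in auto)
  then show ?thesis using p'(3)[OF span_zero] by (simp add: index_at_0_def)
qed

lemma index_at_0_add:
  assumes "X \<in> carrier (HT \<Delta>)" "Y \<in> carrier (HT \<Delta>)"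
  shows "index_at_0 (X \<oplus>\<^bsub>HT \<Delta>\<^esub> Y) = index_at_0 X + index_at_0 Y"
proof -
  obtain q q' where q: "q \<in> carrier (poly_ring (nrays \<Delta>))" "X = HT_class \<Delta> q"
    "q' \<in> carrier (poly_ring (nrays \<Delta>))" "Y = HT_class \<Delta> q'"
    using assms unfolding carrier_HT by blast
  obtain p where p: "polynomial_function p" "\<And>x. gen x \<Longrightarrow> p x = index_sum q x"
    using index_map_class[OF q(1)] by metis
  obtain p' where p': "polynomial_function p'" "\<And>x. gen x \<Longrightarrow> p' x = index_sum q' x"
    using index_map_class[OF q(3)] by metis
  have "index_sum (q + q') x = p x + p' x" if "gen x" for x
    using that p(2) p'(2)
    by (simp add: index_sum_def mpoly_eval_add distrib_left add_divide_distrib sum.distrib)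
  then have "index_at_0 (HT_class \<Delta> (q + q')) = p 0 + p' 0"
    using q p p' by (intro index_at_0_eqI carrier_poly_ring_add polynomial_function_add)
  moreover have "index_at_0 X = p 0" "index_at_0 Y = p' 0"
    unfolding q using q p p' by (auto intro!: index_at_0_eqI)
  moreover have "X \<oplus>\<^bsub>HT \<Delta>\<^esub> Y = HT_class \<Delta> (q + q')"
    using ring_hom_add[OF HT_class_hom q(1,3)] q(2,4) by simp
  ultimately show ?thesis by simp
qed

text \<open>\<open>H\<^sup>*(BT)\<close>-linearity: multiplication by \<open>\<pi>\<^sup>*(u)\<close> becomes multiplication by the linear form \<open>u\<close>.\<close>

lemma lin_ideal_index:
  assumes "L \<in> lin_ideal \<Delta>" shows "L \<in> carrier (HT \<Delta>)" "index_at_0 L = 0"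
proof -
  let ?A = "{X \<in> carrier (HT \<Delta>). \<forall>Y\<in>carrier (HT \<Delta>). index_at_0 (X \<otimes>\<^bsub>HT \<Delta>\<^esub> Y) = 0}"
  have ideal: "ideal ?A (HT \<Delta>)" by (rule HT.annihilator_ideal[OF index_at_0_add])
  have "pi_star \<Delta> ` dual_lattice (lat \<Delta>) \<subseteq> ?A"
  proof safe
    fix u assume u: "u \<in> dual_lattice (lat \<Delta>)"
    define l where "l = (\<Sum>i\<in>{1..nrays \<Delta>}. mconst (complex_of_real (u \<bullet> ray_vec \<Delta> i)) * mvar i)"
    have l: "l \<in> carrier (poly_ring (nrays \<Delta>))"
      unfolding l_def by (intro carrier_poly_ring_sum carrier_poly_ring_mult carrier_poly_ring_const carrier_poly_ring_var)
    have pi: "pi_star \<Delta> u = HT_class \<Delta> l" by (simp add: pi_star_def l_def)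
    show "pi_star \<Delta> u \<in> carrier (HT \<Delta>)" using l by (simp add: pi carrier_HT)
    fix Y assume "Y \<in> carrier (HT \<Delta>)"
    then obtain q where q: "q \<in> carrier (poly_ring (nrays \<Delta>))" "Y = HT_class \<Delta> q" unfolding carrier_HT by blast
    have eval_l: "mpoly_eval (yc I x) l = complex_of_real (u \<bullet> x)" if I: "I \<in> facets \<Delta>" and x: "x \<in> span (lat \<Delta>)" for I x
    proof -
      have "mpoly_eval (yc I x) l = (\<Sum>i\<in>{1..nrays \<Delta>}. complex_of_real (u \<bullet> ray_vec \<Delta> i) * yc I x i)"
        by (simp add: l_def mpoly_eval_sum mpoly_eval_mult)
      also have "\<dots> = (\<Sum>i\<in>I. complex_of_real (u \<bullet> ray_vec \<Delta> i) * complex_of_real (dual_vec \<Delta> I i \<bullet> x))"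
        using facet_sub[OF I] by (intro sum.mono_neutral_cong_right) (auto simp: yc_def y_def)
      also have "\<dots> = complex_of_real (u \<bullet> (\<Sum>i\<in>I. (dual_vec \<Delta> I i \<bullet> x) *\<^sub>R ray_vec \<Delta> i))"
        by (simp add: inner_sum_right mult.commute)
      finally show ?thesis using expand[OF I x] by simp
    qed
    obtain p where p: "polynomial_function p" "\<And>x. gen x \<Longrightarrow> p x = index_sum q x"
      using index_map_class[OF q(1)] by metis
    have "index_sum (l * q) x = complex_of_real (u \<bullet> x) * p x" if x: "gen x" for x
    proof -
      have "index_sum (l * q) x = complex_of_real (u \<bullet> x) * index_sum q x"
        unfolding index_sum_def sum_distrib_left
        by (intro sum.cong) (simp_all add: mpoly_eval_mult eval_l genD(2)[OF x])
      then show ?thesis using p(2)[OF x] by simp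
    qed
    \<comment> \<open>At the origin the linear form u takes the value 0.\<close>
    then have "index_at_0 (HT_class \<Delta> (l * q)) = complex_of_real (u \<bullet> 0) * p 0"
      by (intro index_at_0_eqI carrier_poly_ring_mult l q(1) polynomial_function_cmult p(1)
          polynomial_function_inner_complex)
    moreover have "pi_star \<Delta> u \<otimes>\<^bsub>HT \<Delta>\<^esub> Y = HT_class \<Delta> (l * q)"
      unfolding pi q(2) using ring_hom_mult[OF HT_class_hom l q(1)] by simp
    ultimately show "index_at_0 (pi_star \<Delta> u \<otimes>\<^bsub>HT \<Delta>\<^esub> Y) = 0" by simp
  qed
  then have "lin_ideal \<Delta> \<subseteq> ?A"
    unfolding lin_ideal_def by (rule HT.genideal_minimal[OF ideal])
  then have L: "L \<in> carrier (HT \<Delta>)" "index_at_0 (L \<otimes>\<^bsub>HT \<Delta>\<^esub> \<one>\<^bsub>HT \<Delta>\<^esub>) = 0"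
    using assms HT.one_closed by auto
  then show "L \<in> carrier (HT \<Delta>)" "index_at_0 L = 0" by auto
qed

lemma fan_integral_class:
  assumes q: "q \<in> carrier (poly_ring (nrays \<Delta>))"
  shows "fan_integral \<Delta> (HH_class \<Delta> q) = index_at_0 (HT_class \<Delta> q)"
proof -
  have X: "HT_class \<Delta> q \<in> carrier (HT \<Delta>)" using q by (simp add: carrier_HT)
  have zero: "\<zero>\<^bsub>HT \<Delta>\<^esub> \<in> lin_ideal \<Delta>"
    by (rule additive_subgroup.zero_closed[OF ideal.axioms(1)[OF ideal_lin]])
  have "index_at_0 (L \<oplus>\<^bsub>HT \<Delta>\<^esub> HT_class \<Delta> q) = index_at_0 (HT_class \<Delta> q)" if "L \<in> lin_ideal \<Delta>" for L
    using index_at_0_add[OF lin_ideal_index(1)[OF that] X] lin_ideal_index(2)[OF that] by simp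
  moreover have "HH_class \<Delta> q = (\<lambda>L. L \<oplus>\<^bsub>HT \<Delta>\<^esub> HT_class \<Delta> q) ` lin_ideal \<Delta>"
    by (auto simp: HH_class_def a_r_coset_def')
  ultimately have "index_at_0 ` HH_class \<Delta> q = {index_at_0 (HT_class \<Delta> q)}"
    using zero by (force simp: image_image)
  then show ?thesis by (simp add: fan_integral_def index_at_0_def)
qed

text \<open>For q of degree n the index sum is homogeneous of degree 0, hence constant on the line
  through v without the origin. The polynomial that it equals is continuous, so it takes the same
  value at the origin.\<close>

lemma fan_integral_top_degree:
  assumes q: "q \<in> homog (nrays \<Delta>) (fan_dim \<Delta>)"
  shows "fan_integral \<Delta> (HH_class \<Delta> q) = index_sum q v"
proof -
  have qc: "q \<in> carrier (poly_ring (nrays \<Delta>))" using q by (rule homog_carrier)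
  obtain p where p: "polynomial_function p" "\<And>x. gen x \<Longrightarrow> p x = index_sum q x"
    using index_map_class[OF qc] by metis
  have scale: "p (s *\<^sub>R v) = index_sum q v" if s: "s \<noteq> 0" for s
  proof -
    have "gen (s *\<^sub>R v)" using gen_v s by (auto simp: gen_def span_scale)
    then have "p (s *\<^sub>R v) = index_sum q (s *\<^sub>R v)" by (rule p(2))
    also have "\<dots> = index_sum q v"
      unfolding index_sum_def
    proof (rule sum.cong)
      fix I assume I: "I \<in> facets \<Delta>"
      have "yc I (s *\<^sub>R v) = (\<lambda>i. complex_of_real s * yc I v i)" by (auto simp: yc_def y_def)
      then have "mpoly_eval (yc I (s *\<^sub>R v)) q = complex_of_real s ^ fan_dim \<Delta> * mpoly_eval (yc I v) q"
        using mpoly_eval_homog[OF q] by simp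
      moreover have "(\<Prod>i\<in>I. complex_of_real (dual_vec \<Delta> I i \<bullet> (s *\<^sub>R v))) =
          complex_of_real s ^ fan_dim \<Delta> * (\<Prod>i\<in>I. complex_of_real (dual_vec \<Delta> I i \<bullet> v))"
        by (simp add: prod.distrib card_facet[OF I])
      ultimately show "of_int (weight \<Delta> I) * mpoly_eval (yc I (s *\<^sub>R v)) q /
          (of_nat (card (par I)) * (\<Prod>i\<in>I. complex_of_real (dual_vec \<Delta> I i \<bullet> (s *\<^sub>R v)))) =
        of_int (weight \<Delta> I) * mpoly_eval (yc I v) q /
          (of_nat (card (par I)) * (\<Prod>i\<in>I. complex_of_real (dual_vec \<Delta> I i \<bullet> v)))"
        using s by simp
    qed simp
    finally show ?thesis .
  qed
  have "p (0 *\<^sub>R v) = index_sum q v"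
  proof (rule continuous_eq_on_dense[where f = "\<lambda>s. p (s *\<^sub>R v)" and g = "\<lambda>_. index_sum q v" and x = "0::real"])
    show "isCont (\<lambda>s. p (s *\<^sub>R v)) 0"
      by (rule isCont_o2[of 0 "\<lambda>s. s *\<^sub>R v" p])
        (auto intro: isCont_polynomial_function p(1) continuous_intros)
    show "\<exists>s. dist s 0 < e \<and> p (s *\<^sub>R v) = index_sum q v" if "e > 0" for e :: real
      using that scale[of "e / 2"] by (intro exI[of _ "e / 2"]) (auto simp: dist_real_def)
  qed simp
  then show ?thesis
    using fan_integral_class[OF qc] index_at_0_eqI[OF qc p(1)] p(2) by simp
qed

section \<open>Restriction of the Riemann-Roch class to a facet\<close>

lemma rho_torus_class:
  assumes "I \<in> facets \<Delta>" "a \<in> par I"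
  shows "rho i (torus_class (nrays \<Delta>) a) = unit_char (a i)"
proof -
  have "(\<lambda>b. unit_char (b i)) ` torus_class (nrays \<Delta>) a = (\<lambda>_. unit_char (a i)) ` torus_class (nrays \<Delta>) a"
    by (intro image_cong refl unit_char_cong) (simp add: torus_class_def)
  also have "\<dots> = {unit_char (a i)}"
    by (rule image_constant[OF torus_class_mem[OF par_real_space[OF assms]]])
  finally have "(\<lambda>b. unit_char (b i)) ` torus_class (nrays \<Delta>) a = {unit_char (a i)}" .
  then show ?thesis by (simp add: rho_def unit_char_def)
qed

text \<open>
  Under \<open>x\<^sub>i \<mapsto> u\<^sub>i\<close> (\<open>0\<close> for \<open>i \<notin> I\<close>) the summands of the Todd class at \<open>g \<notin> G\<^sub>I\<close> vanish, since some
  factor \<open>x / (1 - \<rho> e\<^sup>-\<^sup>x)\<close> with \<open>\<rho> \<noteq> 1\<close> is evaluated at \<open>0\<close>.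
\<close>

lemma RR_series_eval:
  assumes I: "I \<in> facets \<Delta>"
  shows "fps_eval (yc I v) (RR_series \<Delta> F) = RR_fps I"
proof -
  let ?T = "torus_class (nrays \<Delta>)"
  define fac where "fac \<rho> i = Abs_fps (\<lambda>k. fps_nth (todd_fps \<rho>) k * yc I v i ^ k)" for \<rho> i
  have fac_in: "fac \<rho> i = todd_fps \<rho> oo (fps_const (complex_of_real (dual_vec \<Delta> I i \<bullet> v)) * fps_X)"
    if "i \<in> I" for \<rho> i
    using that by (simp add: fac_def fps_compose_linear yc_def y_def mult.commute[of "fps_nth _ _"])
  have fac_out: "fac \<rho> i = (if \<rho> = 1 then 1 else 0)" if "i \<notin> I" for \<rho> i
    using that by (auto simp: fac_def fps_eq_iff yc_def y_def power_0_left todd_fps_nth_0 fps_one_nth)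
  have c1: "fps_eval (yc I v) (lin_subst (fps_exp 1) (c1_poly \<Delta> F)) =
      fps_exp (complex_of_real (vertex \<Delta> F I \<bullet> v))"
  proof -
    have vV: "v \<in> span (lat \<Delta>)" using genD(2)[OF gen_v] .
    have "mpoly_eval (yc I v) (c1_poly \<Delta> F) = (\<Sum>i\<in>{1..nrays \<Delta>}. complex_of_real (offset \<Delta> F i) * yc I v i)"
      by (simp add: c1_poly_def mpoly_eval_sum mpoly_eval_mult)
    \<comment> \<open>On I the offsets are the pairings of the vertex with the rays, so c_1
      restricts to the vertex as a linear form.\<close>
    also have "\<dots> = (\<Sum>i\<in>I. complex_of_real ((dual_vec \<Delta> I i \<bullet> v) * (vertex \<Delta> F I \<bullet> ray_vec \<Delta> i)))"
      using facet_sub[OF I] vertex_eq[OF I]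
      by (intro sum.mono_neutral_cong_right) (auto simp: yc_def y_def)
    also have "\<dots> = complex_of_real (vertex \<Delta> F I \<bullet> (\<Sum>i\<in>I. (dual_vec \<Delta> I i \<bullet> v) *\<^sub>R ray_vec \<Delta> i))"
      by (simp add: inner_sum_right)
    also have "\<dots> = complex_of_real (vertex \<Delta> F I \<bullet> v)" using expand[OF I vV] by simp
    finally show ?thesis by (simp add: fps_eval_lin_subst fps_eq_iff)
  qed
  have prod_in: "(\<Prod>i\<in>{1..nrays \<Delta>}. fac (rho i (?T a)) i) =
      (\<Prod>i\<in>I. todd_fps (unit_char (a i)) oo (fps_const (complex_of_real (dual_vec \<Delta> I i \<bullet> v)) * fps_X))"
    if a: "a \<in> par I" for a
  proof (rule prod.mono_neutral_cong_right)
    \<comment> \<open>Off I the coordinate of \<open>a\<close> is 0, so the character is 1 and the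
      Todd factor at argument 0 equals 1.\<close>
    show "\<forall>i\<in>{1..nrays \<Delta>} - I. fac (rho i (?T a)) i = 1"
      using a by (auto simp: fac_out rho_torus_class[OF I a] par_def)
  qed (use facet_sub[OF I] in \<open>auto simp: fac_in rho_torus_class[OF I a]\<close>)
  have prod_out: "(\<Prod>i\<in>{1..nrays \<Delta>}. fac (rho i g) i) = 0" if g: "g \<in> G_fan \<Delta> - GI \<Delta> I" for g
  proof -
    obtain J where J: "J \<in> facets \<Delta>" "g \<in> GI \<Delta> J" using g by (auto simp: G_fan_def)
    then obtain a where a: "a \<in> par J" "g = ?T a" unfolding GI_par[OF J(1)] by blast
    \<comment> \<open>If \<open>a\<close> were supported in I, it would represent an element of
      G_I.\<close>
    have "\<exists>i\<in>J - I. a i \<noteq> 0"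
    proof (rule ccontr)
      assume no: "\<not> (\<exists>i\<in>J - I. a i \<noteq> 0)"
      have "(\<Sum>i\<in>I. a i *\<^sub>R ray_vec \<Delta> i) = (\<Sum>i\<in>I \<inter> J. a i *\<^sub>R ray_vec \<Delta> i)"
        using a(1) finite_facet[OF I] by (intro sum.mono_neutral_right) (auto simp: par_def)
      also have "\<dots> = (\<Sum>i\<in>J. a i *\<^sub>R ray_vec \<Delta> i)"
        using no finite_facet[OF J(1)] by (intro sum.mono_neutral_left) auto
      finally have "a \<in> par I" using a(1) no by (auto simp: par_def)
      then show False using g a(2) GI_par[OF I] by blast
    qed
    then obtain i where i: "i \<in> J" "i \<notin> I" "a i \<noteq> 0" by blast
    have "a i \<notin> \<int>"
    proof
      assume "a i \<in> \<int>"
      moreover have "0 \<le> a i" "a i < 1" using a(1) i(1) by (auto simp: par_def)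
      ultimately show False using i(3) by (metis frac_eq frac_eq_0_iff)
    qed
    then have "fac (rho i g) i = 0"
      using i(2) by (simp add: fac_out a(2) rho_torus_class[OF J(1) a(1)] unit_char_eq_1_iff)
    then show ?thesis using facet_sub[OF J(1)] i(1) by (intro prod_zero) auto
  qed
  have fin: "finite (G_fan \<Delta>)"
    unfolding G_fan_def using finite_Fac finite_par by (auto simp: GI_par)
  have "fps_eval (yc I v) (\<Sum>g\<in>G_fan \<Delta>. \<Prod>i\<in>{1..nrays \<Delta>}. lin_subst (todd_fps (rho i g)) (mvar i)) =
      (\<Sum>g\<in>G_fan \<Delta>. \<Prod>i\<in>{1..nrays \<Delta>}. fac (rho i g) i)"
    by (simp add: fps_eval_sum fps_eval_prod fps_eval_lin_subst fac_def)
  also have "\<dots> = (\<Sum>g\<in>GI \<Delta> I. \<Prod>i\<in>{1..nrays \<Delta>}. fac (rho i g) i)"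
    using fin prod_out I by (intro sum.mono_neutral_right) (auto simp: G_fan_def)
  also have "\<dots> = (\<Sum>a\<in>par I. \<Prod>i\<in>{1..nrays \<Delta>}. fac (rho i (?T a)) i)"
    unfolding GI_par[OF I] by (subst sum.reindex) (auto intro: inj_onI torus_class_inj[OF I I])
  also have "\<dots> = (\<Sum>a\<in>par I. \<Prod>i\<in>I. todd_fps (unit_char (a i)) oo
      (fps_const (complex_of_real (dual_vec \<Delta> I i \<bullet> v)) * fps_X))"
    by (intro sum.cong refl prod_in)
  finally show ?thesis by (simp add: RR_series_def RR_fps_def fps_eval_mult c1 del: One_nat_def)
qed

text \<open>The vector v has two roles: it flips the cones in \<open>sharp\<close>, and it is the
  point at which the index sum of degree 0 is evaluated. The left-hand side does not mention v, so
  \<open>sharp \<Delta> F v\<close> is the same for all generic v.\<close>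

theorem Riemann_Roch:
  "fan_integral_hat \<Delta> (exp_c1 \<Delta> F \<otimes>\<^bsub>HHH \<Delta>\<^esub> todd_class \<Delta>) = of_int (sharp \<Delta> F v)"
proof -
  let ?q = "fps_nth (RR_series \<Delta> F) (fan_dim \<Delta>)"
  have q: "?q \<in> homog (nrays \<Delta>) (fan_dim \<Delta>)" using RR_series_graded by (auto simp: graded_def)
  have "fan_integral_hat \<Delta> (exp_c1 \<Delta> F \<otimes>\<^bsub>HHH \<Delta>\<^esub> todd_class \<Delta>) = index_sum ?q v"
    unfolding fan_integral_hat_def RR_class graded_class_def by (rule fan_integral_top_degree[OF q])
  also have "\<dots> = (\<Sum>I\<in>facets \<Delta>. of_int (weight \<Delta> I) /
      (of_nat (card (par I)) * (\<Prod>i\<in>I. complex_of_real (dual_vec \<Delta> I i \<bullet> v))) *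
      fps_nth (RR_fps I) (fan_dim \<Delta>))"
    unfolding index_sum_def by (intro sum.cong) (simp_all add: RR_series_eval[symmetric])
  also have "\<dots> = of_int (\<Sum>q | q \<in> dual_lattice (lat \<Delta>) \<and> count q \<noteq> 0. count q)"
    by (rule count_constant_term)
  also have "\<dots> = of_int (sharp \<Delta> F v)"
    by (simp add: sharp_count[OF polytope lattice_polytope generic_v])
  finally show ?thesis .
qed

end

theorem theorem8p5:
  fixes \<Delta> :: "('a::euclidean_space, nat set) multi_fan"
    and F :: "nat set \<Rightarrow> 'a set"
    and v :: 'a
  assumes "simple_multi_polytope \<Delta> F"
    and "lattice_multi_polytope \<Delta> F"
    and "generic \<Delta> v"
  shows "fan_integral_hat \<Delta> (exp_c1 \<Delta> F \<otimes>\<^bsub>HHH \<Delta>\<^esub> todd_class \<Delta>) = of_int (sharp \<Delta> F v)"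
  using assms by (rule Riemann_Roch)

end
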